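(* Let $G$ be a non-abelian finite group of order $p^n$, where $p>1$ is a prime number. Suppose that either $\operatorname{char}(K)=0$ or $\operatorname{char}(K)\nmid |G|$. Then the group algebra $KG$ admits a regular grading by some abelian group $T$.
   Context: $K$ is an algebraically closed field of characteristic different from $2$. For an abelian group $T$ (the paper considers finite abelian groups), a regular grading by $T$ on a $K$-algebra $R$ is a decomposition $R=\bigoplus_{t\in T}R_t$ into subspaces with $R_sR_t\subseteq R_{st}$ for all $s,t\in T$ such that: (1) for every $N\in\mathbb{N}$ and every $(t_1,\dots,t_N)\in T^N$ there exist $a_i\in R_{t_i}$ with $a_1\cdots a_N\neq 0$; (2) for all $s,t\in T$ there is a scalar $\theta(s,t)\in K^*$ such that $ab=\theta(s,t)ba$ for all $a\in R_s$, $b\in R_t$. *)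

theory Defs
  imports "HOL-Algebra.Algebraic_Closure_Type"
begin

section \<open>Associative algebras over a field\<close>

text \<open>The locale \<open>algebra\<close> of HOL-Algebra requires commutative algebras. Scalars
  form a type of class \<^class>\<open>field\<close>, seen as a ring record through
  \<^const>\<open>ring_of_type_algebra\<close>.\<close>

locale K_algebra =
  module "ring_of_type_algebra :: 'k::field ring" R + ring R
  for R :: "('k::field, 'r) module" (structure) +
  assumes smult_mult_left:
      "\<lbrakk>x \<in> carrier R; y \<in> carrier R\<rbrakk> \<Longrightarrow> (c \<odot> x) \<otimes> y = c \<odot> (x \<otimes> y)"
    and smult_mult_right:
      "\<lbrakk>x \<in> carrier R; y \<in> carrier R\<rbrakk> \<Longrightarrow> x \<otimes> (c \<odot> y) = c \<odot> (x \<otimes> y)"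


section \<open>Regular gradings\<close>

text \<open>In \<open>decomposition\<close>, \<open>f\<close> is the family of homogeneous components of \<open>r\<close>; it is
  finitely supported, and unique as an extensional function on the carrier of \<open>T\<close>. In
  \<open>regular\<close>, the lists \<open>ts\<close> and \<open>as\<close> are the tuples $(t_1,\dots,t_N)$ and
  $(a_1,\dots,a_N)$, and the fold is $a_1\cdots a_N$.\<close>

locale regular_grading =
  K_algebra R + T: comm_group T
  for R :: "('k::field, 'r) module" (structure) and T :: "'t monoid"
    and A :: "'t \<Rightarrow> 'r set" +
  assumes subspace:
      "t \<in> carrier T \<Longrightarrow> submodule (A t) (ring_of_type_algebra :: 'k ring) R"
    and decomposition:
      "r \<in> carrier R \<Longrightarrow>
        \<exists>!f. f \<in> (\<Pi>\<^sub>E t\<in>carrier T. A t) \<and> finite {t \<in> carrier T. f t \<noteq> \<zero>} \<and>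
             r = (\<Oplus>t\<in>{t \<in> carrier T. f t \<noteq> \<zero>}. f t)"
    and graded_mult:
      "\<lbrakk>s \<in> carrier T; t \<in> carrier T; a \<in> A s; b \<in> A t\<rbrakk> \<Longrightarrow> a \<otimes> b \<in> A (s \<otimes>\<^bsub>T\<^esub> t)"
    and regular:
      "set ts \<subseteq> carrier T \<Longrightarrow>
        \<exists>as. list_all2 (\<lambda>a t. a \<in> A t) as ts \<and> foldr (\<otimes>) as \<one> \<noteq> \<zero>"
    and commutation:
      "\<lbrakk>s \<in> carrier T; t \<in> carrier T\<rbrakk> \<Longrightarrow>
        \<exists>\<theta>::'k. \<theta> \<noteq> 0 \<and> (\<forall>a\<in>A s. \<forall>b\<in>A t. a \<otimes> b = \<theta> \<odot> (b \<otimes> a))"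


section \<open>Group algebras\<close>

text \<open>An element $\sum_x f(x)\,x$ of $KG$ is the finitely supported function \<open>f\<close>, which
  vanishes outside the carrier of \<open>G\<close>.\<close>

definition group_algebra :: "('g, 'm) monoid_scheme \<Rightarrow> ('k::field, 'g \<Rightarrow> 'k) module" where
  "group_algebra G =
    \<lparr>carrier = {f. finite {x. f x \<noteq> 0} \<and> {x. f x \<noteq> 0} \<subseteq> carrier G},
     monoid.mult = (\<lambda>f g x. \<Sum>(y, z) \<in> {(y, z). f y \<noteq> 0 \<and> g z \<noteq> 0 \<and> y \<otimes>\<^bsub>G\<^esub> z = x}. f y * g z),
     monoid.one = (\<lambda>x. if x = \<one>\<^bsub>G\<^esub> then 1 else 0),
     ring.zero = (\<lambda>x. 0),
     ring.add = (\<lambda>f g x. f x + g x),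
     module.smult = (\<lambda>c f x. c * f x)\<rparr>"

lemma group_algebra_mult_eq:
  assumes "finite S" "{y. f y \<noteq> 0} \<subseteq> S" "finite S'" "{z. g z \<noteq> 0} \<subseteq> S'"
  shows "(f \<otimes>\<^bsub>group_algebra G\<^esub> g) x =
    (\<Sum>y\<in>S. \<Sum>z\<in>S'. if y \<otimes>\<^bsub>G\<^esub> z = x then f y * g z else 0)"
proof -
  have "(\<Sum>y\<in>S. \<Sum>z\<in>S'. if y \<otimes>\<^bsub>G\<^esub> z = x then f y * g z else 0) =
    (\<Sum>(y,z)\<in>S \<times> S'. if y \<otimes>\<^bsub>G\<^esub> z = x then f y * g z else 0)"
    by (simp add: sum.cartesian_product)
  also have "\<dots> = (\<Sum>(y, z) \<in> {(y, z). f y \<noteq> 0 \<and> g z \<noteq> 0 \<and> y \<otimes>\<^bsub>G\<^esub> z = x}. f y * g z)"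
    using assms by (intro sum.mono_neutral_cong_right) (auto split: if_splits)
  finally show ?thesis by (simp add: group_algebra_def)
qed

lemma (in group) group_algebra_K_algebra:
  "K_algebra (group_algebra G :: ('k::field, 'a \<Rightarrow> 'k) module)"
proof -
  let ?R = "group_algebra G :: ('k, 'a \<Rightarrow> 'k) module"
  let ?K = "ring_of_type_algebra :: 'k ring"
  have memI: "f \<in> carrier ?R" if "finite S" "S \<subseteq> carrier G" "{x. f x \<noteq> 0} \<subseteq> S" for f S
    using that by (auto simp: group_algebra_def intro: finite_subset)
  have memD: "finite {x. f x \<noteq> 0}" "{x. f x \<noteq> 0} \<subseteq> carrier G" if "f \<in> carrier ?R" for f
    using that by (auto simp: group_algebra_def)
  have add: "f \<oplus>\<^bsub>?R\<^esub> g = (\<lambda>x. f x + g x)" for f g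
    by (simp add: group_algebra_def)
  have smult: "c \<odot>\<^bsub>?R\<^esub> f = (\<lambda>x. c * f x)" for c f
    by (simp add: group_algebra_def)
  have zero: "\<zero>\<^bsub>?R\<^esub> = (\<lambda>x. 0)" and one: "\<one>\<^bsub>?R\<^esub> = (\<lambda>x. if x = \<one> then 1 else 0)"
    by (simp_all add: group_algebra_def)
  have add_closed: "f \<oplus>\<^bsub>?R\<^esub> g \<in> carrier ?R" if "f \<in> carrier ?R" "g \<in> carrier ?R" for f g
    by (rule memI[of "{x. f x \<noteq> 0} \<union> {x. g x \<noteq> 0}"])
       (use memD[OF that(1)] memD[OF that(2)] in \<open>auto simp: add\<close>)
  have smult_closed: "c \<odot>\<^bsub>?R\<^esub> f \<in> carrier ?R" if "f \<in> carrier ?R" for c f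
    by (rule memI[of "{x. f x \<noteq> 0}"]) (use memD[OF that] in \<open>auto simp: smult\<close>)
  have one_closed: "\<one>\<^bsub>?R\<^esub> \<in> carrier ?R"
    by (rule memI[of "{\<one>}"]) (auto simp: one)
  have zero_closed: "\<zero>\<^bsub>?R\<^esub> \<in> carrier ?R"
    by (rule memI[of "{}"]) (auto simp: zero)
  have mult_supp: "{x. (f \<otimes>\<^bsub>?R\<^esub> g) x \<noteq> 0} \<subseteq>
      (\<lambda>(y,z). y \<otimes> z) ` ({x. f x \<noteq> 0} \<times> {x. g x \<noteq> 0})" for f g
  proof
    fix x assume "x \<in> {x. (f \<otimes>\<^bsub>?R\<^esub> g) x \<noteq> 0}"
    hence "(\<Sum>(y, z) \<in> {(y, z). f y \<noteq> 0 \<and> g z \<noteq> 0 \<and> y \<otimes> z = x}. f y * g z) \<noteq> 0"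
      by (simp add: group_algebra_def)
    then obtain p where "p \<in> {(y, z). f y \<noteq> 0 \<and> g z \<noteq> 0 \<and> y \<otimes> z = x}"
      by (rule sum.not_neutral_contains_not_neutral)
    thus "x \<in> (\<lambda>(y,z). y \<otimes> z) ` ({x. f x \<noteq> 0} \<times> {x. g x \<noteq> 0})"
      by force
  qed
  have mult_closed: "f \<otimes>\<^bsub>?R\<^esub> g \<in> carrier ?R" if "f \<in> carrier ?R" "g \<in> carrier ?R" for f g
    by (rule memI[OF _ _ mult_supp[of f g]])
       (use memD[OF that(1)] memD[OF that(2)] in auto)
  have assoc: "(f \<otimes>\<^bsub>?R\<^esub> g) \<otimes>\<^bsub>?R\<^esub> h = f \<otimes>\<^bsub>?R\<^esub> (g \<otimes>\<^bsub>?R\<^esub> h)"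
    if "f \<in> carrier ?R" "g \<in> carrier ?R" "h \<in> carrier ?R" for f g h
  proof
    fix x
    define F where "F = {x. f x \<noteq> 0}"
    define D where "D = {x. g x \<noteq> 0}"
    define H where "H = {x. h x \<noteq> 0}"
    note d = memD[OF that(1), folded F_def] memD[OF that(2), folded D_def]
      memD[OF that(3), folded H_def]
    let ?m = "\<lambda>(y,z). y \<otimes> z"
    have fin: "finite (?m ` (F \<times> D))" "finite (?m ` (D \<times> H))"
      using d by auto
    have "((f \<otimes>\<^bsub>?R\<^esub> g) \<otimes>\<^bsub>?R\<^esub> h) x =
      (\<Sum>w\<in>?m ` (F \<times> D). \<Sum>c\<in>H. if w \<otimes> c = x then (f \<otimes>\<^bsub>?R\<^esub> g) w * h c else 0)"
      by (rule group_algebra_mult_eq)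
         (use mult_supp[of f g] fin d in \<open>simp_all add: F_def D_def H_def\<close>)
    also have "\<dots> = (\<Sum>w\<in>?m ` (F \<times> D). \<Sum>c\<in>H. \<Sum>a\<in>F. \<Sum>b\<in>D.
        if a \<otimes> b = w then if w \<otimes> c = x then f a * g b * h c else 0 else 0)"
      using d by (intro sum.cong refl)
        (auto simp: group_algebra_mult_eq[of F f D g] F_def D_def sum_distrib_right
          intro!: sum.cong sum.neutral)
    also have "\<dots> = (\<Sum>c\<in>H. \<Sum>a\<in>F. \<Sum>b\<in>D. \<Sum>w\<in>?m ` (F \<times> D).
        if a \<otimes> b = w then if w \<otimes> c = x then f a * g b * h c else 0 else 0)"
      by (subst sum.swap, rule sum.cong[OF refl], subst sum.swap, rule sum.cong[OF refl],
          subst sum.swap, rule refl)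
    also have "\<dots> = (\<Sum>c\<in>H. \<Sum>a\<in>F. \<Sum>b\<in>D.
        if a \<otimes> b \<otimes> c = x then f a * g b * h c else 0)"
      using fin by (intro sum.cong refl) (subst sum.delta', auto)
    also have "\<dots> = (\<Sum>a\<in>F. \<Sum>b\<in>D. \<Sum>c\<in>H.
        if a \<otimes> b \<otimes> c = x then f a * g b * h c else 0)"
      by (subst sum.swap, rule sum.cong[OF refl], rule sum.swap)
    also have "\<dots> = (\<Sum>a\<in>F. \<Sum>b\<in>D. \<Sum>c\<in>H.
        if a \<otimes> (b \<otimes> c) = x then f a * g b * h c else 0)"
      using d by (intro sum.cong refl) (auto simp: subset_iff m_assoc)
    also have "\<dots> = (\<Sum>a\<in>F. \<Sum>b\<in>D. \<Sum>c\<in>H. \<Sum>w\<in>?m ` (D \<times> H).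
        if b \<otimes> c = w then if a \<otimes> w = x then f a * g b * h c else 0 else 0)"
      using fin by (intro sum.cong refl) (subst sum.delta', auto)
    also have "\<dots> = (\<Sum>a\<in>F. \<Sum>w\<in>?m ` (D \<times> H). \<Sum>b\<in>D. \<Sum>c\<in>H.
        if b \<otimes> c = w then if a \<otimes> w = x then f a * g b * h c else 0 else 0)"
      by (rule sum.cong[OF refl], subst (2) sum.swap, rule sum.cong[OF refl],
          subst sum.swap, rule refl)
    also have "\<dots> = (\<Sum>a\<in>F. \<Sum>w\<in>?m ` (D \<times> H).
        if a \<otimes> w = x then f a * (g \<otimes>\<^bsub>?R\<^esub> h) w else 0)"
      using d by (intro sum.cong refl)
        (auto simp: group_algebra_mult_eq[of D g H h] D_def H_def sum_distrib_left
          mult.assoc intro!: sum.cong sum.neutral)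
    also have "\<dots> = (f \<otimes>\<^bsub>?R\<^esub> (g \<otimes>\<^bsub>?R\<^esub> h)) x"
      by (rule group_algebra_mult_eq[symmetric])
         (use mult_supp[of g h] fin d in \<open>simp_all add: F_def D_def H_def\<close>)
    finally show "((f \<otimes>\<^bsub>?R\<^esub> g) \<otimes>\<^bsub>?R\<^esub> h) x = (f \<otimes>\<^bsub>?R\<^esub> (g \<otimes>\<^bsub>?R\<^esub> h)) x" .
  qed
  have l_one: "\<one>\<^bsub>?R\<^esub> \<otimes>\<^bsub>?R\<^esub> f = f" if "f \<in> carrier ?R" for f
  proof
    fix x
    have "(\<one>\<^bsub>?R\<^esub> \<otimes>\<^bsub>?R\<^esub> f) x =
      (\<Sum>y\<in>{\<one>}. \<Sum>z\<in>{x. f x \<noteq> 0}. if y \<otimes> z = x then \<one>\<^bsub>?R\<^esub> y * f z else 0)"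
      using memD[OF that] by (intro group_algebra_mult_eq) (auto simp: one)
    also have "\<dots> = (\<Sum>z\<in>{x. f x \<noteq> 0}. if z = x then f z else 0)"
      using memD[OF that] by (auto simp: one subset_iff intro!: sum.cong)
    finally show "(\<one>\<^bsub>?R\<^esub> \<otimes>\<^bsub>?R\<^esub> f) x = f x"
      using memD[OF that] by (simp add: sum.delta)
  qed
  have r_one: "f \<otimes>\<^bsub>?R\<^esub> \<one>\<^bsub>?R\<^esub> = f" if "f \<in> carrier ?R" for f
  proof
    fix x
    have "(f \<otimes>\<^bsub>?R\<^esub> \<one>\<^bsub>?R\<^esub>) x =
      (\<Sum>y\<in>{x. f x \<noteq> 0}. \<Sum>z\<in>{\<one>}. if y \<otimes> z = x then f y * \<one>\<^bsub>?R\<^esub> z else 0)"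
      using memD[OF that] by (intro group_algebra_mult_eq) (auto simp: one)
    also have "\<dots> = (\<Sum>z\<in>{x. f x \<noteq> 0}. if z = x then f z else 0)"
      using memD[OF that] by (auto simp: one subset_iff intro!: sum.cong)
    finally show "(f \<otimes>\<^bsub>?R\<^esub> \<one>\<^bsub>?R\<^esub>) x = f x"
      using memD[OF that] by (simp add: sum.delta)
  qed
  have l_distr: "(f \<oplus>\<^bsub>?R\<^esub> g) \<otimes>\<^bsub>?R\<^esub> h = (f \<otimes>\<^bsub>?R\<^esub> h) \<oplus>\<^bsub>?R\<^esub> (g \<otimes>\<^bsub>?R\<^esub> h)"
    and r_distr: "h \<otimes>\<^bsub>?R\<^esub> (f \<oplus>\<^bsub>?R\<^esub> g) = (h \<otimes>\<^bsub>?R\<^esub> f) \<oplus>\<^bsub>?R\<^esub> (h \<otimes>\<^bsub>?R\<^esub> g)"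
    if m: "f \<in> carrier ?R" "g \<in> carrier ?R" "h \<in> carrier ?R" for f g h
  proof -
    define S where "S = {x. f x \<noteq> 0} \<union> {x. g x \<noteq> 0} \<union> {x. h x \<noteq> 0}"
    have S: "finite S" using m by (simp add: S_def memD)
    have e: "(u \<otimes>\<^bsub>?R\<^esub> v) x = (\<Sum>y\<in>S. \<Sum>z\<in>S. if y \<otimes> z = x then u y * v z else 0)"
      if "{x. u x \<noteq> 0} \<subseteq> S" "{x. v x \<noteq> 0} \<subseteq> S" for u v x
      by (intro group_algebra_mult_eq S that)
    have s: "{x. f x \<noteq> 0} \<subseteq> S" "{x. g x \<noteq> 0} \<subseteq> S" "{x. h x \<noteq> 0} \<subseteq> S"
      "{x. (f \<oplus>\<^bsub>?R\<^esub> g) x \<noteq> 0} \<subseteq> S"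
      by (auto simp: S_def add)
    show "(f \<oplus>\<^bsub>?R\<^esub> g) \<otimes>\<^bsub>?R\<^esub> h = (f \<otimes>\<^bsub>?R\<^esub> h) \<oplus>\<^bsub>?R\<^esub> (g \<otimes>\<^bsub>?R\<^esub> h)"
      unfolding add[of "f \<otimes>\<^bsub>?R\<^esub> h"] e[OF s(4) s(3)] e[OF s(1) s(3)] e[OF s(2) s(3)] fun_eq_iff
      by (auto simp: add sum.distrib[symmetric] algebra_simps intro!: sum.cong)
    show "h \<otimes>\<^bsub>?R\<^esub> (f \<oplus>\<^bsub>?R\<^esub> g) = (h \<otimes>\<^bsub>?R\<^esub> f) \<oplus>\<^bsub>?R\<^esub> (h \<otimes>\<^bsub>?R\<^esub> g)"
      unfolding add[of "h \<otimes>\<^bsub>?R\<^esub> f"] e[OF s(3) s(4)] e[OF s(3) s(1)] e[OF s(3) s(2)] fun_eq_iff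
      by (auto simp: add sum.distrib[symmetric] algebra_simps intro!: sum.cong)
  qed
  have sl: "(c \<odot>\<^bsub>?R\<^esub> f) \<otimes>\<^bsub>?R\<^esub> g = c \<odot>\<^bsub>?R\<^esub> (f \<otimes>\<^bsub>?R\<^esub> g)"
    and sr: "f \<otimes>\<^bsub>?R\<^esub> (c \<odot>\<^bsub>?R\<^esub> g) = c \<odot>\<^bsub>?R\<^esub> (f \<otimes>\<^bsub>?R\<^esub> g)"
    if m: "f \<in> carrier ?R" "g \<in> carrier ?R" for c f g
  proof -
    define S where "S = {x. f x \<noteq> 0} \<union> {x. g x \<noteq> 0}"
    have S: "finite S" using m by (simp add: S_def memD)
    have e: "(u \<otimes>\<^bsub>?R\<^esub> v) x = (\<Sum>y\<in>S. \<Sum>z\<in>S. if y \<otimes> z = x then u y * v z else 0)"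
      if "{x. u x \<noteq> 0} \<subseteq> S" "{x. v x \<noteq> 0} \<subseteq> S" for u v x
      by (intro group_algebra_mult_eq S that)
    have s: "{x. f x \<noteq> 0} \<subseteq> S" "{x. g x \<noteq> 0} \<subseteq> S"
      "{x. (c \<odot>\<^bsub>?R\<^esub> f) x \<noteq> 0} \<subseteq> S" "{x. (c \<odot>\<^bsub>?R\<^esub> g) x \<noteq> 0} \<subseteq> S"
      by (auto simp: S_def smult)
    show "(c \<odot>\<^bsub>?R\<^esub> f) \<otimes>\<^bsub>?R\<^esub> g = c \<odot>\<^bsub>?R\<^esub> (f \<otimes>\<^bsub>?R\<^esub> g)"
      unfolding smult[of c "f \<otimes>\<^bsub>?R\<^esub> g"] e[OF s(3) s(2)] e[OF s(1) s(2)] fun_eq_iff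
      by (auto simp: smult sum_distrib_left mult.assoc intro!: sum.cong sum.neutral)
    show "f \<otimes>\<^bsub>?R\<^esub> (c \<odot>\<^bsub>?R\<^esub> g) = c \<odot>\<^bsub>?R\<^esub> (f \<otimes>\<^bsub>?R\<^esub> g)"
      unfolding smult[of c "f \<otimes>\<^bsub>?R\<^esub> g"] e[OF s(1) s(4)] e[OF s(1) s(2)] fun_eq_iff
      by (auto simp: smult sum_distrib_left mult.left_commute intro!: sum.cong)
  qed
  have ab: "abelian_group ?R"
  proof (rule abelian_groupI)
    fix f assume f: "f \<in> carrier ?R"
    show "\<exists>g\<in>carrier ?R. g \<oplus>\<^bsub>?R\<^esub> f = \<zero>\<^bsub>?R\<^esub>"
      by (rule bexI[OF _ smult_closed[OF f, of "-1"]]) (simp add: add smult zero)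
  qed (use add_closed zero_closed in \<open>auto simp: add zero algebra_simps\<close>)
  have ring: "ring ?R"
    by (rule ringI[OF ab]) (auto intro: monoidI mult_closed one_closed assoc l_one r_one
        l_distr r_distr)
  have mod: "module ?K ?R"
    by (rule moduleI[OF cring_from_type_algebra ab smult_closed])
       (auto simp: ring_of_type_algebra_def add smult algebra_simps)
  show ?thesis
    by (intro K_algebra.intro K_algebra_axioms.intro ring mod sl sr)
qed

end

theory Submission
  imports Defs "HOL-Library.Function_Algebras" "HOL-Algebra.Sylow"
begin

text \<open>
Over an algebraically closed field whose characteristic does not divide $|G| = p^n$, the group
algebra $KG$ is a direct sum of matrix algebras whose sizes are powers of $p$. The matrix algebra
of size $p^k$, with rows indexed by $V_k = (\<int>/p)^k$ and with a primitive $p$-th root of unity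
$\zeta$, is spanned by the generalised Pauli matrices
$X_{u,v} = \sum_{w \in V_k} \zeta^{v \cdot w} E_{w,w+u}$, and
$X_{u,v} X_{u',v'} = \zeta^{v' \cdot u} X_{u+u',v+v'}$. So it is graded by $V_k \times V_k$, and
homogeneous elements commute up to $\zeta^{v' \cdot u - v \cdot u'}$. This factor does not
change when $V_k$ is embedded in a larger $V_l$ as the first $k$ coordinates. Hence all blocks of
$KG$ can be graded by the group $T = V_r \times V_r$ of the largest block: a smaller block
occupies a subgroup of the degrees, the commutation factor is the same in every block, and
elements of different blocks annihilate each other. The largest block has a Pauli matrix in every
degree, and products of Pauli matrices are nonzero multiples of Pauli matrices, so the grading is
regular.

That $KG$ is such a sum is proved by induction along a chain of subgroups. A $p$-group $H \neq 1$
has a subgroup $N$ of index $p$ (Sylow), it is normal (\<open>prime_index_normal\<close>), and $KH$ is the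
crossed product of $KN$ with the powers of an element $g \in H$ outside $N$. Conjugation by $g$
permutes the blocks of $KN$ in orbits of size $1$ or $p$. An orbit of size $p$ merges into a single
block that is $p$ times as large (\<open>splits_moved_block\<close>). On a block with identity $e$ that is
invariant, $g$ acts as an inner automorphism by the Skolem-Noether theorem, so $g$ can be corrected
to an element $z$ that centralises the block; $z^p$ is a nonzero scalar, and the block becomes $p$
copies of itself, one for each $p$-th root of that scalar (\<open>splits_fixed_block\<close>). In both cases
the sizes stay powers of $p$.
\<close>

section \<open>Associative algebras and matrix units\<close>

text \<open>The multiplication is total and has no distinguished unit. Subalgebras such as $KN$, a block, or
  $eR$ for a central idempotent $e$ are then plain subspaces, each with an identity of its own.\<close>

locale assoc_algebra = vector_space scale
  for scale :: "'k::field \<Rightarrow> 'a::ab_group_add \<Rightarrow> 'a" (infixr \<open>*s\<close> 75) +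
  fixes mul :: "'a \<Rightarrow> 'a \<Rightarrow> 'a" (infixl \<open>\<star>\<close> 76)
  assumes mul_assoc: "x \<star> y \<star> z = x \<star> (y \<star> z)"
    and mul_add_left: "(x + y) \<star> z = x \<star> z + y \<star> z"
    and mul_add_right: "x \<star> (y + z) = x \<star> y + x \<star> z"
    and mul_scale_left: "(c *s x) \<star> y = c *s (x \<star> y)"
    and mul_scale_right: "x \<star> (c *s y) = c *s (x \<star> y)"
begin

lemma mul_zero_left [simp]: "0 \<star> x = 0"
  using mul_add_left[of 0 0 x] by simp

lemma mul_zero_right [simp]: "x \<star> 0 = 0"
  using mul_add_right[of x 0 0] by simp

lemma mul_sum_left: "sum f A \<star> y = (\<Sum>a\<in>A. f a \<star> y)"
  by (induction A rule: infinite_finite_induct) (simp_all add: mul_add_left)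

lemma mul_sum_right: "y \<star> sum f A = (\<Sum>a\<in>A. y \<star> f a)"
  by (induction A rule: infinite_finite_induct) (simp_all add: mul_add_right)

lemma subspace_mul_right_preimage: "subspace V \<Longrightarrow> subspace {x. x \<star> y \<in> V}"
  by (auto simp: subspace_def mul_add_left mul_scale_left)

lemma subspace_mul_left_preimage: "subspace V \<Longrightarrow> subspace {x. y \<star> x \<in> V}"
  by (auto simp: subspace_def mul_add_right mul_scale_right)

lemma span_mul_right:
  assumes "x \<in> span A" "subspace V" "\<And>a. a \<in> A \<Longrightarrow> a \<star> y \<in> V"
  shows "x \<star> y \<in> V"
  using span_minimal[OF _ subspace_mul_right_preimage[OF assms(2), of y], of A] assms(1,3)
  by blast

lemma span_mul_left:
  assumes "x \<in> span A" "subspace V" "\<And>a. a \<in> A \<Longrightarrow> y \<star> a \<in> V"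
  shows "y \<star> x \<in> V"
  using span_minimal[OF _ subspace_mul_left_preimage[OF assms(2), of y], of A] assms(1,3)
  by blast

lemma span_mul:
  assumes "x \<in> span A" "y \<in> span B" "subspace V" "\<And>a b. a \<in> A \<Longrightarrow> b \<in> B \<Longrightarrow> a \<star> b \<in> V"
  shows "x \<star> y \<in> V"
  by (rule span_mul_right[OF assms(1,3)], rule span_mul_left[OF assms(2,3)], rule assms(4))

lemma span_commute:
  assumes "x \<in> span A" and "\<And>a. a \<in> A \<Longrightarrow> b \<star> a = a \<star> b"
  shows "b \<star> x = x \<star> b"
proof -
  have "subspace {x. b \<star> x = x \<star> b}"
    by (auto simp: subspace_def mul_add_left mul_scale_left mul_add_right mul_scale_right)
  from span_minimal[OF _ this, of A] assms show ?thesis by blast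
qed

end

text \<open>The elements $E_{ij}$ are linearly independent by the multiplication rule, so their span is
  a full matrix algebra inside the ambient one.\<close>

locale matrix_units = assoc_algebra +
  fixes J :: "'i set" and E :: "'i \<Rightarrow> 'i \<Rightarrow> 'b"
  assumes finite_index: "finite J"
    and unit_mul: "\<lbrakk>i \<in> J; j \<in> J; l \<in> J; m \<in> J\<rbrakk> \<Longrightarrow>
      E i j \<star> E l m = (if j = l then E i m else 0)"
    and unit_nonzero: "\<lbrakk>i \<in> J; j \<in> J\<rbrakk> \<Longrightarrow> E i j \<noteq> 0"
begin

definition entries :: "'b set" where
  "entries = (\<lambda>(i, j). E i j) ` (J \<times> J)"

text \<open>The identity of the spanned matrix algebra; in the ambient algebra it is only an
  idempotent.\<close>

definition ident :: 'b where
  "ident = (\<Sum>i\<in>J. E i i)"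

lemma entriesI: "i \<in> J \<Longrightarrow> j \<in> J \<Longrightarrow> E i j \<in> entries"
  by (force simp: entries_def)

lemma entriesE:
  assumes "x \<in> entries"
  obtains i j where "i \<in> J" "j \<in> J" "x = E i j"
  using assms by (auto simp: entries_def)

lemma entry_in_span: "i \<in> J \<Longrightarrow> j \<in> J \<Longrightarrow> E i j \<in> span entries"
  by (intro span_base entriesI)

lemma ident_mul_unit: "i \<in> J \<Longrightarrow> j \<in> J \<Longrightarrow> ident \<star> E i j = E i j"
  by (simp add: ident_def mul_sum_left unit_mul finite_index)

lemma unit_mul_ident: "i \<in> J \<Longrightarrow> j \<in> J \<Longrightarrow> E i j \<star> ident = E i j"
proof -
  assume *: "i \<in> J" "j \<in> J"
  have "E i j \<star> ident = (\<Sum>l\<in>J. if j = l then E i l else 0)"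
    unfolding ident_def mul_sum_right by (rule sum.cong) (auto simp: unit_mul *)
  thus ?thesis using * by (simp add: finite_index)
qed

lemma ident_mul: "x \<in> span entries \<Longrightarrow> ident \<star> x = x"
  by (rule span_induct_alt, simp) (auto simp: entries_def ident_mul_unit mul_add_right mul_scale_right)

lemma mul_ident: "x \<in> span entries \<Longrightarrow> x \<star> ident = x"
  by (rule span_induct_alt, simp) (auto simp: entries_def unit_mul_ident mul_add_left mul_scale_left)

lemma ident_in_span: "ident \<in> span entries"
  unfolding ident_def by (intro span_sum entry_in_span)

lemma ident_idem: "ident \<star> ident = ident"
  by (rule ident_mul[OF ident_in_span])

lemma ident_nonzero: "J \<noteq> {} \<Longrightarrow> ident \<noteq> 0"
  using ident_mul_unit unit_nonzero by (metis ex_in_conv mul_zero_left)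

lemma span_entries_mul: "x \<in> span entries \<Longrightarrow> y \<in> span entries \<Longrightarrow> x \<star> y \<in> span entries"
  by (erule span_mul, assumption, rule subspace_span)
     (auto elim!: entriesE simp: unit_mul intro: span_zero entry_in_span)

text \<open>The scalar is the entry of \<open>x\<close> in row \<open>i\<close> and column \<open>j\<close>, which does not depend on the row
  and column to which the outer units move it.\<close>

lemma unit_sandwich:
  assumes "x \<in> span entries" "i \<in> J" "j \<in> J"
  shows "\<exists>c. \<forall>a\<in>J. \<forall>b\<in>J. E a i \<star> x \<star> E j b = c *s E a b"
  using assms(1)
proof (induction rule: span_induct_alt)
  case base
  show ?case by (rule exI[of _ 0]) simp
next
  case (step c x y)
  then obtain d where d: "\<forall>a\<in>J. \<forall>b\<in>J. E a i \<star> y \<star> E j b = d *s E a b" by blast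
  from step obtain l m where x: "x = E l m" "l \<in> J" "m \<in> J" by (auto simp: entries_def)
  have "E a i \<star> (c *s x + y) \<star> E j b = (d + (if i = l \<and> m = j then c else 0)) *s E a b"
    if "a \<in> J" "b \<in> J" for a b
  proof -
    have "E a i \<star> (c *s x + y) \<star> E j b = c *s (E a i \<star> E l m \<star> E j b) + d *s E a b"
      using d that by (simp add: x(1) mul_add_left mul_add_right mul_scale_left mul_scale_right)
    moreover have "E a i \<star> E l m \<star> E j b = (if i = l \<and> m = j then E a b else 0)"
      using that x(2,3) assms(2,3) by (cases "i = l") (simp_all add: unit_mul)
    ultimately show ?thesis by (simp add: scale_left_distrib)
  qed
  thus ?case by blast
qed

text \<open>A central element satisfies $z = \sum_i E_{i1} z E_{1i}$, so it is determined by its single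
  entry in position $(1,1)$.\<close>

lemma central_is_scalar:
  assumes z: "z \<in> span entries" and comm: "\<And>x. x \<in> entries \<Longrightarrow> z \<star> x = x \<star> z"
  shows "\<exists>c. z = c *s ident"
proof (cases "J = {}")
  case True
  have "entries = {}" unfolding entries_def by (simp add: True)
  with z have "z = 0" by simp
  thus ?thesis by (intro exI[of _ 0]) simp
next
  case False
  then obtain o' where o: "o' \<in> J" by blast
  obtain c where c: "E i o' \<star> z \<star> E o' i = c *s E i i" if "i \<in> J" for i
    using unit_sandwich[OF z o o] by blast
  have "z = ident \<star> z" using ident_mul[OF z] by simp
  also have "\<dots> = (\<Sum>i\<in>J. E i o' \<star> z \<star> E o' i)"
    unfolding ident_def mul_sum_left
  proof (rule sum.cong[OF refl])
    fix i assume i: "i \<in> J"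
    have "E i o' \<star> z \<star> E o' i = E i o' \<star> E o' i \<star> z"
      using comm[OF entriesI[OF o i]] by (simp add: mul_assoc)
    thus "E i i \<star> z = E i o' \<star> z \<star> E o' i" using i o by (simp add: unit_mul)
  qed
  also have "\<dots> = c *s ident"
    unfolding ident_def scale_sum_right by (rule sum.cong) (auto intro: c)
  finally show ?thesis by blast
qed

text \<open>Given a second system $F$ of matrix units with the same span, an intertwiner has the form
  $u = \sum_l F_{l1} y E_{1l}$ for some nonzero $y$ in $F_{11} M E_{11}$, and likewise
  $v = \sum_l E_{l1} y' F_{1l}$ in the other direction. Then $vu$ is a scalar $\kappa$, which a
  suitable $y'$ makes nonzero. The product $uv$ commutes with the common span and is idempotent, so
  it is the identity too.\<close>

theorem skolem_noether:
  assumes ne: "J \<noteq> {}"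
    and F: "\<And>i j. i \<in> J \<Longrightarrow> j \<in> J \<Longrightarrow> F i j \<in> span entries"
    and F_mul: "\<And>i j l m. \<lbrakk>i \<in> J; j \<in> J; l \<in> J; m \<in> J\<rbrakk> \<Longrightarrow>
      F i j \<star> F l m = (if j = l then F i m else 0)"
    and F_nz: "\<And>i j. i \<in> J \<Longrightarrow> j \<in> J \<Longrightarrow> F i j \<noteq> 0"
    and F_span: "entries \<subseteq> span ((\<lambda>(i, j). F i j) ` (J \<times> J))"
  obtains u v where "u \<in> span entries" "v \<in> span entries" "u \<star> v = ident" "v \<star> u = ident"
    "\<And>i j. i \<in> J \<Longrightarrow> j \<in> J \<Longrightarrow> u \<star> E i j = F i j \<star> u"
    "\<And>i j. i \<in> J \<Longrightarrow> j \<in> J \<Longrightarrow> v \<star> F i j = E i j \<star> v"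
proof -
  obtain o' where o: "o' \<in> J" using ne by blast
  obtain i where i: "i \<in> J" "F o' o' \<star> E i i \<noteq> 0"
  proof -
    have "F o' o' = (\<Sum>i\<in>J. F o' o' \<star> E i i)"
      using mul_ident[OF F[OF o o]] by (simp add: ident_def mul_sum_right)
    with F_nz[OF o o] have "(\<Sum>i\<in>J. F o' o' \<star> E i i) \<noteq> 0" by simp
    thus ?thesis by (rule sum.not_neutral_contains_not_neutral) (rule that)
  qed
  let ?y = "F o' o' \<star> E i o'"
  have y: "?y \<in> span entries" by (intro span_entries_mul F o i entry_in_span)
  have "?y \<star> E o' i = F o' o' \<star> E i i" using o i by (simp add: mul_assoc unit_mul)
  with i have "?y \<noteq> 0" by (metis mul_zero_left)
  hence "(\<Sum>j\<in>J. E j j \<star> ?y) \<noteq> 0"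
    using ident_mul[OF y] by (simp add: ident_def mul_sum_left)
  \<comment> \<open>Here \<open>y\<close> is \<open>F o' o' \<star> E i o'\<close>; a nonzero row \<open>j\<close> of it provides \<open>y'\<close>.\<close>
  then obtain j where j: "j \<in> J" "E j j \<star> ?y \<noteq> 0"
    by (rule sum.not_neutral_contains_not_neutral)
  have "E j o' \<star> (E o' j \<star> ?y) = E j j \<star> ?y" using o j by (simp add: mul_assoc[symmetric] unit_mul)
  with j have nz: "E o' j \<star> ?y \<noteq> 0" by (metis mul_zero_right)
  obtain \<kappa> where \<kappa>: "E a j \<star> F o' o' \<star> E i b = \<kappa> *s E a b" if "a \<in> J" "b \<in> J" for a b
    using unit_sandwich[OF F[OF o o] j(1) i(1)] by blast
  have \<kappa>0: "\<kappa> \<noteq> 0" using nz \<kappa>[OF o o] by (auto simp: mul_assoc)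
  define u where "u = (\<Sum>l\<in>J. F l o' \<star> E i l)"
  define v where "v = inverse \<kappa> *s (\<Sum>l\<in>J. E l j \<star> F o' l)"
  have u: "u \<in> span entries" unfolding u_def
    by (intro span_sum span_entries_mul F o i entry_in_span)
  have v: "v \<in> span entries" unfolding v_def
    by (intro span_sum span_scale span_entries_mul F o j entry_in_span)
  have uE: "u \<star> E a b = F a b \<star> u" if ab: "a \<in> J" "b \<in> J" for a b
  proof -
    have "u \<star> E a b = (\<Sum>l\<in>J. if l = a then F l o' \<star> E i b else 0)"
      unfolding u_def mul_sum_left
      by (rule sum.cong) (use ab i in \<open>auto simp: mul_assoc unit_mul\<close>)
    moreover have "F a b \<star> u = (\<Sum>l\<in>J. if l = b then F a o' \<star> E i l else 0)"
      unfolding u_def mul_sum_right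
      by (rule sum.cong) (use ab o in \<open>auto simp: mul_assoc[symmetric] F_mul\<close>)
    ultimately show ?thesis using ab by (simp add: finite_index)
  qed
  have vF: "v \<star> F a b = E a b \<star> v" if ab: "a \<in> J" "b \<in> J" for a b
  proof -
    have "(\<Sum>l\<in>J. E l j \<star> F o' l) \<star> F a b = (\<Sum>l\<in>J. if l = a then E l j \<star> F o' b else 0)"
      unfolding mul_sum_left
      by (rule sum.cong) (use ab o in \<open>auto simp: mul_assoc F_mul\<close>)
    moreover have "E a b \<star> (\<Sum>l\<in>J. E l j \<star> F o' l) = (\<Sum>l\<in>J. if l = b then E a j \<star> F o' l else 0)"
      unfolding mul_sum_right
      by (rule sum.cong) (use ab j in \<open>auto simp: mul_assoc[symmetric] unit_mul\<close>)
    ultimately show ?thesis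
      using ab by (simp add: finite_index v_def mul_scale_left mul_scale_right)
  qed
  have vu: "v \<star> u = ident"
  proof -
    have "(\<Sum>l\<in>J. E l j \<star> F o' l) \<star> u = (\<Sum>l\<in>J. \<Sum>m\<in>J. if l = m then E l j \<star> F o' o' \<star> E i m else 0)"
      unfolding mul_sum_left unfolding u_def mul_sum_right
    proof (intro sum.cong refl)
      fix l m assume lm: "l \<in> J" "m \<in> J"
      have "E l j \<star> F o' l \<star> (F m o' \<star> E i m) = E l j \<star> (F o' l \<star> F m o') \<star> E i m"
        by (simp add: mul_assoc)
      thus "E l j \<star> F o' l \<star> (F m o' \<star> E i m) = (if l = m then E l j \<star> F o' o' \<star> E i m else 0)"
        using lm o by (simp add: F_mul)
    qed
    also have "\<dots> = \<kappa> *s ident"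
      using finite_index by (simp add: ident_def scale_sum_right \<kappa>)
    finally show ?thesis using \<kappa>0 by (simp add: v_def mul_scale_left)
  qed
  have "\<exists>c. u \<star> v = c *s ident"
  proof (rule central_is_scalar)
    show "u \<star> v \<in> span entries" by (intro span_entries_mul u v)
    fix x assume "x \<in> entries"
    hence "x \<in> span ((\<lambda>(i, j). F i j) ` (J \<times> J))" using F_span by blast
    thus "u \<star> v \<star> x = x \<star> (u \<star> v)"
    proof (rule span_commute)
      fix y assume "y \<in> (\<lambda>(i, j). F i j) ` (J \<times> J)"
      then obtain a b where ab: "a \<in> J" "b \<in> J" and y: "y = F a b" by auto
      have "u \<star> v \<star> F a b = u \<star> E a b \<star> v" by (simp add: mul_assoc vF[OF ab])
      also have "\<dots> = F a b \<star> (u \<star> v)" by (simp add: uE[OF ab] mul_assoc)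
      finally show "u \<star> v \<star> y = y \<star> (u \<star> v)" by (simp add: y)
    qed
  qed
  then obtain c where c: "u \<star> v = c *s ident" by blast
  have "u \<star> v = u \<star> (v \<star> u) \<star> v" by (simp add: vu mul_ident[OF u])
  also have "\<dots> = (u \<star> v) \<star> (u \<star> v)" by (simp add: mul_assoc)
  finally have "c *s ident = (c * c) *s ident"
    unfolding c by (simp add: mul_scale_left mul_scale_right ident_idem)
  moreover have "c \<noteq> 0"
  proof
    assume "c = 0"
    hence "v \<star> (u \<star> v) \<star> u = 0" using c by simp
    moreover have "v \<star> (u \<star> v) \<star> u = (v \<star> u) \<star> (v \<star> u)" by (simp add: mul_assoc)
    ultimately show False using ident_nonzero[OF ne] by (simp add: vu ident_idem)
  qed
  ultimately have "c = 1" using ident_nonzero[OF ne] by auto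
  hence uv: "u \<star> v = ident" using c by simp
  show ?thesis by (rule that[OF u v uv vu uE vF])
qed

end

section \<open>Sums of matrix algebras of prime power size\<close>

text \<open>Vectors over $\<int>/p$ with \<open>k\<close> coordinates, continued by zeros. Thus \<open>words p k\<close> is literally
  a subset of \<open>words p l\<close> for $k \le l$ and $p > 0$, which embeds the degrees of a small block into those
  of a large one.\<close>

definition words :: "nat \<Rightarrow> nat \<Rightarrow> (nat \<Rightarrow> nat) set" where
  "words p k = {w. (\<forall>i<k. w i < p) \<and> (\<forall>i\<ge>k. w i = 0)}"

lemma words_0: "words p 0 = {\<lambda>_. 0}"
  by (auto simp: words_def)

lemma words_SucD: "w \<in> words p (Suc k) \<Longrightarrow> w(k := 0) \<in> words p k \<and> w k < p"
  by (auto simp: words_def)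

lemma words_SucI: "w \<in> words p k \<Longrightarrow> i < p \<Longrightarrow> w(k := i) \<in> words p (Suc k)"
  by (auto simp: words_def less_Suc_eq)

lemma words_upd_0: "w \<in> words p k \<Longrightarrow> w(k := 0) = w"
  by (auto simp: words_def)

lemma bij_betw_words_Suc:
  "bij_betw (\<lambda>(i, w). w(k := i)) ({..<p} \<times> words p k) (words p (Suc k))"
proof (rule bij_betw_byWitness[where f' = "\<lambda>w. (w k, w(k := 0))"])
  show "(\<lambda>(i, w). w(k := i)) ` ({..<p} \<times> words p k) \<subseteq> words p (Suc k)"
    using words_SucI by auto
  show "(\<lambda>w. (w k, w(k := 0))) ` words p (Suc k) \<subseteq> {..<p} \<times> words p k"
    using words_SucD by auto
qed (auto simp: words_upd_0)

lemma finite_words: "finite (words p k)"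
  by (induction k) (use bij_betw_finite[OF bij_betw_words_Suc] in \<open>auto simp: words_0\<close>)

lemma zero_in_words: "p > 0 \<Longrightarrow> (\<lambda>_. 0) \<in> words p k"
  by (simp add: words_def)

locale prime_root_of_unity =
  fixes p :: nat and \<zeta> :: "'k::field"
  assumes prime_p: "prime p" and p_nonzero: "of_nat p \<noteq> (0 :: 'k)"
    and root: "\<zeta> ^ p = 1" and root_nontrivial: "\<zeta> \<noteq> 1"
begin

lemma p_pos: "p > 0"
  using prime_p by (rule prime_gt_0_nat)

lemma zeta_nonzero: "\<zeta> \<noteq> 0"
  using root p_pos by (auto simp: power_0_left)

lemma zeta_power_neq_1:
  assumes "0 < m" "m < p"
  shows "\<zeta> ^ m \<noteq> 1"
proof
  assume 1: "\<zeta> ^ m = 1"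
  have "gcd m p = 1"
    using assms prime_p by (metis coprime_iff_gcd_eq_1 coprime_commute nat_dvd_not_less prime_imp_coprime)
  then obtain x y where xy: "m * x = p * y + 1"
    using bezout_nat[of m p] assms by auto
  have "\<zeta> ^ (p * y) = 1" "\<zeta> ^ (m * x) = 1" by (simp_all add: power_mult root 1)
  thus False using xy root_nontrivial by simp
qed

lemma zeta_power_inj:
  assumes "i < p" "j < p" "\<zeta> ^ i = \<zeta> ^ j"
  shows "i = j"
proof -
  have *: "\<zeta> ^ a \<noteq> \<zeta> ^ b" if "a < b" "b < p" for a b
  proof
    assume "\<zeta> ^ a = \<zeta> ^ b"
    also have "\<zeta> ^ b = \<zeta> ^ a * \<zeta> ^ (b - a)"
      using that power_add[of \<zeta> a "b - a"] by simp
    finally have "\<zeta> ^ (b - a) = 1" using zeta_nonzero by simp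
    thus False using zeta_power_neq_1[of "b - a"] that by simp
  qed
  show ?thesis using *[of i j] *[of j i] assms by (metis linorder_neqE_nat)
qed

text \<open>Orthogonality of the characters of $\<int>/p$.\<close>

lemma character_sum:
  assumes "i < p" "j < p"
  shows "(\<Sum>r<p. (\<zeta> ^ i / \<zeta> ^ j) ^ r) = (if i = j then of_nat p else 0)"
proof (cases "i = j")
  case False
  hence "\<zeta> ^ i / \<zeta> ^ j \<noteq> 1" using zeta_power_inj[OF assms] zeta_nonzero by auto
  moreover have "(\<zeta> ^ i / \<zeta> ^ j) ^ p = 1"
    by (simp add: power_divide root power_commutes flip: power_mult)
       (simp add: mult.commute[of _ p] power_mult root zeta_nonzero)
  ultimately show ?thesis using False zeta_nonzero by (simp add: sum_gp_strict)
qed (use zeta_nonzero in simp)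

end

text \<open>\<open>S\<close> is a direct sum of matrix algebras of sizes $p^k$. A block is a pair of its exponent
  \<open>k\<close> and its system of matrix units, whose rows are indexed by \<open>words p k\<close>. A set of blocks
  suffices, because distinct blocks annihilate each other and so cannot share their units.\<close>

locale block_decomposition = assoc_algebra +
  fixes p :: nat and F :: "(nat \<times> ((nat \<Rightarrow> nat) \<Rightarrow> (nat \<Rightarrow> nat) \<Rightarrow> 'b)) set" and S :: "'b set"
  assumes base_pos: "p > 0" and finite_blocks: "finite F"
    and block: "b \<in> F \<Longrightarrow> matrix_units scale mul (words p (fst b)) (snd b)"
    and blocks_orthogonal: "\<lbrakk>b \<in> F; c \<in> F; b \<noteq> c;
      x \<in> matrix_units.entries (words p (fst b)) (snd b);
      y \<in> matrix_units.entries (words p (fst c)) (snd c)\<rbrakk> \<Longrightarrow> x \<star> y = 0"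
    and blocks_span: "span (\<Union>b\<in>F. matrix_units.entries (words p (fst b)) (snd b)) = S"
begin

definition block_entries :: "nat \<times> ((nat \<Rightarrow> nat) \<Rightarrow> (nat \<Rightarrow> nat) \<Rightarrow> 'b) \<Rightarrow> 'b set" where
  "block_entries b = matrix_units.entries (words p (fst b)) (snd b)"

definition block_ident :: "nat \<times> ((nat \<Rightarrow> nat) \<Rightarrow> (nat \<Rightarrow> nat) \<Rightarrow> 'b) \<Rightarrow> 'b" where
  "block_ident b = matrix_units.ident (words p (fst b)) (snd b)"

lemma S_span: "S = span (\<Union>b\<in>F. block_entries b)"
  by (simp add: blocks_span block_entries_def)

lemma subspace_S: "subspace S"
  by (simp add: S_span)

lemma words_nonempty: "words p k \<noteq> {}"
  using zero_in_words[OF base_pos] by blast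

lemma e_in_ent: "b \<in> F \<Longrightarrow> block_ident b \<in> span (block_entries b)"
  unfolding block_ident_def block_entries_def by (rule matrix_units.ident_in_span[OF block])

lemma span_ent_subset: "b \<in> F \<Longrightarrow> span (block_entries b) \<subseteq> S"
  unfolding S_span by (rule span_mono) blast

lemma e_in_S: "b \<in> F \<Longrightarrow> block_ident b \<in> S"
  using e_in_ent span_ent_subset by blast

lemma orthogonal:
  assumes "b \<in> F" "c \<in> F" "b \<noteq> c" "x \<in> span (block_entries b)" "y \<in> span (block_entries c)"
  shows "x \<star> y = 0"
  using span_mul[OF assms(4,5), of "{0}"] blocks_orthogonal[OF assms(1-3)]
  by (auto simp: block_entries_def subspace_single_0)

lemma e_mul: "b \<in> F \<Longrightarrow> x \<in> span (block_entries b) \<Longrightarrow> block_ident b \<star> x = x"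
  and mul_e: "b \<in> F \<Longrightarrow> x \<in> span (block_entries b) \<Longrightarrow> x \<star> block_ident b = x"
  unfolding block_ident_def block_entries_def
  by (simp_all add: matrix_units.ident_mul[OF block] matrix_units.mul_ident[OF block])

lemma ent_mul: "b \<in> F \<Longrightarrow> x \<in> span (block_entries b) \<Longrightarrow> y \<in> span (block_entries b) \<Longrightarrow> x \<star> y \<in> span (block_entries b)"
  unfolding block_entries_def by (rule matrix_units.span_entries_mul[OF block])

lemma e_idem: "b \<in> F \<Longrightarrow> block_ident b \<star> block_ident b = block_ident b"
  by (simp add: e_mul e_in_ent)

lemma e_nonzero: "b \<in> F \<Longrightarrow> block_ident b \<noteq> 0"
  unfolding block_ident_def by (rule matrix_units.ident_nonzero[OF block words_nonempty])

lemma e_orthogonal: "b \<in> F \<Longrightarrow> c \<in> F \<Longrightarrow> b \<noteq> c \<Longrightarrow> block_ident b \<star> block_ident c = 0"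
  by (rule orthogonal) (auto intro: e_in_ent)

lemma e_inj: "inj_on block_ident F"
  by (rule inj_onI) (metis e_idem e_nonzero e_orthogonal)

lemma e_mul_in:
  assumes "b \<in> F" "x \<in> S"
  shows "block_ident b \<star> x \<in> span (block_entries b)"
  using assms(2) unfolding S_span
proof (rule span_mul_left)
  fix y assume "y \<in> (\<Union>b\<in>F. block_entries b)"
  then obtain c where c: "c \<in> F" "y \<in> block_entries c" by blast
  show "block_ident b \<star> y \<in> span (block_entries b)"
  proof (cases "c = b")
    case True
    thus ?thesis using assms c by (simp add: e_mul span_base)
  next
    case False
    hence "block_ident b \<star> y = 0" using assms c by (intro orthogonal[of b c]) (auto intro: e_in_ent span_base)
    thus ?thesis by (simp add: span_zero)
  qed
qed simp

lemma e_central: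
  assumes "b \<in> F" "x \<in> S"
  shows "block_ident b \<star> x = x \<star> block_ident b"
  using assms(2) unfolding S_span
proof (rule span_commute)
  fix y assume "y \<in> (\<Union>b\<in>F. block_entries b)"
  then obtain c where c: "c \<in> F" "y \<in> block_entries c" by blast
  show "block_ident b \<star> y = y \<star> block_ident b"
  proof (cases "c = b")
    case True
    thus ?thesis using assms c by (simp add: e_mul mul_e span_base)
  next
    case False
    hence "block_ident b \<star> y = 0" "y \<star> block_ident b = 0"
      using assms c orthogonal[of b c "block_ident b" y] orthogonal[of c b y "block_ident b"]
      by (auto intro: e_in_ent span_base)
    thus ?thesis by simp
  qed
qed

lemma sum_e_mul: "x \<in> S \<Longrightarrow> (\<Sum>b\<in>F. block_ident b) \<star> x = x"
proof -
  assume "x \<in> S"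
  hence "x \<in> span (\<Union>b\<in>F. block_entries b)" by (simp add: S_span)
  moreover have "subspace {x. (\<Sum>b\<in>F. block_ident b) \<star> x = x}"
    by (auto simp: subspace_def mul_add_right mul_scale_right)
  moreover have "(\<Sum>b\<in>F. block_ident b) \<star> y = y" if c: "c \<in> F" "y \<in> block_entries c" for c y
  proof -
    have "(\<Sum>b\<in>F. block_ident b) \<star> y = (\<Sum>b\<in>F. if b = c then y else 0)"
      unfolding mul_sum_left
      by (rule sum.cong)
         (use c in \<open>auto simp: e_mul span_base intro: orthogonal[of _ c] e_in_ent span_base\<close>)
    thus ?thesis using c finite_blocks by simp
  qed
  ultimately show ?thesis
    using span_minimal[of "\<Union>b\<in>F. block_entries b" "{x. (\<Sum>b\<in>F. block_ident b) \<star> x = x}"] by blast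
qed

text \<open>The centre of a block consists of scalars, so the only idempotents in it are zero and the
  identity of the block.\<close>

lemma e_primitive:
  assumes "b \<in> F" "z \<in> S" "\<And>x. x \<in> S \<Longrightarrow> z \<star> x = x \<star> z" "z \<star> z = z" "block_ident b \<star> z \<noteq> 0"
  shows "block_ident b \<star> z = block_ident b"
proof -
  have "block_ident b \<star> z \<in> span (block_entries b)" by (rule e_mul_in) fact+
  have "\<exists>c. block_ident b \<star> z = c *s matrix_units.ident (words p (fst b)) (snd b)"
  proof (rule matrix_units.central_is_scalar[OF block])
    show "block_ident b \<star> z \<in> span (matrix_units.entries (words p (fst b)) (snd b))"
      using e_mul_in[OF assms(1,2)] by (simp add: block_entries_def)
    fix x assume "x \<in> matrix_units.entries (words p (fst b)) (snd b)"
    hence x: "x \<in> span (block_entries b)" by (simp add: block_entries_def span_base)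
    hence xS: "x \<in> S" using span_ent_subset assms(1) by blast
    have "block_ident b \<star> z \<star> x = block_ident b \<star> x \<star> z" by (simp add: mul_assoc assms(3)[OF xS])
    thus "block_ident b \<star> z \<star> x = x \<star> (block_ident b \<star> z)"
      using e_central[OF assms(1) xS] by (simp add: mul_assoc)
  qed fact
  then obtain c where c: "block_ident b \<star> z = c *s block_ident b" by (auto simp: block_ident_def)
  have "c *s block_ident b = block_ident b \<star> (z \<star> z)" using c by (simp add: assms(4))
  also have "\<dots> = c *s (block_ident b \<star> z)" by (simp add: mul_assoc[symmetric] c mul_scale_left)
  also have "\<dots> = (c * c) *s block_ident b" by (simp add: c)
  finally have "c = c * c" using e_nonzero[OF assms(1)] by simp
  moreover have "c \<noteq> 0" using c assms(5) by auto
  ultimately show ?thesis using c by simp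
qed

end

context assoc_algebra begin

definition splits :: "nat \<Rightarrow> 'a set \<Rightarrow> bool" where
  "splits p S \<longleftrightarrow> (\<exists>F. block_decomposition scale mul p F S)"

lemma splits_zero: "p > 0 \<Longrightarrow> splits p {0}"
  unfolding splits_def
  by (rule exI[of _ "{}"], unfold_locales) auto

lemma splits_Un:
  assumes "splits p A" "splits p B"
    and ann: "\<And>x y. x \<in> A \<Longrightarrow> y \<in> B \<Longrightarrow> x \<star> y = 0" "\<And>x y. x \<in> A \<Longrightarrow> y \<in> B \<Longrightarrow> y \<star> x = 0"
  shows "splits p (span (A \<union> B))"
proof -
  obtain F G where F: "block_decomposition scale mul p F A" and G: "block_decomposition scale mul p G B"
    using assms by (auto simp: splits_def)
  interpret F: block_decomposition scale mul p F A by fact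
  interpret G: block_decomposition scale mul p G B by fact
  have sub: "b \<in> F \<Longrightarrow> F.block_entries b \<subseteq> A" "b \<in> G \<Longrightarrow> G.block_entries b \<subseteq> B" for b
    using F.span_ent_subset G.span_ent_subset span_superset by blast+
  have "block_decomposition scale mul p (F \<union> G) (span (A \<union> B))"
  proof (intro block_decomposition.intro block_decomposition_axioms.intro assoc_algebra_axioms)
    show "p > 0" by (rule F.base_pos)
    show "finite (F \<union> G)" by (simp add: F.finite_blocks G.finite_blocks)
    show "matrix_units scale mul (words p (fst b)) (snd b)" if "b \<in> F \<union> G" for b
      using that F.block G.block by blast
    show "x \<star> y = 0" if "b \<in> F \<union> G" "c \<in> F \<union> G" "b \<noteq> c"
      "x \<in> matrix_units.entries (words p (fst b)) (snd b)"
      "y \<in> matrix_units.entries (words p (fst c)) (snd c)" for b c x y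
      using that sub F.blocks_orthogonal G.blocks_orthogonal ann
      unfolding F.block_entries_def G.block_entries_def by blast
    have "span (\<Union>b\<in>F \<union> G. F.block_entries b) = span (span (\<Union>b\<in>F. F.block_entries b) \<union> span (\<Union>b\<in>G. F.block_entries b))"
      by (simp add: UN_Un span_Un span_span)
    thus "span (\<Union>b\<in>F \<union> G. matrix_units.entries (words p (fst b)) (snd b)) = span (A \<union> B)"
      using F.blocks_span G.blocks_span by (simp add: F.block_entries_def)
  qed
  thus ?thesis by (auto simp: splits_def)
qed

end

section \<open>Cyclic extensions of prime degree: invariant blocks\<close>

text \<open>The crossed product of an algebra \<open>S\<close> with identity \<open>u\<close> by the powers \<open>\<gamma> i\<close> of one
  invertible element that normalises \<open>S\<close> and whose \<open>p\<close>-th power lies in \<open>S\<close>. The sum of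
  the subspaces $S\gamma^i$ with $0 \le i < p$ is direct; this is stated for the component of $i = 0$,
  and the other components reduce to it by multiplication with powers of $\gamma$.\<close>

locale cyclic_extension = assoc_algebra scale mul + prime_root_of_unity p \<zeta>
  for scale :: "'k::field \<Rightarrow> 'a::ab_group_add \<Rightarrow> 'a" (infixr \<open>*s\<close> 75)
    and mul :: "'a \<Rightarrow> 'a \<Rightarrow> 'a" (infixl \<open>\<star>\<close> 76)
    and p :: nat and \<zeta> :: 'k +
  fixes S :: "'a set" and u :: 'a and \<gamma> :: "int \<Rightarrow> 'a"
  assumes S_subspace: "subspace S"
    and S_mul: "\<lbrakk>x \<in> S; y \<in> S\<rbrakk> \<Longrightarrow> x \<star> y \<in> S"
    and u_in_S: "u \<in> S"
    and u_left: "x \<in> S \<Longrightarrow> u \<star> x = x"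
    and u_right: "x \<in> S \<Longrightarrow> x \<star> u = x"
    and gamma_0: "\<gamma> 0 = u"
    and gamma_add: "\<gamma> (i + j) = \<gamma> i \<star> \<gamma> j"
    and twist_in_S: "x \<in> S \<Longrightarrow> \<gamma> i \<star> x \<star> \<gamma> (- i) \<in> S"
    and gamma_p: "\<gamma> (int p * m) \<in> S"
    and gamma_independent: "\<lbrakk>\<And>i. i < p \<Longrightarrow> f i \<in> S; (\<Sum>i<p. f i \<star> \<gamma> (int i)) = 0\<rbrakk> \<Longrightarrow> f 0 = 0"
    and p_th_roots: "\<exists>d. d ^ p = (c :: 'k)"
begin

definition twist :: "int \<Rightarrow> 'a \<Rightarrow> 'a" where
  "twist i x = \<gamma> i \<star> x \<star> \<gamma> (- i)"

definition R :: "'a set" where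
  "R = span {x \<star> \<gamma> i |x i. x \<in> S}"

lemma gamma_inverse: "\<gamma> i \<star> \<gamma> (- i) = u" "\<gamma> (- i) \<star> \<gamma> i = u"
  using gamma_add[of i "- i"] gamma_add[of "- i" i] by (simp_all add: gamma_0)

lemma u_gamma: "u \<star> \<gamma> i = \<gamma> i" and gamma_u: "\<gamma> i \<star> u = \<gamma> i"
  using gamma_add[of 0 i] gamma_add[of i 0] by (simp_all add: gamma_0)

lemma twist_in: "x \<in> S \<Longrightarrow> twist i x \<in> S"
  unfolding twist_def by (rule twist_in_S)

lemma twist_0: "x \<in> S \<Longrightarrow> twist 0 x = x"
  by (simp add: twist_def gamma_0 u_left u_right)

lemma twist_twist: "twist i (twist j x) = twist (i + j) x"
proof -
  have "\<gamma> (- (i + j)) = \<gamma> (- j) \<star> \<gamma> (- i)" using gamma_add[of "- j" "- i"] by (simp add: add.commute)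
  thus ?thesis by (simp add: twist_def gamma_add mul_assoc)
qed

lemma twist_mul:
  assumes "x \<in> S"
  shows "twist i (x \<star> y) = twist i x \<star> twist i y"
proof -
  have "twist i x \<star> twist i y = \<gamma> i \<star> x \<star> (\<gamma> (- i) \<star> \<gamma> i) \<star> y \<star> \<gamma> (- i)"
    by (simp add: twist_def mul_assoc)
  also have "\<dots> = \<gamma> i \<star> (x \<star> u) \<star> y \<star> \<gamma> (- i)" by (simp add: gamma_inverse mul_assoc)
  finally show ?thesis using assms by (simp add: twist_def u_right mul_assoc)
qed

lemma twist_zero [simp]: "twist i 0 = 0"
  by (simp add: twist_def)

lemma twist_eq_0_iff: "x \<in> S \<Longrightarrow> twist i x = 0 \<longleftrightarrow> x = 0"
  using twist_twist[of "- i" i x] twist_0[of x] by auto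

lemma twist_sum: "twist i (sum f A) = (\<Sum>a\<in>A. twist i (f a))"
  by (simp add: twist_def mul_sum_left mul_sum_right)

lemma twist_span: "x \<in> span A \<Longrightarrow> twist i x \<in> span (twist i ` A)"
proof (induction rule: span_induct_alt)
  case (step c x y)
  have "twist i (c *s x + y) = c *s twist i x + twist i y"
    by (simp add: twist_def mul_add_left mul_add_right mul_scale_left mul_scale_right)
  thus ?case using step by (auto intro: span_add span_scale span_base)
qed (simp add: span_zero)

lemma gamma_commute: "x \<in> S \<Longrightarrow> \<gamma> i \<star> x = twist i x \<star> \<gamma> i"
  by (simp add: twist_def mul_assoc gamma_inverse u_right)

lemma subspace_R: "subspace R"
  by (simp add: R_def)

lemma R_base: "x \<in> S \<Longrightarrow> x \<star> \<gamma> i \<in> R"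
  unfolding R_def by (rule span_base) blast

lemma S_subset_R: "S \<subseteq> R"
  using R_base[of _ 0] by (auto simp: gamma_0 u_right)

lemma gamma_in_R: "\<gamma> i \<in> R"
  using R_base[OF u_in_S, of i] by (simp add: u_gamma)

lemma R_mul: "x \<in> R \<Longrightarrow> y \<in> R \<Longrightarrow> x \<star> y \<in> R"
  unfolding R_def
proof (erule span_mul, assumption)
  fix a b assume "a \<in> {x \<star> \<gamma> i |x i. x \<in> S}" "b \<in> {x \<star> \<gamma> i |x i. x \<in> S}"
  then obtain x i y j where *: "a = x \<star> \<gamma> i" "b = y \<star> \<gamma> j" "x \<in> S" "y \<in> S" by blast
  have "a \<star> b = x \<star> (\<gamma> i \<star> y) \<star> \<gamma> j" by (simp add: * mul_assoc)
  also have "\<dots> = (x \<star> twist i y) \<star> \<gamma> (i + j)" by (simp add: * gamma_commute gamma_add mul_assoc)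
  finally show "a \<star> b \<in> span {x \<star> \<gamma> i |x i. x \<in> S}"
    using R_base[of "x \<star> twist i y" "i + j"] * by (simp add: S_mul twist_in R_def)
qed simp

lemma u_R: "x \<in> R \<Longrightarrow> u \<star> x = x"
  unfolding R_def by (rule span_induct_alt, simp)
    (auto simp: mul_add_right mul_scale_right u_left simp flip: mul_assoc)

text \<open>Right ideals of the extension are recognised by right multiplication with \<open>S\<close> and \<open>\<gamma> 1\<close>
  alone, since negative powers of $\gamma$ are nonnegative ones times powers of $\gamma^p$. This is
  how the span of a newly found system of matrix units is shown to be all of $eR$.\<close>

lemma R_absorb:
  assumes V: "subspace V" and VS: "\<And>v x. v \<in> V \<Longrightarrow> x \<in> S \<Longrightarrow> v \<star> x \<in> V"
    and V1: "\<And>v. v \<in> V \<Longrightarrow> v \<star> \<gamma> 1 \<in> V" and v: "v \<in> V" "r \<in> R"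
  shows "v \<star> r \<in> V"
proof -
  have nat: "v \<star> \<gamma> (int n) \<in> V" if "v \<in> V" for v n
  proof (induction n)
    case 0
    show ?case using VS[OF that u_in_S] by (simp add: gamma_0)
  next
    case (Suc n)
    have "v \<star> \<gamma> (int n) \<star> \<gamma> 1 = v \<star> \<gamma> (int (Suc n))"
      using gamma_add[of "int n" 1] by (simp add: mul_assoc add.commute)
    with V1[OF Suc] show ?case by simp
  qed
  have int: "v \<star> \<gamma> i \<in> V" if "v \<in> V" for v i
  proof -
    define n where "n = nat (i mod int p)"
    have "int p * (i div int p) + int n = i" using p_pos by (simp add: n_def)
    hence "v \<star> \<gamma> i = v \<star> \<gamma> (int p * (i div int p)) \<star> \<gamma> (int n)"
      using gamma_add[of "int p * (i div int p)" "int n"] by (simp add: mul_assoc)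
    thus ?thesis using nat VS gamma_p that by simp
  qed
  show ?thesis
    using v(2) unfolding R_def
    by (rule span_mul_left) (use VS int v(1) V in \<open>auto simp flip: mul_assoc\<close>)
qed

end

locale cyclic_extension_blocks =
  cyclic_extension scale mul p \<zeta> S u \<gamma> + block_decomposition scale mul p F S
  for scale :: "'k::field \<Rightarrow> 'a::ab_group_add \<Rightarrow> 'a" (infixr \<open>*s\<close> 75)
    and mul :: "'a \<Rightarrow> 'a \<Rightarrow> 'a" (infixl \<open>\<star>\<close> 76) and p \<zeta> S u \<gamma> F
begin

text \<open>For a central idempotent \<open>q\<close> this is a direct summand of \<open>R\<close>.\<close>

definition corner :: "'a \<Rightarrow> 'a set" where
  "corner q = (\<star>) q ` R"

lemma subspace_corner: "subspace (corner q)"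
  unfolding subspace_def
proof (intro conjI ballI allI)
  show "0 \<in> corner q" unfolding corner_def using subspace_0[OF subspace_R] by force
next
  fix x y assume "x \<in> corner q" "y \<in> corner q"
  then obtain r s where "r \<in> R" "s \<in> R" "x = q \<star> r" "y = q \<star> s" by (auto simp: corner_def)
  thus "x + y \<in> corner q" unfolding corner_def
    by (intro image_eqI[of _ _ "r + s"]) (simp_all add: mul_add_right subspace_add[OF subspace_R])
next
  fix c x assume "x \<in> corner q"
  then obtain r where "r \<in> R" "x = q \<star> r" by (auto simp: corner_def)
  thus "c *s x \<in> corner q" unfolding corner_def
    by (intro image_eqI[of _ _ "c *s r"]) (simp_all add: mul_scale_right subspace_scale[OF subspace_R])
qed

lemma u_eq_sum_e: "u = (\<Sum>b\<in>F. block_ident b)"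
proof -
  have "(\<Sum>b\<in>F. block_ident b) \<in> S" by (rule subspace_sum[OF S_subspace e_in_S])
  thus ?thesis using sum_e_mul[OF u_in_S] u_right by simp
qed

text \<open>Conjugation by $\gamma$ restricts to an automorphism of the block, which Skolem-Noether
  writes as conjugation by some $a$ in the block. So $z = a^{-1}\gamma$ centralises the block. Its
  power $z^p$ lies in the block again, hence is a scalar $c \neq 0$, and $eR$ is the tensor product of
  the block with $K[z]/(z^p - c)$. The latter is a product of $p$ copies of $K$: for each root
  $\eta_r = d\zeta^r$ of $c$ there is the idempotent
  $f_r = \frac1p \sum_{i<p} \eta_r^{-i} z^i$, on which $z$ acts as $\eta_r$.\<close>

lemma splits_fixed_block:
  assumes b: "b \<in> F" and fixed: "twist 1 (block_ident b) = block_ident b"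
  shows "splits p (corner (block_ident b))"
proof -
  define J E B where "J = words p (fst b)" and "E = snd b" and "B = span (block_entries b)"
  interpret M: matrix_units scale mul J E
    unfolding J_def E_def by (rule block[OF b])
  have ident: "M.ident = block_ident b" and entries: "M.entries = block_entries b"
    by (simp_all add: block_ident_def block_entries_def J_def E_def)
  note skolem = M.skolem_noether[unfolded ident entries]
  have J: "J \<noteq> {}" unfolding J_def by (rule words_nonempty)
  have E_B: "E i j \<in> B" if "i \<in> J" "j \<in> J" for i j
    unfolding B_def using M.entry_in_span[OF that] by (simp add: entries)
  have BS: "x \<in> S" if "x \<in> B" for x using that span_ent_subset[OF b] by (auto simp: B_def)
  have B_mul: "x \<star> y \<in> B" if "x \<in> B" "y \<in> B" for x y
    using ent_mul[OF b] that by (simp add: B_def)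
  have eB: "block_ident b \<star> x = x" "x \<star> block_ident b = x" if "x \<in> B" for x
    using e_mul mul_e b that by (simp_all add: B_def)
  have e_B: "block_ident b \<in> B" using e_in_ent[OF b] by (simp add: B_def)
  have BSB: "block_ident b \<star> x \<in> B" if "x \<in> S" for x using e_mul_in[OF b that] by (simp add: B_def)
  have conj_B: "twist 1 x \<in> B" "twist (-1) x \<in> B" if "x \<in> B" for x
  proof -
    have "twist (-1) (block_ident b) = block_ident b"
      using twist_twist[of "-1" 1 "block_ident b"] fixed twist_0[OF e_in_S[OF b]] by simp
    hence *: "twist i (block_ident b) = block_ident b" if "i \<in> {1, -1}" for i using fixed that by auto
    have "twist i x \<in> B" if "i \<in> {1, -1}" for i
      using twist_mul[OF e_in_S[OF b], of i x] BSB[OF twist_in[OF BS[OF \<open>x \<in> B\<close>]], of i]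
      by (simp add: *[OF that] eB[OF \<open>x \<in> B\<close>])
    thus "twist 1 x \<in> B" "twist (-1) x \<in> B" by auto
  qed
  obtain a a' where a: "a \<in> B" "a' \<in> B" "a \<star> a' = block_ident b" "a' \<star> a = block_ident b"
    and a'E: "\<And>i j. i \<in> J \<Longrightarrow> j \<in> J \<Longrightarrow> a' \<star> twist 1 (E i j) = E i j \<star> a'"
  proof (rule skolem[OF J, where F = "\<lambda>i j. twist 1 (E i j)"])
    fix i j assume ij: "i \<in> J" "j \<in> J"
    show "twist 1 (E i j) \<in> span (block_entries b)" using conj_B E_B[OF ij] by (simp add: B_def)
    show "twist 1 (E i j) \<noteq> 0"
      using M.unit_nonzero[OF ij] by (simp add: twist_eq_0_iff BS E_B ij)
  next
    fix i j l m assume ij: "i \<in> J" "j \<in> J" "l \<in> J" "m \<in> J"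
    show "twist 1 (E i j) \<star> twist 1 (E l m) = (if j = l then twist 1 (E i m) else 0)"
      using M.unit_mul[OF ij] ij by (simp add: twist_mul[OF BS[OF E_B], symmetric])
  next
    show "block_entries b \<subseteq> span ((\<lambda>(i, j). twist 1 (E i j)) ` (J \<times> J))"
    proof
      fix x assume "x \<in> block_entries b"
      hence x: "x \<in> B" by (simp add: B_def span_base)
      have "twist 1 (twist (-1) x) \<in> span (twist 1 ` block_entries b)"
        using twist_span conj_B[OF x] by (simp add: B_def)
      moreover have "twist 1 (twist (-1) x) = x" by (simp add: twist_twist twist_0 BS x)
      moreover have "twist 1 ` block_entries b = (\<lambda>(i, j). twist 1 (E i j)) ` (J \<times> J)"
        by (force simp: M.entries_def simp flip: entries)
      ultimately show "x \<in> span ((\<lambda>(i, j). twist 1 (E i j)) ` (J \<times> J))" by simp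
    qed
  qed (auto simp: B_def)
  have a'x: "a' \<star> twist 1 x = x \<star> a'" if "x \<in> B" for x
    using that unfolding B_def
  proof (induction rule: span_induct_alt)
    case (step c x y)
    then obtain i j where "i \<in> J" "j \<in> J" "x = E i j" by (auto simp: M.entries_def simp flip: entries)
    hence "a' \<star> twist 1 x = x \<star> a'" using a'E by simp
    thus ?case using step
      by (simp add: twist_def mul_add_left mul_add_right mul_scale_left mul_scale_right)
  qed simp
  define z where "z = a' \<star> \<gamma> 1"
  have zx: "z \<star> x = x \<star> z" if "x \<in> B" for x
  proof -
    have "z \<star> x = a' \<star> twist 1 x \<star> \<gamma> 1"
      by (simp add: z_def mul_assoc gamma_commute[OF BS[OF that]])
    thus ?thesis by (simp add: a'x[OF that] z_def mul_assoc)
  qed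
  \<comment> \<open>The powers of \<open>z\<close> inside \<open>e R\<close>, so that the power with exponent \<open>0\<close> is the block identity.\<close>
  define zp where "zp n = ((\<star>) z ^^ n) (block_ident b)" for n
  have zp_0: "zp 0 = block_ident b" and zp_Suc: "zp (Suc n) = z \<star> zp n" for n
    by (simp_all add: zp_def)
  have zp_comm: "zp n \<star> x = x \<star> zp n" if "x \<in> B" for n x
  proof (induction n)
    case (Suc n)
    have "zp (Suc n) \<star> x = z \<star> x \<star> zp n" by (simp add: zp_Suc mul_assoc Suc)
    thus ?case by (simp add: zx[OF that] zp_Suc mul_assoc)
  qed (simp add: zp_0 eB that)
  have e_zp: "block_ident b \<star> zp n = zp n" for n
  proof (induction n)
    case (Suc n)
    have "block_ident b \<star> zp (Suc n) = z \<star> (block_ident b \<star> zp n)"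
      by (simp add: zp_Suc zx[OF e_B] flip: mul_assoc)
    thus ?case by (simp add: Suc zp_Suc)
  qed (simp add: zp_0 eB e_B)
  have zp_z: "zp n \<star> z = zp (Suc n)" for n
    by (induction n) (simp_all add: zp_0 zp_Suc zx e_B mul_assoc)
  have zp_form: "\<exists>y\<in>B. zp n = y \<star> \<gamma> (int n)" for n
  proof (induction n)
    case 0
    show ?case by (rule bexI[OF _ e_B]) (simp add: zp_0 gamma_0 u_right e_in_S[OF b])
  next
    case (Suc n)
    then obtain y where y: "y \<in> B" "zp n = y \<star> \<gamma> (int n)" by blast
    have "zp (Suc n) = a' \<star> (\<gamma> 1 \<star> y) \<star> \<gamma> (int n)" by (simp add: zp_Suc y z_def mul_assoc)
    also have "\<dots> = (a' \<star> twist 1 y) \<star> \<gamma> (int (Suc n))"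
      using gamma_add[of 1 "int n"] by (simp add: gamma_commute BS y mul_assoc)
    finally show ?case using B_mul[OF a(2) conj_B(1)[OF y(1)]] by blast
  qed
  have zp_R: "zp n \<in> R" for n using zp_form[of n] R_base BS by auto
  have "\<exists>c. zp p = c *s block_ident b"
    unfolding ident[symmetric]
  proof (rule M.central_is_scalar)
    obtain y where "y \<in> B" "zp p = y \<star> \<gamma> (int p)" using zp_form by blast
    hence "zp p \<in> S" using S_mul BS gamma_p[of 1] by simp
    thus "zp p \<in> span M.entries" using BSB e_zp by (metis B_def entries)
    show "zp p \<star> x = x \<star> zp p" if "x \<in> M.entries" for x
      using that zp_comm by (simp add: entries B_def span_base)
  qed
  then obtain c where c: "zp p = c *s block_ident b" by blast
  \<comment> \<open>\<open>z\<close> is invertible in \<open>e R\<close>, so its \<open>p\<close>-th power is a nonzero scalar.\<close>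
  have zz': "z \<star> (\<gamma> (-1) \<star> a) = block_ident b"
  proof -
    have "z \<star> (\<gamma> (-1) \<star> a) = a' \<star> (\<gamma> 1 \<star> \<gamma> (-1)) \<star> a" by (simp add: z_def mul_assoc)
    thus ?thesis using a by (simp add: gamma_inverse mul_assoc u_left BS)
  qed
  have zp_nz: "zp n \<noteq> 0" for n
  proof (induction n)
    case (Suc n)
    have "zp (Suc n) \<star> (\<gamma> (-1) \<star> a) = zp n \<star> block_ident b"
      by (simp add: zz' mul_assoc flip: zp_z)
    also have "\<dots> = zp n" by (simp add: zp_comm e_B e_zp)
    finally show ?case using Suc by auto
  qed (simp add: zp_0 e_nonzero b)
  have "c \<noteq> 0" using c zp_nz[of p] by auto
  obtain d where d: "d ^ p = c" using p_th_roots by blast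
  have d0: "d \<noteq> 0" using d \<open>c \<noteq> 0\<close> p_pos by (auto simp: power_0_left)
  define \<eta> where "\<eta> r = d * \<zeta> ^ r" for r
  have \<eta>0: "\<eta> r \<noteq> 0" for r using d0 zeta_nonzero by (simp add: \<eta>_def)
  have \<eta>p: "\<eta> r ^ p = c" for r
    by (simp add: \<eta>_def power_mult_distrib d mult.commute[of r] root power_mult flip: power_mult)
       (simp add: power_mult mult.commute[of _ p] root)
  define g where "g r i = inverse (\<eta> r) ^ i *s zp i" for r i
  define f where "f r = inverse (of_nat p) *s (\<Sum>i<p. g r i)" for r
  have f_z: "f r \<star> z = \<eta> r *s f r" for r
  proof -
    \<comment> \<open>The summands are periodic with period \<open>p\<close>, so multiplication by \<open>z\<close> shifts the sum into itself.\<close>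
    have "g r p = g r 0"
      using \<eta>p[of r] \<open>c \<noteq> 0\<close> by (simp add: g_def c zp_0 power_inverse)
    hence shift: "(\<Sum>i<p. g r (Suc i)) = (\<Sum>i<p. g r i)"
      using sum.lessThan_Suc_shift[of "g r" p] sum.lessThan_Suc[of "g r" p] by simp
    have "g r i \<star> z = \<eta> r *s g r (Suc i)" for i
      using \<eta>0 by (simp add: g_def mul_scale_left zp_z)
    hence "(\<Sum>i<p. g r i) \<star> z = \<eta> r *s (\<Sum>i<p. g r (Suc i))"
      by (simp add: mul_sum_left scale_sum_right)
    thus ?thesis by (simp add: f_def mul_scale_left shift mult.commute)
  qed
  have f_comm: "f r \<star> x = x \<star> f r" if "x \<in> B" for r x
    using that by (simp add: f_def g_def mul_scale_left mul_scale_right mul_sum_left mul_sum_right zp_comm)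
  have e_f: "block_ident b \<star> f r = f r" for r
    by (simp add: f_def g_def mul_scale_right mul_sum_right e_zp)
  have f_zp: "f r \<star> zp n = \<eta> r ^ n *s f r" for r n
  proof (induction n)
    case (Suc n)
    have "f r \<star> zp (Suc n) = f r \<star> zp n \<star> z" by (simp add: mul_assoc zp_z)
    thus ?case by (simp add: Suc mul_scale_left f_z mult.commute)
  qed (simp add: zp_0 f_comm e_B e_f)
  have f_f: "f r \<star> f s = (if r = s then f r else 0)" if rs: "r < p" "s < p" for r s
  proof -
    have "f r \<star> g s i = (\<zeta> ^ r / \<zeta> ^ s) ^ i *s f r" for i
    proof -
      have "inverse (\<eta> s) ^ i * \<eta> r ^ i = (\<eta> r / \<eta> s) ^ i" by (simp add: field_simps)
      also have "\<eta> r / \<eta> s = \<zeta> ^ r / \<zeta> ^ s" using d0 by (simp add: \<eta>_def)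
      finally show ?thesis by (simp add: g_def mul_scale_right f_zp)
    qed
    hence "f r \<star> f s = inverse (of_nat p) *s (\<Sum>i<p. (\<zeta> ^ r / \<zeta> ^ s) ^ i) *s f r"
      by (subst (2) f_def) (simp add: mul_scale_right mul_sum_right scale_sum_left)
    thus ?thesis using p_nonzero by (simp add: character_sum[OF rs])
  qed
  have sum_f: "(\<Sum>r<p. f r) = block_ident b"
  proof -
    have "(\<Sum>r<p. g r i) = (if i = 0 then of_nat p *s block_ident b else 0)" if "i < p" for i
    proof -
      have "inverse (\<eta> r) ^ i = inverse d ^ i * (\<zeta> ^ 0 / \<zeta> ^ i) ^ r" for r
        by (simp add: \<eta>_def power_mult_distrib divide_inverse power_inverse mult.commute flip: power_mult)
      hence "(\<Sum>r<p. g r i) = (inverse d ^ i * (\<Sum>r<p. (\<zeta> ^ 0 / \<zeta> ^ i) ^ r)) *s zp i"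
        by (simp add: g_def scale_sum_left sum_distrib_left)
      thus ?thesis using character_sum[OF p_pos that] by (auto simp: zp_0)
    qed
    hence "(\<Sum>i<p. \<Sum>r<p. g r i) = of_nat p *s block_ident b" using p_pos by simp
    moreover have "(\<Sum>r<p. f r) = inverse (of_nat p) *s (\<Sum>i<p. \<Sum>r<p. g r i)"
      unfolding f_def scale_sum_right[symmetric] by (subst sum.swap) simp
    ultimately show ?thesis using p_nonzero by simp
  qed
  \<comment> \<open>The component of \<open>f r \<star> E i j\<close> in \<open>S\<close> is the summand for exponent \<open>0\<close>, namely \<open>E i j\<close> divided by \<open>p\<close>.\<close>
  have f_nz: "f r \<star> E i j \<noteq> 0" if ij: "i \<in> J" "j \<in> J" for r i j
  proof
    assume 0: "f r \<star> E i j = 0"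
    obtain y where y: "\<And>n. y n \<in> B" "\<And>n. zp n = y n \<star> \<gamma> (int n)" using zp_form by metis
    define x where "x n = (inverse (of_nat p) * inverse (\<eta> r) ^ n) *s (E i j \<star> y n)" for n
    have "f r \<star> E i j = (\<Sum>n<p. x n \<star> \<gamma> (int n))"
      unfolding f_comm[OF E_B[OF ij]]
      by (simp add: f_def g_def x_def mul_scale_left mul_scale_right
          mul_sum_right scale_sum_right y(2) mul_assoc)
    hence "x 0 = 0"
      using 0 gamma_independent[of x] subspace_scale[OF S_subspace] BS B_mul E_B[OF ij] y(1)
      by (simp add: x_def)
    hence "E i j \<star> y 0 = 0" using p_nonzero by (simp add: x_def)
    hence "E i j \<star> zp 0 = 0" using y(2)[of 0] by (simp add: mul_assoc[symmetric])
    thus False using eB(2)[OF E_B[OF ij]] M.unit_nonzero[OF ij] by (simp add: zp_0)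
  qed
  define N where "N r = (fst b, \<lambda>i j. f r \<star> E i j)" for r
  have N_units: "matrix_units scale mul (words p (fst (N r))) (snd (N r))" if "r < p" for r
  proof (intro matrix_units.intro matrix_units_axioms.intro assoc_algebra_axioms)
    fix i j l m assume "i \<in> words p (fst (N r))" "j \<in> words p (fst (N r))"
      "l \<in> words p (fst (N r))" "m \<in> words p (fst (N r))"
    hence ij: "i \<in> J" "j \<in> J" "l \<in> J" "m \<in> J" by (auto simp: N_def J_def)
    have "f r \<star> E i j \<star> (f r \<star> E l m) = f r \<star> (E i j \<star> f r) \<star> E l m" by (simp add: mul_assoc)
    also have "\<dots> = f r \<star> f r \<star> (E i j \<star> E l m)"
      by (simp add: f_comm[OF E_B[OF ij(1,2)], symmetric] mul_assoc)
    finally show "snd (N r) i j \<star> snd (N r) l m = (if j = l then snd (N r) i m else 0)"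
      using M.unit_mul[OF ij] f_f[OF that that] by (simp add: N_def)
  qed (auto simp: N_def f_nz M.finite_index J_def[symmetric])
  have N_ent: "matrix_units.entries (words p (fst (N r))) (snd (N r)) = (\<star>) (f r) ` block_entries b" if "r < p" for r
    unfolding matrix_units.entries_def[OF N_units[OF that]]
    by (simp add: N_def M.entries_def image_image case_prod_unfold J_def[symmetric]
        flip: entries)
  define V where "V = span (\<Union>r<p. (\<star>) (f r) ` block_entries b)"
  have V_sub: "subspace V" by (simp add: V_def)
  have fB: "f r \<star> x \<in> V" if "r < p" "x \<in> B" for r x
    using that(2) unfolding B_def by (rule span_mul_left) (use that(1) in \<open>auto simp: V_def intro: span_base\<close>)
  have V_closed: "v \<star> y \<in> V" if v: "v \<in> V"
    and step: "\<And>r x. r < p \<Longrightarrow> x \<in> B \<Longrightarrow> f r \<star> x \<star> y \<in> V" for v y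
    using v unfolding V_def
    by (rule span_mul_right) (use step in \<open>auto simp: V_def B_def span_base\<close>)
  have V_eq: "V = corner (block_ident b)"
  proof
    show "V \<subseteq> corner (block_ident b)"
      unfolding V_def
    proof (rule span_minimal[OF _ subspace_corner], safe)
      fix r x assume rx: "r < p" "x \<in> block_entries b"
      hence x: "x \<in> B" by (simp add: B_def span_base)
      have "f r \<in> R" unfolding f_def g_def
        by (intro subspace_scale subspace_sum subspace_R zp_R)
      hence "f r \<star> x \<in> R" using S_subset_R BS[OF x] by (intro R_mul) auto
      moreover have "f r \<star> x = block_ident b \<star> (f r \<star> x)" by (simp add: e_f flip: mul_assoc)
      ultimately show "f r \<star> x \<in> corner (block_ident b)" by (auto simp: corner_def)
    qed
    have e_V: "block_ident b \<in> V"
    proof -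
      have "block_ident b = (\<Sum>r<p. f r \<star> block_ident b)" by (simp add: eB e_B sum_f flip: mul_sum_left)
      thus ?thesis using fB e_B by (metis (no_types, lifting) V_sub lessThan_iff subspace_sum)
    qed
    have "block_ident b \<star> r \<in> V" if "r \<in> R" for r
    proof (rule R_absorb[OF V_sub _ _ e_V that])
      fix v x assume v: "v \<in> V" and x: "x \<in> S"
      show "v \<star> x \<in> V"
      proof (rule V_closed[OF v])
        fix r y assume ry: "r < p" "y \<in> B"
        have "f r \<star> y \<star> x = f r \<star> (y \<star> (block_ident b \<star> x))"
          using eB(2)[OF ry(2)] by (metis mul_assoc)
        thus "f r \<star> y \<star> x \<in> V" using fB[OF ry(1) B_mul[OF ry(2) BSB[OF x]]] by simp
      qed
    next
      fix v assume v: "v \<in> V"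
      show "v \<star> \<gamma> 1 \<in> V"
      proof (rule V_closed[OF v])
        fix r y assume ry: "r < p" "y \<in> B"
        \<comment> \<open>On the block \<open>\<gamma> 1\<close> equals \<open>a \<star> z\<close>, and \<open>z\<close> moves left until it meets \<open>f r\<close>.\<close>
        have "f r \<star> y \<star> \<gamma> 1 = f r \<star> (y \<star> (a \<star> a')) \<star> \<gamma> 1"
          by (simp add: a(3) eB(2)[OF ry(2)])
        also have "\<dots> = f r \<star> (y \<star> a \<star> z)" by (simp add: z_def mul_assoc)
        also have "\<dots> = f r \<star> z \<star> (y \<star> a)" unfolding zx[OF B_mul[OF ry(2) a(1)], symmetric] by (simp add: mul_assoc)
        finally show "f r \<star> y \<star> \<gamma> 1 \<in> V"
          using fB[OF ry(1) B_mul[OF ry(2) a(1)]] subspace_scale[OF V_sub]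
          by (simp add: f_z mul_scale_left)
      qed
    qed
    thus "corner (block_ident b) \<subseteq> V" by (auto simp: corner_def)
  qed
  have "block_decomposition scale mul p (N ` {..<p}) (corner (block_ident b))"
  proof (intro block_decomposition.intro block_decomposition_axioms.intro assoc_algebra_axioms)
    show "p > 0" by (rule p_pos)
    show "finite (N ` {..<p})" by simp
    show "matrix_units scale mul (words p (fst c)) (snd c)" if "c \<in> N ` {..<p}" for c
      using that N_units by blast
    show "span (\<Union>c\<in>N ` {..<p}. matrix_units.entries (words p (fst c)) (snd c)) = corner (block_ident b)"
      using N_ent by (simp add: V_eq[symmetric] V_def)
    fix c c' x y assume *: "c \<in> N ` {..<p}" "c' \<in> N ` {..<p}" "c \<noteq> c'"
      "x \<in> matrix_units.entries (words p (fst c)) (snd c)"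
      "y \<in> matrix_units.entries (words p (fst c')) (snd c')"
    then obtain r s where rs: "r < p" "s < p" "c = N r" "c' = N s" "r \<noteq> s" by blast
    then obtain x' y' where xy: "x' \<in> B" "y' \<in> B" "x = f r \<star> x'" "y = f s \<star> y'"
      using * N_ent[of r] N_ent[of s] unfolding B_def by (blast intro: span_base)
    have "x \<star> y = f r \<star> (x' \<star> f s) \<star> y'" by (simp add: xy mul_assoc)
    also have "\<dots> = f r \<star> f s \<star> (x' \<star> y')" by (simp add: xy f_comm[symmetric] mul_assoc)
    finally show "x \<star> y = 0" using f_f rs by simp
  qed
  thus ?thesis by (auto simp: splits_def)
qed

end

section \<open>Cyclic extensions of prime degree: permuted blocks\<close>

context cyclic_extension_blocks begin

text \<open>The primitive central idempotents of \<open>S\<close>; conjugation acts on these elements, whereas the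
  matrix units of a block are not canonical.\<close>

definition block_idents :: "'a set" where
  "block_idents = block_ident ` F"

lemma P_S: "q \<in> block_idents \<Longrightarrow> q \<in> S"
  by (auto simp: block_idents_def e_in_S)

lemma P_central: "q \<in> block_idents \<Longrightarrow> x \<in> S \<Longrightarrow> q \<star> x = x \<star> q"
  by (auto simp: block_idents_def e_central)

lemma P_idem: "q \<in> block_idents \<Longrightarrow> q \<star> q = q"
  by (auto simp: block_idents_def e_idem)

lemma P_nonzero: "q \<in> block_idents \<Longrightarrow> q \<noteq> 0"
  by (auto simp: block_idents_def e_nonzero)

lemma P_orthogonal: "q \<in> block_idents \<Longrightarrow> q' \<in> block_idents \<Longrightarrow> q \<noteq> q' \<Longrightarrow> q \<star> q' = 0"
  by (auto simp: block_idents_def intro: e_orthogonal)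

lemma finite_P: "finite block_idents"
  by (simp add: block_idents_def finite_blocks)

lemma sum_P: "(\<Sum>q\<in>block_idents. q) = u"
  by (simp add: block_idents_def sum.reindex[OF e_inj] u_eq_sum_e)

text \<open>The conjugate of $q$ is a central idempotent, so it lies above some primitive one $c$.
  Conjugated back, $c$ becomes a nonzero central idempotent below $q$, hence $q$ itself.\<close>

lemma twist_P:
  assumes q: "q \<in> block_idents"
  shows "twist i q \<in> block_idents"
proof -
  have central: "twist j c \<star> x = x \<star> twist j c" if "c \<in> block_idents" "x \<in> S" for c j x
  proof -
    have x: "x = twist j (twist (- j) x)" using that by (simp add: twist_twist twist_0)
    have "twist j c \<star> x = twist j (c \<star> twist (- j) x)"
      by (subst x) (simp add: twist_mul P_S that)
    also have "\<dots> = twist j (twist (- j) x \<star> c)" by (simp only: P_central[OF that(1) twist_in[OF that(2)]])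
    also have "\<dots> = x \<star> twist j c" by (subst (2) x) (simp add: twist_mul twist_in that)
    finally show ?thesis .
  qed
  have idem: "twist j c \<star> twist j c = twist j c" if "c \<in> block_idents" for c j
    by (simp add: P_idem P_S that flip: twist_mul)
  have prim: "c \<star> twist j q' = c" if c: "c \<in> block_idents" "q' \<in> block_idents" "c \<star> twist j q' \<noteq> 0" for c j q'
  proof -
    obtain b where "b \<in> F" "c = block_ident b" using c by (auto simp: block_idents_def)
    thus ?thesis
      using e_primitive[OF _ twist_in[OF P_S[OF c(2)]] central[OF c(2)] idem[OF c(2)]] c(3) by blast
  qed
  have "(\<Sum>c\<in>block_idents. c \<star> twist i q) = twist i q"
    by (simp add: sum_P u_left twist_in P_S q flip: mul_sum_left)
  moreover have "twist i q \<noteq> 0" using q by (simp add: twist_eq_0_iff P_S P_nonzero)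
  ultimately have "(\<Sum>c\<in>block_idents. c \<star> twist i q) \<noteq> 0" by simp
  then obtain c where c: "c \<in> block_idents" "c \<star> twist i q \<noteq> 0"
    by (rule sum.not_neutral_contains_not_neutral)
  have "twist (- i) c = twist (- i) (c \<star> twist i q)" by (simp only: prim[OF c(1) q c(2)])
  also have "\<dots> = twist (- i) c \<star> q" by (simp add: twist_mul twist_twist twist_0 P_S c q)
  also have "\<dots> = q \<star> twist (- i) c" by (rule central[OF c(1) P_S[OF q]])
  finally have *: "twist (- i) c = q \<star> twist (- i) c" .
  moreover have "twist (- i) c \<noteq> 0" using c by (simp add: twist_eq_0_iff P_S P_nonzero)
  ultimately have "q \<star> twist (- i) c \<noteq> 0" by simp
  hence "twist (- i) c = q" by (rule trans[OF * prim[OF q c(1)]])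
  hence "twist i q = twist i (twist (- i) c)" by simp
  also have "\<dots> = c" by (simp add: twist_twist twist_0 P_S c)
  finally show ?thesis using c by simp
qed

text \<open>$\gamma^p$ belongs to \<open>S\<close>, so it commutes with central elements of \<open>S\<close>.\<close>

lemma twist_period:
  assumes q: "q \<in> block_idents"
  shows "twist (i + int p * m) q = twist i q"
proof -
  have "twist (int p * m) q = q \<star> \<gamma> (int p * m) \<star> \<gamma> (- (int p * m))"
    by (simp add: twist_def P_central[OF q gamma_p])
  also have "\<dots> = q" by (simp add: mul_assoc gamma_inverse u_right P_S q)
  finally show ?thesis using twist_twist[of i "int p * m" q] by simp
qed

text \<open>The exponents that fix \<open>q\<close> form a subgroup of $\<int>$ that contains the prime $p$ but not
  $1$, so it is $p\<int>$.\<close>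

lemma twist_free:
  assumes q: "q \<in> block_idents" and moved: "twist 1 q \<noteq> q" and i: "\<not> int p dvd i"
  shows "twist i q \<noteq> q"
proof
  assume fix_i: "twist i q = q"
  have mult: "twist (i * int n) q = q" for n
  proof (induction n)
    case (Suc n)
    have "twist (i * int (Suc n)) q = twist i (twist (i * int n) q)"
      by (simp add: twist_twist algebra_simps)
    thus ?case by (simp add: Suc fix_i)
  qed (simp add: twist_0 P_S q)
  have mult_int: "twist (i * x) q = q" for x
  proof (cases x rule: int_cases2)
    case (nonpos n)
    have "twist (i * x) q = twist (i * x) (twist (i * int n) q)" by (simp add: mult)
    thus ?thesis by (simp add: nonpos twist_twist twist_0 P_S q)
  qed (simp add: mult)
  have "coprime (int p) i"
    using i prime_p by (intro prime_imp_coprime) simp_all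
  hence "gcd i (int p) = 1" by (simp add: coprime_iff_gcd_eq_1 gcd.commute)
  then obtain n m where m: "i * n + int p * m = 1"
    using bezout_int[of i "int p"] by (metis mult.commute)
  have "twist 1 q = twist (i * n + int p * m) q" by (simp add: m)
  thus False using moved by (simp add: twist_period q mult_int)
qed

text \<open>The $p$ conjugates $e_i = \gamma^{-i} e \gamma^i$ are orthogonal, so for the units $E$ of
  the block $e$ the elements $\gamma^{-i} E_{ww'} \gamma^j$ with $i, j < p$ are matrix units again:
  the middle factor $\gamma^{j-l}$ of a product moves $e$ away from itself unless $j = l$. The new
  coordinate $i$ is stored at position $k$ of the word.\<close>

lemma splits_moved_block:
  assumes b: "b \<in> F" and moved: "twist 1 (block_ident b) \<noteq> block_ident b"
  defines "Orb \<equiv> range (\<lambda>i. twist i (block_ident b))"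
  shows "splits p (corner (\<Sum>q\<in>Orb. q))"
proof -
  define k E B where "k = fst b" and "E = snd b" and "B = span (block_entries b)"
  define J where "J = words p k"
  interpret M: matrix_units scale mul J E
    unfolding J_def E_def k_def by (rule block[OF b])
  have entries: "M.entries = block_entries b" and ident: "M.ident = block_ident b"
    by (simp_all add: block_ident_def block_entries_def J_def E_def k_def)
  have E_B: "E i j \<in> B" if "i \<in> J" "j \<in> J" for i j
    unfolding B_def using M.entry_in_span[OF that] by (simp add: entries)
  have BS: "x \<in> S" if "x \<in> B" for x using that span_ent_subset[OF b] by (auto simp: B_def)
  have B_mul: "x \<star> y \<in> B" if "x \<in> B" "y \<in> B" for x y
    using ent_mul[OF b] that by (simp add: B_def)
  have eB: "block_ident b \<star> x = x" "x \<star> block_ident b = x" if "x \<in> B" for x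
    using e_mul mul_e b that by (simp_all add: B_def)
  have BSB: "x \<star> y \<in> B" if "x \<in> B" "y \<in> S" for x y
  proof -
    have "x \<star> y = x \<star> (block_ident b \<star> y)" using eB(2)[OF that(1)] by (simp flip: mul_assoc)
    thus ?thesis using B_mul[OF that(1)] e_mul_in[OF b that(2)] by (simp add: B_def)
  qed
  have eP: "block_ident b \<in> block_idents" using b by (simp add: block_idents_def)
  have OP: "Orb \<subseteq> block_idents" using twist_P[OF eP] by (auto simp: Orb_def)
  have fin_O: "finite Orb" by (rule finite_subset[OF OP finite_P])
  define s where "s = (\<Sum>q\<in>Orb. q)"
  have s_mul: "s \<star> q = q" if "q \<in> Orb" for q
  proof -
    have "s \<star> q = (\<Sum>c\<in>Orb. if c = q then q else 0)"
      unfolding s_def mul_sum_left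
      by (rule sum.cong) (use that OP in \<open>auto simp: P_idem intro!: P_orthogonal\<close>)
    thus ?thesis using that fin_O by simp
  qed
  define T where "T w x w' = \<gamma> (- int w) \<star> x \<star> \<gamma> (int w')" for w x w'
  have T_mul: "T i x j \<star> T l y m = (if j = l then T i (x \<star> y) m else 0)"
    if "x \<in> B" "y \<in> B" "j < p" "l < p" for i j l m x y
  proof (cases "j = l")
    case True
    have "T i x j \<star> T l y m = \<gamma> (- int i) \<star> x \<star> (\<gamma> (int j) \<star> \<gamma> (- int l)) \<star> y \<star> \<gamma> (int m)"
      by (simp add: T_def mul_assoc)
    thus ?thesis using True that by (simp add: T_def mul_assoc gamma_inverse u_left BS)
  next
    case False
    define d where "d = int j - int l"
    have "\<not> int p dvd d"
    proof
      assume "int p dvd d"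
      hence "\<bar>int p\<bar> \<le> \<bar>d\<bar>" using False by (intro dvd_imp_le_int) (simp_all add: d_def)
      thus False using that by (simp add: d_def)
    qed
    hence "twist d (block_ident b) \<noteq> block_ident b" by (rule twist_free[OF eP moved])
    hence orth: "block_ident b \<star> twist d (block_ident b) = 0"
      using P_orthogonal[OF eP twist_P[OF eP]] by metis
    have "\<gamma> (int j) \<star> \<gamma> (- int l) = \<gamma> d" using gamma_add[of "int j" "- int l"] by (simp add: d_def)
    hence "T i x j \<star> T l y m = \<gamma> (- int i) \<star> (x \<star> block_ident b) \<star> \<gamma> d \<star> (block_ident b \<star> y) \<star> \<gamma> (int m)"
      by (simp add: T_def mul_assoc eB that)
         (metis mul_assoc)
    also have "\<dots> = \<gamma> (- int i) \<star> x \<star> (block_ident b \<star> twist d (block_ident b)) \<star> \<gamma> d \<star> y \<star> \<gamma> (int m)"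
    proof -
      have "\<gamma> d \<star> (block_ident b \<star> y) = twist d (block_ident b) \<star> \<gamma> d \<star> y"
        by (simp add: gamma_commute[OF P_S[OF eP]] flip: mul_assoc)
      thus ?thesis by (simp add: mul_assoc)
    qed
    finally show ?thesis using False by (simp add: orth)
  qed
  have T_zero: "T i 0 j = 0" for i j by (simp add: T_def)
  have T_nz: "T i x j \<noteq> 0" if "x \<in> B" "x \<noteq> 0" for i j x
  proof
    assume "T i x j = 0"
    hence "\<gamma> (int i) \<star> T i x j \<star> \<gamma> (- int j) = 0" by simp
    moreover have "\<gamma> (int i) \<star> T i x j \<star> \<gamma> (- int j)
        = (\<gamma> (int i) \<star> \<gamma> (- int i)) \<star> x \<star> (\<gamma> (int j) \<star> \<gamma> (- int j))"
      by (simp add: T_def mul_assoc)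
    ultimately show False using that by (simp add: gamma_inverse u_left u_right BS)
  qed
  define N where "N w w' = T (w k) (E (w(k := 0)) (w'(k := 0))) (w' k)" for w w'
  have N_units: "matrix_units scale mul (words p (Suc k)) N"
  proof (intro matrix_units.intro matrix_units_axioms.intro assoc_algebra_axioms finite_words)
    fix i j l m assume "i \<in> words p (Suc k)" "j \<in> words p (Suc k)" "l \<in> words p (Suc k)" "m \<in> words p (Suc k)"
    hence J: "i(k := 0) \<in> J" "j(k := 0) \<in> J" "l(k := 0) \<in> J" "m(k := 0) \<in> J"
      and lt: "j k < p" "l k < p" by (auto simp: J_def dest: words_SucD)
    have "j = l \<longleftrightarrow> j k = l k \<and> j(k := 0) = l(k := 0)"
      by (metis fun_upd_idem_iff fun_upd_upd)
    thus "N i j \<star> N l m = (if j = l then N i m else 0)"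
      by (simp add: N_def T_mul[OF E_B E_B] J lt M.unit_mul T_zero)
  next
    fix i j assume "i \<in> words p (Suc k)" "j \<in> words p (Suc k)"
    hence J: "i(k := 0) \<in> J" "j(k := 0) \<in> J" by (auto simp: J_def dest: words_SucD)
    show "N i j \<noteq> 0" unfolding N_def by (rule T_nz[OF E_B[OF J] M.unit_nonzero[OF J]])
  qed
  define V where "V = span (matrix_units.entries (words p (Suc k)) N)"
  have V_sub: "subspace V" by (simp add: V_def)
  have N_ent: "matrix_units.entries (words p (Suc k)) N = {T i x j |i x j. i < p \<and> j < p \<and> x \<in> block_entries b}"
    (is "?l = ?r")
  proof
    show "?l \<subseteq> ?r"
      unfolding matrix_units.entries_def[OF N_units]
      by (auto simp: N_def J_def simp flip: entries dest!: words_SucD intro!: M.entriesI)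
         (metis J_def M.entriesI entries)
  next
    show "?r \<subseteq> ?l"
    proof safe
      fix i x j assume *: "i < p" "j < p" "x \<in> block_entries b"
      then obtain v w where vw: "v \<in> J" "w \<in> J" "x = E v w" using M.entriesE[of x] entries by metis
      hence "T i x j = N (v(k := i)) (w(k := j))"
        by (simp add: N_def words_upd_0 J_def)
      thus "T i x j \<in> ?l"
        using matrix_units.entriesI[OF N_units] words_SucI vw * by (simp add: J_def)
    qed
  qed
  have T_V: "T i x j \<in> V" if "i < p" "j < p" "x \<in> B" for i x j
  proof -
    have "\<gamma> (- int i) \<star> x \<in> {y. y \<star> \<gamma> (int j) \<in> V}"
      using that(3) unfolding B_def
      by (rule span_mul_left[OF _ subspace_mul_right_preimage[OF V_sub]])
         (use that in \<open>auto simp: V_def N_ent T_def[symmetric] intro!: span_base\<close>)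
    thus ?thesis by (simp add: T_def)
  qed
  have V_closed: "v \<star> y \<in> V" if v: "v \<in> V"
    and step: "\<And>i x j. i < p \<Longrightarrow> j < p \<Longrightarrow> x \<in> B \<Longrightarrow> T i x j \<star> y \<in> V" for v y
    using v unfolding V_def
    by (rule span_mul_right) (use step in \<open>auto simp: N_ent V_def B_def span_base\<close>)
  have T_diag: "T i (block_ident b) i = twist (- int i) (block_ident b)" for i
    by (simp add: T_def twist_def)
  have V_eq: "V = corner s"
  proof
    show "V \<subseteq> corner s"
      unfolding V_def N_ent
    proof (rule span_minimal[OF _ subspace_corner], safe)
      fix i x j assume "i < p" "j < p" "x \<in> block_entries b"
      hence x: "x \<in> B" by (simp add: B_def span_base)
      have "T i x j \<in> R"
        unfolding T_def using x BS S_subset_R by (intro R_mul gamma_in_R) auto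
      moreover have "T i x j = s \<star> T i x j"
      proof -
        have "T i x j = \<gamma> (- int i) \<star> block_ident b \<star> (x \<star> \<gamma> (int j))"
          using eB(1)[OF x] by (simp add: T_def mul_assoc) (metis mul_assoc)
        hence T: "T i x j = twist (- int i) (block_ident b) \<star> \<gamma> (- int i) \<star> (x \<star> \<gamma> (int j))"
          by (simp add: gamma_commute P_S eP)
        have "s \<star> twist (- int i) (block_ident b) = twist (- int i) (block_ident b)"
          by (rule s_mul) (simp add: Orb_def)
        thus ?thesis by (simp add: T flip: mul_assoc)
      qed
      ultimately show "T i x j \<in> corner s" by (auto simp: corner_def)
    qed
    have s_V: "s \<in> V"
      unfolding s_def
    proof (rule subspace_sum[OF V_sub])
      fix q assume "q \<in> Orb"
      then obtain j where j: "q = twist j (block_ident b)" by (auto simp: Orb_def)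
      define i where "i = nat ((- j) mod int p)"
      have "int p * ((- j) div int p) + int i = - j" using p_pos by (simp add: i_def)
      hence "- int i = j + int p * ((- j) div int p)" by linarith
      hence "q = twist (- int i) (block_ident b)" by (simp only: j twist_period[OF eP])
      moreover have "i < p" using p_pos by (simp add: i_def nat_less_iff)
      moreover have "block_ident b \<in> B" using e_in_ent[OF b] by (simp add: B_def)
      ultimately show "q \<in> V" using T_V[of i i "block_ident b"] by (simp add: T_diag)
    qed
    have "s \<star> r \<in> V" if "r \<in> R" for r
    proof (rule R_absorb[OF V_sub _ _ s_V that])
      fix v y assume v: "v \<in> V" and y: "y \<in> S"
      show "v \<star> y \<in> V"
      proof (rule V_closed[OF v])
        fix i x j assume *: "i < p" "j < p" "x \<in> B"
        have "T i x j \<star> y = T i (x \<star> twist (int j) y) j"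
          by (simp add: T_def mul_assoc gamma_commute y)
        thus "T i x j \<star> y \<in> V" using * T_V BSB twist_in y by simp
      qed
    next
      fix v assume v: "v \<in> V"
      show "v \<star> \<gamma> 1 \<in> V"
      proof (rule V_closed[OF v])
        fix i x j assume *: "i < p" "j < p" "x \<in> B"
        have T1: "T i x j \<star> \<gamma> 1 = T i x (Suc j)"
          using gamma_add[of "int j" 1] by (simp add: T_def mul_assoc add.commute)
        show "T i x j \<star> \<gamma> 1 \<in> V"
        \<comment> \<open>At the end of the range, \<open>\<gamma> p\<close> is absorbed into the block.\<close>
        proof (cases "Suc j = p")
          case False
          thus ?thesis using * T1 T_V by simp
        next
          case True
          have "T i x p = T i (x \<star> \<gamma> (int p * 1)) 0"
            using gamma_p[of 1] by (simp add: T_def mul_assoc gamma_0 u_right)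
          thus ?thesis using * T1 True T_V BSB gamma_p by (metis p_pos)
        qed
      qed
    qed
    thus "corner s \<subseteq> V" by (auto simp: corner_def)
  qed
  have "block_decomposition scale mul p {(Suc k, N)} (corner s)"
    by (intro block_decomposition.intro block_decomposition_axioms.intro assoc_algebra_axioms)
       (use p_pos N_units V_eq in \<open>auto simp: V_def\<close>)
  thus ?thesis unfolding s_def splits_def by blast
qed

text \<open>Removing the orbit of one block identity from \<open>Q\<close> splits off a direct summand of the
  extension, because sums over sets that are stable under conjugation are central in \<open>R\<close>.\<close>

lemma splits_stable_set:
  assumes "finite Q" "Q \<subseteq> block_idents" "\<And>i q. q \<in> Q \<Longrightarrow> twist i q \<in> Q"
  shows "splits p (corner (\<Sum>q\<in>Q. q))"
  using assms
proof (induction Q rule: finite_psubset_induct)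
  case (psubset Q)
  show ?case
  proof (cases "Q = {}")
    case True
    have "corner 0 = {0}" unfolding corner_def using S_subset_R u_in_S by auto
    thus ?thesis using True splits_zero[OF p_pos] by simp
  next
    case False
    then obtain b where b: "b \<in> F" "block_ident b \<in> Q" using psubset.prems(1) unfolding block_idents_def by blast
    define Orb where "Orb = range (\<lambda>i. twist i (block_ident b))"
    have eP: "block_ident b \<in> block_idents" and eS: "block_ident b \<in> S" using b psubset.prems P_S by blast+
    have e_O: "block_ident b \<in> Orb" unfolding Orb_def using twist_0[OF eS] by (metis rangeI)
    have OQ: "Orb \<subseteq> Q" using psubset.prems(2)[OF b(2)] by (auto simp: Orb_def)
    have stable_O: "twist i q \<in> Orb" if "q \<in> Orb" for i q
      using that by (auto simp: Orb_def twist_twist)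
    have stable_D: "twist i q \<in> Q - Orb" if "q \<in> Q - Orb" for i q
    proof -
      have "q = twist (- i) (twist i q)"
        using that psubset.prems(1) P_S by (auto simp: twist_twist twist_0)
      thus ?thesis using that stable_O psubset.prems(2) by (metis DiffD1 DiffD2 DiffI)
    qed
    have splits_O: "splits p (corner (\<Sum>q\<in>Orb. q))"
    proof (cases "twist 1 (block_ident b) = block_ident b")
      case True
      have "twist (int n) (block_ident b) = block_ident b" for n
      proof (induction n)
        case (Suc n)
        have "twist (int (Suc n)) (block_ident b) = twist 1 (twist (int n) (block_ident b))" by (simp add: twist_twist)
        thus ?case by (simp add: Suc True)
      qed (simp add: twist_0 eS)
      hence "twist i (block_ident b) = block_ident b" for i
        using twist_period[OF eP, of "i mod int p" "i div int p"] p_pos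
        by (metis mod_mult_div_eq add.commute mult.commute int_nat_eq of_nat_0_less_iff pos_mod_sign)
      hence "Orb = {block_ident b}" by (auto simp: Orb_def)
      thus ?thesis using splits_fixed_block[OF b(1) True] by simp
    next
      case False
      show ?thesis unfolding Orb_def by (rule splits_moved_block[OF b(1) False])
    qed
    have splits_D: "splits p (corner (\<Sum>q\<in>Q - Orb. q))"
      by (rule psubset.IH) (use stable_D psubset.prems e_O b in auto)
    have sum_comm: "(\<Sum>q\<in>A. q) \<star> r = r \<star> (\<Sum>q\<in>A. q)"
      if A: "A \<subseteq> Q" "\<And>i q. q \<in> A \<Longrightarrow> twist i q \<in> A" and r: "r \<in> R" for A r
    proof -
      have AP: "A \<subseteq> block_idents" using A psubset.prems by blast
      have sum_S: "(\<Sum>q\<in>A. q) \<in> S" by (rule subspace_sum[OF S_subspace]) (use AP P_S in blast)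
      have twist_sum: "twist i (\<Sum>q\<in>A. q) = (\<Sum>q\<in>A. q)" for i
      proof -
        have inv: "twist (- i) (twist i q) = q" "twist i (twist (- i) q) = q" if "q \<in> A" for q
          using that AP P_S by (auto simp: twist_twist twist_0)
        have "bij_betw (twist i) A A"
          by (rule bij_betw_byWitness[where f' = "twist (- i)"]) (use inv A in auto)
        thus ?thesis by (simp add: twist_sum sum.reindex_bij_betw[where g = "\<lambda>x. x"])
      qed
      show ?thesis
        using r unfolding R_def
      proof (rule span_commute)
        fix y assume "y \<in> {x \<star> \<gamma> i |x i. x \<in> S}"
        then obtain x i where y: "y = x \<star> \<gamma> i" "x \<in> S" by blast
        have "(\<Sum>q\<in>A. q) \<star> x = x \<star> (\<Sum>q\<in>A. q)"
          unfolding mul_sum_left mul_sum_right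
          by (rule sum.cong) (use AP P_central y in blast)+
        hence "(\<Sum>q\<in>A. q) \<star> y = x \<star> ((\<Sum>q\<in>A. q) \<star> \<gamma> i)" by (simp add: y mul_assoc[symmetric])
        also have "(\<Sum>q\<in>A. q) \<star> \<gamma> i = \<gamma> i \<star> (\<Sum>q\<in>A. q)"
          using gamma_commute[OF sum_S, of i] by (simp add: twist_sum)
        finally show "(\<Sum>q\<in>A. q) \<star> y = y \<star> (\<Sum>q\<in>A. q)" by (simp add: y mul_assoc)
      qed
    qed
    define s t where "s = (\<Sum>q\<in>Orb. q)" and "t = (\<Sum>q\<in>Q - Orb. q)"
    have s_comm: "s \<star> r = r \<star> s" and t_comm: "t \<star> r = r \<star> t" if "r \<in> R" for r
      unfolding s_def t_def using that OQ stable_O stable_D by (auto intro!: sum_comm)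
    have st: "s \<star> t = 0"
      unfolding s_def t_def mul_sum_left mul_sum_right
      using OQ psubset.prems(1) by (intro sum.neutral ballI P_orthogonal) auto
    have ss: "s \<star> s = s"
    proof -
      have "s \<star> s = (\<Sum>q\<in>Orb. \<Sum>q'\<in>Orb. if q' = q then q' else 0)"
        unfolding s_def mul_sum_left mul_sum_right
        by (subst sum.swap, intro sum.cong refl)
           (use OQ psubset.prems(1) in \<open>auto simp: P_idem intro!: P_orthogonal\<close>)
      thus ?thesis using finite_subset[OF OQ psubset.hyps] by (simp add: s_def)
    qed
    have st_R: "s \<in> R" "t \<in> R"
      unfolding s_def t_def using OQ psubset.prems(1) P_S S_subset_R
      by (auto intro!: subspace_sum[OF subspace_R])
    have ts: "t \<star> s = 0" using s_comm[OF st_R(2)] st by simp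
    have sum_Q: "(\<Sum>q\<in>Q. q) = s + t"
      using sum.subset_diff[OF OQ psubset.hyps, of "\<lambda>q. q"] by (simp add: s_def t_def add.commute)
    have st_t: "(s + t) \<star> s = s" by (simp add: mul_add_left ss ts)
    have "splits p (span (corner s \<union> corner t))"
    proof (rule splits_Un)
      show "splits p (corner s)" "splits p (corner t)" using splits_O splits_D by (simp_all add: s_def t_def)
      fix x y assume "x \<in> corner s" "y \<in> corner t"
      then obtain r r' where r: "r \<in> R" "r' \<in> R" "x = s \<star> r" "y = t \<star> r'" by (auto simp: corner_def)
      have "x \<star> y = s \<star> (r \<star> t) \<star> r'" by (simp add: r mul_assoc)
      also have "\<dots> = (s \<star> t) \<star> (r \<star> r')" by (simp add: t_comm[OF r(1), symmetric] mul_assoc)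
      finally show "x \<star> y = 0" by (simp add: st)
      have "y \<star> x = t \<star> (r' \<star> s) \<star> r" by (simp add: r mul_assoc)
      also have "\<dots> = (t \<star> s) \<star> (r' \<star> r)" by (simp add: s_comm[OF r(2), symmetric] mul_assoc)
      finally show "y \<star> x = 0" by (simp add: ts)
    qed
    moreover have "span (corner s \<union> corner t) = corner (s + t)"
    proof
      show "span (corner s \<union> corner t) \<subseteq> corner (s + t)"
      proof (rule span_minimal[OF _ subspace_corner])
        have "s \<star> r = (s + t) \<star> (s \<star> r)" for r by (simp add: st_t flip: mul_assoc)
        moreover have "t \<star> r = (s + t) \<star> (r - s \<star> r)" for r
        proof -
          have "(s + t) \<star> (s \<star> r) = s \<star> r" by (simp add: st_t flip: mul_assoc)
          moreover have "(s + t) \<star> (r - s \<star> r) + (s + t) \<star> (s \<star> r) = (s + t) \<star> r"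
            by (simp only: mul_add_right[symmetric] diff_add_cancel)
          ultimately have "(s + t) \<star> (r - s \<star> r) + s \<star> r = s \<star> r + t \<star> r"
            by (simp only: mul_add_left)
          thus ?thesis by (simp add: add.commute)
        qed
        moreover have "s \<star> r \<in> R" "r - s \<star> r \<in> R" if "r \<in> R" for r
          using that st_R by (auto intro!: R_mul subspace_diff[OF subspace_R])
        ultimately show "corner s \<union> corner t \<subseteq> corner (s + t)" unfolding corner_def by blast
      qed
      show "corner (s + t) \<subseteq> span (corner s \<union> corner t)"
      proof
        fix x assume "x \<in> corner (s + t)"
        then obtain r where r: "r \<in> R" "x = s \<star> r + t \<star> r" by (auto simp: corner_def mul_add_left)
        have "s \<star> r \<in> corner s" "t \<star> r \<in> corner t" using r by (auto simp: corner_def)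
        thus "x \<in> span (corner s \<union> corner t)" unfolding r(2) by (intro span_add) (auto intro: span_base)
      qed
    qed
    ultimately show ?thesis by (simp add: sum_Q)
  qed
qed

theorem splits_extension: "splits p R"
proof -
  have "corner u = R" using u_R by (force simp: corner_def)
  thus ?thesis using splits_stable_set[OF finite_P order.refl twist_P] by (simp add: sum_P)
qed

end

text \<open>The step of the induction along a subgroup chain, without reference to groups.\<close>

theorem (in cyclic_extension) splits_R:
  assumes "splits p S"
  shows "splits p R"
proof -
  obtain F where "block_decomposition scale mul p F S" using assms by (auto simp: splits_def)
  then interpret B: block_decomposition scale mul p F S .
  interpret cyclic_extension_blocks scale mul p \<zeta> S u \<gamma> F ..
  show ?thesis by (rule splits_extension)
qed

section \<open>Subgroups of prime index in groups of prime power order\<close>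

lemma card_image_same_fibers:
  assumes "\<And>a b. a \<in> A \<Longrightarrow> b \<in> A \<Longrightarrow> f a = f b \<longleftrightarrow> g a = g b"
  shows "card (f ` A) = card (g ` A)"
proof (rule bij_betw_same_card)
  have g: "g (inv_into A f (f a)) = g a" if "a \<in> A" for a
    using assms[of "inv_into A f (f a)" a] that by (simp add: inv_into_into f_inv_into_f)
  show "bij_betw (\<lambda>y. g (inv_into A f y)) (f ` A) (g ` A)"
    unfolding bij_betw_def
    by (simp add: inj_on_def image_image g assms)
qed

text \<open>$N$ acts on the $p$ cosets of $N$ by right multiplication and fixes the coset $N$. The orbit
  of another coset $Nx$ has at most $p - 1$ elements, but its size is the index in $N$ of the
  stabiliser $K = N \cap x^{-1}Nx$ and thus a power of $p$. So it is $1$, which means $K = N$.\<close>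

lemma (in group) prime_index_normal:
  assumes fin: "finite (carrier G)" and N: "subgroup N G" and p: "prime p"
    and card_N: "card N = p ^ m" and order: "Coset.order G = p ^ Suc m"
  shows "N \<lhd> G"
  unfolding normal_inv_iff
proof (intro conjI ballI)
  fix x n assume x: "x \<in> carrier G" and n: "n \<in> N"
  note sub = subgroup.subset[OF N] subgroup.mem_carrier[OF N]
  have l_cancel_inv: "inv x \<otimes> (x \<otimes> y) = y" if "y \<in> carrier G" for y
    using x that by (simp flip: m_assoc)
  show "x \<otimes> n \<otimes> inv x \<in> N"
  proof (cases "x \<in> N")
    case True
    thus ?thesis using n N by (simp add: subgroup.m_closed subgroup.m_inv_closed)
  next
    case xN: False
    define K where "K = {n \<in> N. x \<otimes> n \<otimes> inv x \<in> N}"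
    interpret N: group "G\<lparr>carrier := N\<rparr>" by (rule subgroup_imp_group[OF N])
    have K: "subgroup K (G\<lparr>carrier := N\<rparr>)"
    proof (rule N.subgroupI)
      show "K \<subseteq> carrier (G\<lparr>carrier := N\<rparr>)" by (auto simp: K_def)
      have "\<one> \<in> K" using x by (simp add: K_def subgroup.one_closed[OF N])
      thus "K \<noteq> {}" by blast
      fix a assume a: "a \<in> K"
      have "x \<otimes> inv a \<otimes> inv x = inv (x \<otimes> a \<otimes> inv x)"
        using a x sub by (simp add: K_def inv_mult_group m_assoc)
      thus "inv\<^bsub>G\<lparr>carrier := N\<rparr>\<^esub> a \<in> K"
        using a N by (simp add: K_def subgroup.m_inv_closed m_inv_consistent)
      fix b assume b: "b \<in> K"
      have "x \<otimes> (a \<otimes> b) \<otimes> inv x = (x \<otimes> a \<otimes> inv x) \<otimes> (x \<otimes> b \<otimes> inv x)"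
        using a b x sub l_cancel_inv by (simp add: K_def m_assoc)
      thus "a \<otimes>\<^bsub>G\<lparr>carrier := N\<rparr>\<^esub> b \<in> K"
        using a b N by (simp add: K_def subgroup.m_closed)
    qed
    have lag: "card (rcosets\<^bsub>G\<lparr>carrier := N\<rparr>\<^esub> K) * card K = p ^ m"
      using N.lagrange[OF K] card_N by (simp add: Coset.order_def)
    have fiber: "N #> (x \<otimes> a) = N #> (x \<otimes> b) \<longleftrightarrow>
        K #>\<^bsub>G\<lparr>carrier := N\<rparr>\<^esub> a = K #>\<^bsub>G\<lparr>carrier := N\<rparr>\<^esub> b" if ab: "a \<in> N" "b \<in> N" for a b
    proof -
      have "N #> (x \<otimes> a) = N #> (x \<otimes> b) \<longleftrightarrow> (x \<otimes> a) \<otimes> inv (x \<otimes> b) \<in> N"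
        using ab x sub repr_independence[of "x \<otimes> a" N "x \<otimes> b"] rcos_self[of "x \<otimes> a" N]
          subgroup.rcos_module[OF N is_group, of "x \<otimes> b" "x \<otimes> a"] N
        by (metis m_closed)
      also have "(x \<otimes> a) \<otimes> inv (x \<otimes> b) = x \<otimes> (a \<otimes> inv b) \<otimes> inv x"
        using ab x sub by (simp add: inv_mult_group m_assoc)
      also have "x \<otimes> (a \<otimes> inv b) \<otimes> inv x \<in> N \<longleftrightarrow> a \<otimes> inv b \<in> K"
        using ab N by (simp add: K_def subgroup.m_closed subgroup.m_inv_closed)
      also have "a \<otimes> inv b \<in> K \<longleftrightarrow> K #>\<^bsub>G\<lparr>carrier := N\<rparr>\<^esub> a = K #>\<^bsub>G\<lparr>carrier := N\<rparr>\<^esub> b"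
        using ab N.repr_independence[of a K b] N.rcos_self[of a K]
          subgroup.rcos_module[OF K N.is_group, of b a] K m_inv_consistent[OF N ab(2)]
        by auto
      finally show ?thesis .
    qed
    have "card (rcosets\<^bsub>G\<lparr>carrier := N\<rparr>\<^esub> K) = card ((\<lambda>a. N #> (x \<otimes> a)) ` N)"
    proof -
      have "rcosets\<^bsub>G\<lparr>carrier := N\<rparr>\<^esub> K = (\<lambda>a. K #>\<^bsub>G\<lparr>carrier := N\<rparr>\<^esub> a) ` N"
        by (auto simp: RCOSETS_def)
      moreover have "card ((\<lambda>a. K #>\<^bsub>G\<lparr>carrier := N\<rparr>\<^esub> a) ` N) = card ((\<lambda>a. N #> (x \<otimes> a)) ` N)"
        by (rule card_image_same_fibers) (simp only: fiber)
      ultimately show ?thesis by simp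
    qed
    also have "\<dots> \<le> card (rcosets N - {N})"
    proof (rule card_mono)
      show "finite (rcosets N - {N})" using fin by (simp add: RCOSETS_def)
      show "(\<lambda>a. N #> (x \<otimes> a)) ` N \<subseteq> rcosets N - {N}"
      proof safe
        fix a assume a: "a \<in> N"
        show "N #> (x \<otimes> a) \<in> rcosets N" using a x sub by (intro rcosetsI) auto
        assume "N #> (x \<otimes> a) = N"
        hence "x \<otimes> a \<in> N" using a x sub by (intro coset_join1[OF _ _ N]) auto
        hence "x \<otimes> a \<otimes> inv a \<in> N" using a N by (simp add: subgroup.m_closed subgroup.m_inv_closed)
        thus False using xN a x sub by (simp add: m_assoc)
      qed
    qed
    also have "\<dots> < p"
    proof -
      have "card (rcosets N) * p ^ m = p * p ^ m" using lagrange[OF N] card_N order by simp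
      hence "card (rcosets N) = p" using p by (simp add: prime_gt_0_nat)
      moreover have "N \<in> rcosets N" using subgroup.rcosets_carrier N coset_join2[OF one_closed N subgroup.one_closed[OF N]]
        rcosetsI[OF sub(1) one_closed] by simp
      ultimately show ?thesis using p fin by (simp add: RCOSETS_def prime_gt_0_nat)
    qed
    finally have lt: "card (rcosets\<^bsub>G\<lparr>carrier := N\<rparr>\<^esub> K) < p" .
    have "card (rcosets\<^bsub>G\<lparr>carrier := N\<rparr>\<^esub> K) dvd p ^ m" using lag by (metis dvd_triv_left)
    then obtain i where i: "card (rcosets\<^bsub>G\<lparr>carrier := N\<rparr>\<^esub> K) = p ^ i"
      using p by (auto simp: divides_primepow_nat)
    have "i = 0"
    proof (rule ccontr)
      assume "i \<noteq> 0"
      hence "p ^ 1 \<le> p ^ i" using p by (intro power_increasing) (auto simp: prime_gt_0_nat Suc_leI)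
      thus False using lt i by simp
    qed
    hence "card K = card N" using lag i card_N by simp
    moreover have "K \<subseteq> N" "finite N" using fin sub finite_subset by (auto simp: K_def)
    ultimately have "K = N" by (simp add: card_subset_eq)
    thus ?thesis using n by (auto simp: K_def)
  qed
qed (rule N)

text \<open>The facts on \<open>g\<close> are what the crossed product needs; they hold since the coset of \<open>g\<close>
  generates the quotient by \<open>N\<close>, which has prime order.\<close>

lemma (in group) prime_power_cyclic_extension:
  assumes fin: "finite (carrier G)" and p: "prime p" and order: "Coset.order G = p ^ Suc m"
  obtains N g where "subgroup N G" "card N = p ^ m" "g \<in> carrier G"
    "\<And>(i::int) n. n \<in> N \<Longrightarrow> g [^] i \<otimes> n \<otimes> g [^] (- i) \<in> N"
    "\<And>i::int. g [^] (int p * i) \<in> N"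
    "\<And>i. 0 < i \<Longrightarrow> i < p \<Longrightarrow> g [^] int i \<notin> N"
    "\<And>h. h \<in> carrier G \<Longrightarrow> \<exists>n\<in>N. \<exists>i::int. h = n \<otimes> g [^] i"
proof -
  obtain N where N: "subgroup N G" and card_N: "card N = p ^ m"
    using sylow_thm[OF p is_group, of m p] order fin by auto
  interpret N: normal N G by (rule prime_index_normal[OF fin N p card_N order])
  interpret Q: group "G Mod N" by (rule N.factorgroup_is_group)
  have "card N < card (carrier G)"
    using order prime_gt_1_nat[OF p] by (simp add: card_N Coset.order_def prime_gt_0_nat p)
  hence "N \<noteq> carrier G" by auto
  then obtain g where g: "g \<in> carrier G" "g \<notin> N" using N.subset by blast
  let ?a = "N #> g"
  have a: "?a \<in> carrier (G Mod N)" using g by (auto simp: carrier_FactGroup)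
  have order_Q: "Coset.order (G Mod N) = p"
    using lagrange[OF N] card_N order p by (simp add: Coset.order_def FactGroup_def prime_gt_0_nat)
  have pow: "?a [^]\<^bsub>G Mod N\<^esub> i = N #> (g [^] i)" for i :: int
    using N.FactGroup_int_pow g by simp
  have coset_iff: "N #> h = N \<longleftrightarrow> h \<in> N" if "h \<in> carrier G" for h
    using coset_join1[OF _ that N] coset_join2[OF that N] by blast
  have "Q.ord ?a dvd p" using Q.ord_dvd_group_order[OF a] by (simp add: order_Q)
  moreover have "Q.ord ?a \<noteq> 1"
    using Q.int_pow_eq_id[OF a, of 1] pow[of 1] coset_iff[OF g(1)] g by simp
  ultimately have ord: "Q.ord ?a = p" using p by (auto simp: prime_nat_iff)
  have pow_N: "g [^] i \<in> N \<longleftrightarrow> int p dvd i" for i :: int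
    using Q.int_pow_eq_id[OF a, of i] coset_iff[of "g [^] i"] g by (simp add: ord pow)
  show ?thesis
  proof (rule that[OF N card_N g(1)])
    fix i :: int and n assume "n \<in> N"
    thus "g [^] i \<otimes> n \<otimes> g [^] (- i) \<in> N"
      using g N.inv_op_closed2[of "g [^] i" n] by (simp add: int_pow_neg)
  next
    fix i :: int show "g [^] (int p * i) \<in> N" by (simp add: pow_N)
  next
    fix i assume "0 < i" "i < p"
    thus "g [^] int i \<notin> N" by (auto simp: pow_N dest: nat_dvd_not_less)
  next
    fix h assume h: "h \<in> carrier G"
    have "card (generate (G Mod N) {?a}) = card (carrier (G Mod N))"
      using Q.generate_pow_card[OF a] ord order_Q by (simp add: Coset.order_def)
    moreover have "finite (carrier (G Mod N))" using fin by (simp add: carrier_FactGroup)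
    ultimately have "generate (G Mod N) {?a} = carrier (G Mod N)"
      using a Q.generate_incl[of "{?a}"] by (intro card_subset_eq) auto
    hence "N #> h \<in> generate (G Mod N) {?a}" using h by (auto simp: carrier_FactGroup)
    then obtain i :: int where "N #> h = N #> (g [^] i)"
      using Q.generate_pow[OF a] by (auto simp: pow)
    hence "h \<in> N #> (g [^] i)" using rcos_self[OF h N] by simp
    thus "\<exists>n\<in>N. \<exists>i::int. h = n \<otimes> g [^] i" by (auto simp: r_coset_def)
  qed
qed

section \<open>The group algebra of a group of prime power order\<close>

definition fscale :: "'k::field \<Rightarrow> ('g \<Rightarrow> 'k) \<Rightarrow> 'g \<Rightarrow> 'k" where
  "fscale c f = (\<lambda>x. c * f x)"

text \<open>The elements of the group algebra are supported on the carrier of \<open>G\<close>. If both factors are cut off to that support first, the product is bilinear and associative on all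
  functions.\<close>

definition cut :: "('g, 'm) monoid_scheme \<Rightarrow> ('g \<Rightarrow> 'k::field) \<Rightarrow> 'g \<Rightarrow> 'k" where
  "cut G f = (\<lambda>x. if x \<in> carrier G then f x else 0)"

definition gmul :: "('g, 'm) monoid_scheme \<Rightarrow> ('g \<Rightarrow> 'k::field) \<Rightarrow> ('g \<Rightarrow> 'k) \<Rightarrow> 'g \<Rightarrow> 'k" where
  "gmul G f h = cut G f \<otimes>\<^bsub>group_algebra G\<^esub> cut G h"

definition delta :: "'g \<Rightarrow> 'g \<Rightarrow> 'k::field" where
  "delta a = (\<lambda>x. if x = a then 1 else 0)"

lemma sum_fun_apply: "(\<Sum>a\<in>A. F a) x = (\<Sum>a\<in>A. F a x)"
  for F :: "'a \<Rightarrow> 'g \<Rightarrow> 'k::field"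
  by (induction A rule: infinite_finite_induct) auto

lemma add_group_algebra: "f \<oplus>\<^bsub>group_algebra G\<^esub> h = f + h"
  and zero_group_algebra: "\<zero>\<^bsub>group_algebra G\<^esub> = 0"
  and one_group_algebra: "\<one>\<^bsub>group_algebra G\<^esub> = delta \<one>\<^bsub>G\<^esub>"
  and smult_group_algebra: "c \<odot>\<^bsub>group_algebra G\<^esub> f = fscale c f"
  by (auto simp: group_algebra_def fun_eq_iff delta_def fscale_def)

lemma cut_in: "finite (carrier G) \<Longrightarrow> cut G f \<in> carrier (group_algebra G)"
  by (auto simp: cut_def group_algebra_def intro: finite_subset)

lemma cut_eq: "f \<in> carrier (group_algebra G) \<Longrightarrow> cut G f = f"
  by (auto simp: cut_def group_algebra_def fun_eq_iff)

lemma mult_group_algebra: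
  "f \<in> carrier (group_algebra G) \<Longrightarrow> h \<in> carrier (group_algebra G) \<Longrightarrow>
    f \<otimes>\<^bsub>group_algebra G\<^esub> h = gmul G f h"
  by (simp add: gmul_def cut_eq)

lemma (in group) assoc_algebra_gmul:
  assumes fin: "finite (carrier G)"
  shows "assoc_algebra (fscale :: 'k::field \<Rightarrow> ('a \<Rightarrow> 'k) \<Rightarrow> _) (gmul G)"
proof -
  interpret KG: K_algebra "group_algebra G :: ('k, 'a \<Rightarrow> 'k) module"
    by (rule group_algebra_K_algebra)
  note in_KG = cut_in[OF fin]
  have cut_mul: "cut G (gmul G f h) = gmul G f h" for f h :: "'a \<Rightarrow> 'k"
    unfolding gmul_def by (intro cut_eq KG.m_closed in_KG)
  have cut_add: "cut G (f + h) = cut G f \<oplus>\<^bsub>group_algebra G\<^esub> cut G h" for f h :: "'a \<Rightarrow> 'k"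
    by (auto simp: cut_def add_group_algebra)
  have cut_scale: "cut G (fscale c f) = c \<odot>\<^bsub>group_algebra G\<^esub> cut G f" for c and f :: "'a \<Rightarrow> 'k"
    by (auto simp: cut_def smult_group_algebra fscale_def)
  show ?thesis
  proof
    fix x y z :: "'a \<Rightarrow> 'k" and a b c :: 'k
    show "gmul G (gmul G x y) z = gmul G x (gmul G y z)"
      using KG.m_assoc[OF in_KG in_KG in_KG, of x y z]
      by (simp add: gmul_def[of G "gmul G x y"] gmul_def[of G x "gmul G y z"] cut_mul)
         (simp add: gmul_def)
    show "gmul G (x + y) z = gmul G x z + gmul G y z" "gmul G x (y + z) = gmul G x y + gmul G x z"
      unfolding gmul_def cut_add
      by (simp_all add: KG.l_distr KG.r_distr in_KG) (simp_all add: add_group_algebra)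
    show "gmul G (fscale c x) y = fscale c (gmul G x y)" "gmul G x (fscale c y) = fscale c (gmul G x y)"
      unfolding gmul_def cut_scale
      by (simp_all add: KG.smult_mult_left KG.smult_mult_right in_KG) (simp_all add: smult_group_algebra)
  qed (auto simp: fscale_def fun_eq_iff algebra_simps)
qed

lemma (in group) gmul_delta:
  assumes "a \<in> carrier G" "b \<in> carrier G"
  shows "gmul G (delta a) (delta b) = (delta (a \<otimes> b) :: 'a \<Rightarrow> 'k::field)"
proof
  fix x
  have c: "cut G (delta a) = (delta a :: 'a \<Rightarrow> 'k)" "cut G (delta b) = (delta b :: 'a \<Rightarrow> 'k)"
    using assms by (auto simp: cut_def delta_def)
  show "gmul G (delta a) (delta b) x = (delta (a \<otimes> b) x :: 'k)"
    unfolding gmul_def c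
    by (subst group_algebra_mult_eq[where S = "{a}" and S' = "{b}"]) (auto simp: delta_def split: if_splits)
qed

lemma (in group) span_delta_carrier:
  assumes fin: "finite (carrier G)"
  shows "module.span fscale (delta ` carrier G) = carrier (group_algebra G :: ('k::field, 'a \<Rightarrow> 'k) module)"
proof -
  interpret A: assoc_algebra "fscale :: 'k \<Rightarrow> ('a \<Rightarrow> 'k) \<Rightarrow> _" "gmul G"
    by (rule assoc_algebra_gmul[OF fin])
  have car: "carrier (group_algebra G :: ('k, 'a \<Rightarrow> 'k) module) = {f. \<forall>x. x \<notin> carrier G \<longrightarrow> f x = 0}"
    using fin by (auto simp: group_algebra_def intro: finite_subset)
  show ?thesis
  proof
    show "A.span (delta ` carrier G) \<subseteq> carrier (group_algebra G)"
      unfolding car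
      by (rule A.span_minimal) (auto simp: delta_def A.subspace_def fscale_def)
    show "carrier (group_algebra G) \<subseteq> A.span (delta ` carrier G)"
    proof
      fix f :: "'a \<Rightarrow> 'k" assume "f \<in> carrier (group_algebra G)"
      hence "f = (\<Sum>a\<in>carrier G. fscale (f a) (delta a))"
        using fin by (auto simp: fun_eq_iff sum_fun_apply fscale_def delta_def car if_distrib cong: if_cong)
      also have "\<dots> \<in> A.span (delta ` carrier G)"
        by (intro A.span_sum A.span_scale A.span_base) auto
      finally show "f \<in> A.span (delta ` carrier G)" .
    qed
  qed
qed

text \<open>All subgroups are treated inside the one algebra $KG$, so the induction on the order of
  \<open>H\<close> never leaves it.\<close>

theorem (in group) splits_prime_power_subgroup:
  fixes \<zeta> :: "'k::field"
  assumes fin: "finite (carrier G)" and zeta: "prime_root_of_unity p \<zeta>"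
    and roots: "\<And>c::'k. \<exists>d. d ^ p = c"
  shows "subgroup H G \<Longrightarrow> card H = p ^ m \<Longrightarrow>
    assoc_algebra.splits (fscale :: 'k \<Rightarrow> _) (gmul G) p (module.span fscale (delta ` H))"
proof (induction m arbitrary: H)
  interpret A: assoc_algebra "fscale :: 'k \<Rightarrow> ('a \<Rightarrow> 'k) \<Rightarrow> _" "gmul G"
    by (rule assoc_algebra_gmul[OF fin])
  interpret prime_root_of_unity p \<zeta> by fact
  have one: "\<one> \<in> H" if "subgroup H G" for H by (rule subgroup.one_closed[OF that])
  {
    case 0
    then obtain a where "H = {a}" by (auto simp: card_1_singleton_iff)
    hence H: "H = {\<one>}" using one[OF 0(1)] by simp
    have nz: "delta \<one> \<noteq> (0 :: 'a \<Rightarrow> 'k)" by (auto simp: delta_def fun_eq_iff)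
    let ?E = "\<lambda>(_::nat \<Rightarrow> nat) (_::nat \<Rightarrow> nat). delta \<one> :: 'a \<Rightarrow> 'k"
    have E: "matrix_units fscale (gmul G) (words p 0) ?E"
      by (intro matrix_units.intro matrix_units_axioms.intro A.assoc_algebra_axioms)
         (auto simp: words_0 gmul_delta nz)
    have block_entries: "matrix_units.entries (words p 0) ?E = {delta \<one>}"
      unfolding matrix_units.entries_def[OF E] by (simp add: words_0)
    have "block_decomposition fscale (gmul G) p {(0, ?E)} (A.span (delta ` H))"
      by (intro block_decomposition.intro block_decomposition_axioms.intro A.assoc_algebra_axioms)
         (use E p_pos in \<open>auto simp: block_entries H\<close>)
    thus ?case by (auto simp: A.splits_def)
  next
    case (Suc m)
    note H = \<open>subgroup H G\<close>
    interpret H: group "G\<lparr>carrier := H\<rparr>" by (rule subgroup_imp_group[OF H])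
    have fin_H: "finite H" using fin subgroup.subset[OF H] finite_subset by blast
    let ?H = "G\<lparr>carrier := H\<rparr>"
    have fin_H': "finite (carrier ?H)" using fin_H by simp
    have order_H: "Coset.order ?H = p ^ Suc m" using Suc.prems(2) by (simp add: Coset.order_def)
    obtain N g where N: "subgroup N ?H" "card N = p ^ m" and g': "g \<in> carrier ?H"
      and conj': "\<And>(i::int) n. n \<in> N \<Longrightarrow> g [^]\<^bsub>?H\<^esub> i \<otimes>\<^bsub>?H\<^esub> n \<otimes>\<^bsub>?H\<^esub> g [^]\<^bsub>?H\<^esub> (- i) \<in> N"
      and gp': "\<And>i::int. g [^]\<^bsub>?H\<^esub> (int p * i) \<in> N"
      and g_not': "\<And>i. 0 < i \<Longrightarrow> i < p \<Longrightarrow> g [^]\<^bsub>?H\<^esub> int i \<notin> N"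
      and cover': "\<And>h. h \<in> carrier ?H \<Longrightarrow> \<exists>n\<in>N. \<exists>i::int. h = n \<otimes>\<^bsub>?H\<^esub> g [^]\<^bsub>?H\<^esub> i"
      using H.prime_power_cyclic_extension[OF fin_H' prime_p order_H] by blast
    have g: "g \<in> H" using g' by simp
    have pow: "g [^]\<^bsub>?H\<^esub> i = g [^] i" for i :: int
      by (rule int_pow_consistent[OF H g, symmetric])
    have conj: "g [^] i \<otimes> n \<otimes> g [^] (- i) \<in> N" if "n \<in> N" for i :: int and n
      using conj'[OF that, of i] by (simp only: pow) simp
    have gp: "g [^] (int p * i) \<in> N" for i :: int
      using gp'[of i] by (simp only: pow)
    have g_not: "g [^] int i \<notin> N" if "0 < i" "i < p" for i
      using g_not'[OF that] by (simp only: pow not_False_eq_True)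
    have cover: "\<exists>n\<in>N. \<exists>i::int. h = n \<otimes> g [^] i" if "h \<in> H" for h
      using cover'[of h] that by (simp only: pow) simp
    have NG: "subgroup N G" by (rule incl_subgroup[OF H N(1)])
    have NH: "N \<subseteq> H" using subgroup.subset[OF N(1)] by simp
    have HG: "H \<subseteq> carrier G" by (rule subgroup.subset[OF H])
    have gG: "g \<in> carrier G" using g HG by blast
    have gi: "g [^] i \<in> carrier G" "g [^] i \<in> H" for i :: int
      using gG subgroup_int_pow_closed[OF H g] by auto
    define S where "S = A.span (delta ` N)"
    have mulNH: "n \<otimes> h \<in> H" if "n \<in> H" "h \<in> H" for n h by (rule subgroup.m_closed[OF H that])
    have S_mem: "delta n \<in> S" if "n \<in> N" for n using that by (auto simp: S_def intro: A.span_base)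
    have S_supp: "f x = 0" if "f \<in> S" "x \<notin> N" for f x
    proof -
      have "S \<subseteq> {f. f x = 0}" unfolding S_def
        by (rule A.span_minimal) (use that in \<open>auto simp: delta_def A.subspace_def fscale_def\<close>)
      thus ?thesis using that by blast
    qed
    have unit: "gmul G (delta \<one>) x = x" "gmul G x (delta \<one>) = x" if "x \<in> S" for x
    proof -
      have "S \<subseteq> {x. gmul G x (delta \<one>) = x \<and> gmul G (delta \<one>) x = x}"
        unfolding S_def
        by (rule A.span_minimal)
           (use NH HG in \<open>auto simp: gmul_delta A.subspace_def A.mul_add_left A.mul_add_right
             A.mul_scale_left A.mul_scale_right subset_iff\<close>)
      thus "gmul G (delta \<one>) x = x" "gmul G x (delta \<one>) = x" using that by auto
    qed
    interpret cyclic_extension fscale "gmul G" p \<zeta> S "delta \<one>" "\<lambda>i. delta (g [^] i)"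
    proof
      show "A.subspace S" by (simp add: S_def)
      show "gmul G x y \<in> S" if "x \<in> S" "y \<in> S" for x y
        using that unfolding S_def
        by (rule A.span_mul)
           (use NG NH HG in \<open>auto simp: gmul_delta subset_iff subgroup.m_closed intro!: A.span_base\<close>)
      show "delta \<one> \<in> S" by (rule S_mem[OF one[OF NG]])
      show "gmul G (delta \<one>) x = x" "gmul G x (delta \<one>) = x" if "x \<in> S" for x
        using unit[OF that] by auto
      show "delta (g [^] (0::int)) = delta \<one>" by simp
      show "delta (g [^] (i + j)) = gmul G (delta (g [^] i)) (delta (g [^] j))" for i j :: int
        using gG by (simp add: gmul_delta int_pow_mult)
      show "gmul G (gmul G (delta (g [^] i)) x) (delta (g [^] (- i))) \<in> S" if "x \<in> S" for x and i :: int
      proof -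
        have "gmul G (delta (g [^] i)) x \<in> {y. gmul G y (delta (g [^] (- i))) \<in> S}"
          using that unfolding S_def
          by (rule A.span_mul_left[OF _ A.subspace_mul_right_preimage[OF A.subspace_span]])
             (use conj gi NH HG in \<open>auto simp: gmul_delta subset_iff intro!: A.span_base\<close>)
        thus ?thesis by simp
      qed
      show "delta (g [^] (int p * i)) \<in> S" for i by (rule S_mem[OF gp])
      show "\<exists>d. d ^ p = c" for c :: 'k by (rule roots)
      fix f :: "nat \<Rightarrow> 'a \<Rightarrow> 'k"
      assume f: "\<And>i. i < p \<Longrightarrow> f i \<in> S" and 0: "(\<Sum>i<p. gmul G (f i) (delta (g [^] int i))) = 0"
      \<comment> \<open>For \<open>0 < i < p\<close> the coset of \<open>g\<close> to the power \<open>i\<close> is disjoint from \<open>N\<close>, so only the summand for \<open>0\<close> lives on \<open>N\<close>.\<close>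
      define Z where "Z = {f :: 'a \<Rightarrow> 'k. \<forall>x\<in>N. f x = 0}"
      have Z: "A.subspace Z" by (auto simp: Z_def A.subspace_def fscale_def)
      have fZ: "gmul G (f i) (delta (g [^] int i)) \<in> Z" if i: "i \<in> {..<p} - {0}" for i
      proof -
        have "f i \<in> S" using f i by simp
        thus ?thesis
          unfolding S_def
        proof (rule A.span_mul_right[OF _ Z])
          fix a :: "'a \<Rightarrow> 'k" assume "a \<in> delta ` N"
          then obtain n where n: "n \<in> N" "a = delta n" by blast
          have nG: "n \<in> carrier G" using n NH HG by blast
          have "n \<otimes> g [^] int i \<notin> N"
          proof
            assume "n \<otimes> g [^] int i \<in> N"
            hence "inv n \<otimes> (n \<otimes> g [^] int i) \<in> N"
              using n NG by (simp add: subgroup.m_closed subgroup.m_inv_closed)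
            thus False using g_not[of i] i nG gi(1)[of "int i"] by (simp add: inv_solve_left' flip: m_assoc)
          qed
          thus "gmul G a (delta (g [^] int i)) \<in> Z"
            unfolding n(2) gmul_delta[OF nG gi(1)] by (auto simp: Z_def delta_def)
        qed
      qed
      have "(\<Sum>i<p. gmul G (f i) (delta (g [^] int i))) =
        gmul G (f 0) (delta (g [^] int 0)) + (\<Sum>i\<in>{..<p} - {0}. gmul G (f i) (delta (g [^] int i)))"
        using p_pos by (subst sum.remove[of _ 0]) auto
      hence "f 0 + (\<Sum>i\<in>{..<p} - {0}. gmul G (f i) (delta (g [^] int i))) = 0"
        using 0 unit(2)[OF f[OF p_pos]] by simp
      hence "f 0 = - (\<Sum>i\<in>{..<p} - {0}. gmul G (f i) (delta (g [^] int i)))"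
        by (simp add: eq_neg_iff_add_eq_0)
      also have "\<dots> \<in> Z" by (intro A.subspace_neg[OF Z] A.subspace_sum[OF Z] fZ)
      finally have "f 0 \<in> Z" .
      thus "f 0 = 0" using S_supp[OF f[OF p_pos]] by (auto simp: Z_def fun_eq_iff)
    qed
    have "R = A.span (delta ` H)"
    proof
      show "R \<subseteq> A.span (delta ` H)"
        unfolding R_def
      proof (rule A.span_minimal[OF _ A.subspace_span], safe)
        fix x i assume "x \<in> S"
        thus "gmul G x (delta (g [^] (i::int))) \<in> A.span (delta ` H)"
          unfolding S_def
          by (rule A.span_mul_right)
             (use NH HG gi mulNH in \<open>auto simp: gmul_delta subset_iff intro!: A.span_base\<close>)
      qed
      show "A.span (delta ` H) \<subseteq> R"
      proof (rule A.span_minimal[OF _ subspace_R], safe)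
        fix h assume "h \<in> H"
        then obtain n i where h: "n \<in> N" "h = n \<otimes> g [^] (i::int)" using cover by blast
        thus "delta h \<in> R"
          using R_base[OF S_mem[OF h(1)], of i] NH HG gi by (auto simp: gmul_delta subset_iff)
      qed
    qed
    thus ?case using splits_R Suc.IH[OF NG N(2)] by (simp add: S_def)
  }
qed

section \<open>Pauli gradings\<close>

definition vadd :: "nat \<Rightarrow> (nat \<Rightarrow> nat) \<Rightarrow> (nat \<Rightarrow> nat) \<Rightarrow> nat \<Rightarrow> nat" where
  "vadd p u v = (\<lambda>i. (u i + v i) mod p)"

lemma vadd_comm: "vadd p u v = vadd p v u"
  by (simp add: vadd_def add.commute)

lemma vadd_assoc: "vadd p (vadd p u v) w = vadd p u (vadd p v w)"
  by (simp add: vadd_def mod_simps add.assoc)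

lemma vadd_left_comm: "vadd p u (vadd p v w) = vadd p v (vadd p u w)"
  by (metis vadd_assoc vadd_comm)

lemma vadd_closed: "p > 0 \<Longrightarrow> u \<in> words p k \<Longrightarrow> v \<in> words p k \<Longrightarrow> vadd p u v \<in> words p k"
  by (simp add: words_def vadd_def)

lemma words_lt: "p > 0 \<Longrightarrow> u \<in> words p k \<Longrightarrow> u i < p"
  by (cases "i < k") (simp_all add: words_def)

lemma vadd_zero: "p > 0 \<Longrightarrow> u \<in> words p k \<Longrightarrow> vadd p u (\<lambda>_. 0) = u"
  by (simp add: vadd_def words_lt)

lemma vadd_inverse:
  assumes "p > 0" "u \<in> words p k"
  shows "\<exists>v\<in>words p k. vadd p u v = (\<lambda>_. 0)"
proof
  let ?v = "\<lambda>i. (p - u i) mod p"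
  show "?v \<in> words p k" using assms by (auto simp: words_def)
  show "vadd p u ?v = (\<lambda>_. 0)"
    using words_lt[OF assms] by (auto simp: vadd_def mod_simps less_imp_le fun_eq_iff)
qed

lemma vadd_cancel:
  assumes "p > 0" "u \<in> words p k" "v \<in> words p k" "w \<in> words p k" "vadd p w u = vadd p w v"
  shows "u = v"
proof -
  obtain w' where w': "w' \<in> words p k" "vadd p w w' = (\<lambda>_. 0)" using vadd_inverse assms by blast
  have "vadd p (vadd p w' w) u = vadd p (vadd p w' w) v" using assms(5) by (simp add: vadd_assoc)
  thus ?thesis
    using w' assms vadd_zero[of p u k] vadd_zero[of p v k] by (simp add: vadd_comm[of p _ "\<lambda>_. 0"] vadd_comm[of p w'])
qed

lemma words_mono: "k \<le> l \<Longrightarrow> p > 0 \<Longrightarrow> words p k \<subseteq> words p l"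
  by (auto simp: words_def) (metis not_le)

definition word_pairs :: "nat \<Rightarrow> nat \<Rightarrow> ((nat \<Rightarrow> nat) \<times> (nat \<Rightarrow> nat)) monoid" where
  "word_pairs p k = \<lparr>carrier = words p k \<times> words p k,
    monoid.mult = (\<lambda>(u, v) (u', v'). (vadd p u u', vadd p v v')),
    monoid.one = (\<lambda>_. 0, \<lambda>_. 0)\<rparr>"

lemma comm_group_word_pairs:
  assumes p: "p > 0"
  shows "comm_group (word_pairs p k)"
proof (rule comm_groupI)
  fix x assume "x \<in> carrier (word_pairs p k)"
  then obtain u v where x: "x = (u, v)" "u \<in> words p k" "v \<in> words p k" by (auto simp: word_pairs_def)
  obtain u' v' where "u' \<in> words p k" "vadd p u u' = (\<lambda>_. 0)" "v' \<in> words p k" "vadd p v v' = (\<lambda>_. 0)"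
    using vadd_inverse[OF p] x by blast
  thus "\<exists>y\<in>carrier (word_pairs p k). y \<otimes>\<^bsub>word_pairs p k\<^esub> x = \<one>\<^bsub>word_pairs p k\<^esub>"
    by (intro bexI[of _ "(u', v')"]) (auto simp: word_pairs_def x vadd_comm)
qed (auto simp: word_pairs_def vadd_assoc vadd_comm vadd_left_comm vadd_closed p zero_in_words vadd_zero
  vadd_comm[of p "\<lambda>_. 0"])

text \<open>Any finite abelian group has a copy whose elements are natural numbers.\<close>

lemma comm_group_on_nat:
  assumes "comm_group T" and fin: "finite (carrier T)"
  obtains T' :: "nat monoid" and h where "comm_group T'" "finite (carrier T')"
    "bij_betw h (carrier T') (carrier T)"
    "\<And>i j. i \<in> carrier T' \<Longrightarrow> j \<in> carrier T' \<Longrightarrow> h (i \<otimes>\<^bsub>T'\<^esub> j) = h i \<otimes>\<^bsub>T\<^esub> h j"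
proof -
  interpret comm_group T by fact
  obtain h where h: "bij_betw h {0..<card (carrier T)} (carrier T)"
    using ex_bij_betw_nat_finite[OF fin] by blast
  define g where "g = inv_into {0..<card (carrier T)} h"
  define T' where "T' = \<lparr>carrier = {0..<card (carrier T)}, monoid.mult = (\<lambda>i j. g (h i \<otimes>\<^bsub>T\<^esub> h j)),
    monoid.one = g \<one>\<^bsub>T\<^esub>\<rparr>"
  have hg: "h (g x) = x" "g x \<in> carrier T'" if "x \<in> carrier T" for x
    using that h bij_betw_inv_into_right[OF h that] bij_betw_apply[OF bij_betw_inv_into[OF h] that]
    by (simp_all add: g_def T'_def)
  have gh: "g (h i) = i" "h i \<in> carrier T" if "i \<in> carrier T'" for i
    using that bij_betw_inv_into_left[OF h] bij_betw_apply[OF h] by (simp_all add: g_def T'_def)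
  have mult: "i \<otimes>\<^bsub>T'\<^esub> j = g (h i \<otimes>\<^bsub>T\<^esub> h j)" and one: "\<one>\<^bsub>T'\<^esub> = g \<one>\<^bsub>T\<^esub>" for i j
    by (simp_all add: T'_def)
  have "comm_group T'"
  proof (rule comm_groupI)
    fix i assume i: "i \<in> carrier T'"
    show "\<exists>j\<in>carrier T'. j \<otimes>\<^bsub>T'\<^esub> i = \<one>\<^bsub>T'\<^esub>"
      by (rule bexI[of _ "g (inv\<^bsub>T\<^esub> h i)"]) (simp_all add: mult one hg gh i)
  qed (simp_all add: mult one hg gh m_ac)
  moreover have "finite (carrier T')" by (simp add: T'_def)
  moreover have "bij_betw h (carrier T') (carrier T)" using h by (simp add: T'_def)
  ultimately show ?thesis using that[of T' h] by (simp add: mult hg gh)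
qed

locale pauli_grading = block_decomposition scale mul p F S + prime_root_of_unity p \<zeta>
  for scale :: "'k::field \<Rightarrow> 'a::ab_group_add \<Rightarrow> 'a" (infixr \<open>*s\<close> 75)
    and mul :: "'a \<Rightarrow> 'a \<Rightarrow> 'a" (infixl \<open>\<star>\<close> 76) and p F S and \<zeta> :: "'k" +
  assumes F_nonempty: "F \<noteq> {}"
begin

text \<open>The exponent of the largest block; the degrees are the pairs of words of this length.\<close>

definition rank :: nat where "rank = Max (fst ` F)"

text \<open>The pairing $\zeta^{u \cdot v}$. It is evaluated on \<open>rank\<close> coordinates for words of every
  block, which makes it, and with it the commutation factor, independent of the block.\<close>

definition chi :: "(nat \<Rightarrow> nat) \<Rightarrow> (nat \<Rightarrow> nat) \<Rightarrow> 'k" where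
  "chi u v = (\<Prod>i<rank. \<zeta> ^ (u i * v i))"

text \<open>$X_{u,v}$ is the product of the clock matrix for \<open>v\<close> and the shift matrix for \<open>u\<close>.\<close>

definition pauli :: "nat \<times> ((nat \<Rightarrow> nat) \<Rightarrow> (nat \<Rightarrow> nat) \<Rightarrow> 'a) \<Rightarrow> (nat \<Rightarrow> nat) \<Rightarrow> (nat \<Rightarrow> nat) \<Rightarrow> 'a" where
  "pauli b u v = (\<Sum>w\<in>words p (fst b). chi v w *s snd b w (vadd p w u))"

definition part :: "(nat \<Rightarrow> nat) \<times> (nat \<Rightarrow> nat) \<Rightarrow> 'a set" where
  "part t = span {pauli b (fst t) (snd t) |b. b \<in> F \<and> t \<in> words p (fst b) \<times> words p (fst b)}"

lemma rank_ge: "b \<in> F \<Longrightarrow> fst b \<le> rank"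
  by (simp add: rank_def finite_blocks)

lemma rank_attained: "\<exists>b\<in>F. fst b = rank"
proof -
  have "rank \<in> fst ` F"
    unfolding rank_def by (rule Max_in) (simp_all add: finite_blocks F_nonempty)
  thus ?thesis by (metis imageE)
qed

lemma block_units:
  assumes "b \<in> F"
  shows "\<lbrakk>i \<in> words p (fst b); j \<in> words p (fst b); l \<in> words p (fst b); m \<in> words p (fst b)\<rbrakk> \<Longrightarrow>
      snd b i j \<star> snd b l m = (if j = l then snd b i m else 0)"
    and "\<lbrakk>i \<in> words p (fst b); j \<in> words p (fst b)\<rbrakk> \<Longrightarrow> snd b i j \<noteq> 0"
    and "\<lbrakk>i \<in> words p (fst b); j \<in> words p (fst b)\<rbrakk> \<Longrightarrow> snd b i j \<in> block_entries b"
  using matrix_units.unit_mul[OF block] matrix_units.unit_nonzero[OF block]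
    matrix_units.entriesI[OF block] assms
  by (simp_all add: block_entries_def)

lemma zeta_mod: "\<zeta> ^ (n mod p) = \<zeta> ^ n"
proof -
  have "\<zeta> ^ n = \<zeta> ^ (p * (n div p) + n mod p)" by simp
  also have "\<dots> = \<zeta> ^ (n mod p)" by (simp only: power_add power_mult root) simp
  finally show ?thesis by simp
qed

lemma chi_nonzero: "chi u v \<noteq> 0"
  by (simp add: chi_def zeta_nonzero)

lemma chi_sym: "chi u v = chi v u"
  by (simp add: chi_def mult.commute)

lemma chi_add_left: "chi (vadd p u v) w = chi u w * chi v w"
  unfolding chi_def prod.distrib[symmetric]
  by (rule prod.cong[OF refl]) (simp add: vadd_def power_mult zeta_mod power_add power_mult_distrib)

lemma chi_add_right: "chi w (vadd p u v) = chi w u * chi w v"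
  by (simp add: chi_sym[of w] chi_add_left)

lemma chi_zero: "chi (\<lambda>_. 0) w = 1"
  by (simp add: chi_def)

lemma chi_orthogonality:
  assumes "k \<le> rank" "\<And>i. u i < p" "\<And>i. v i < p"
  shows "(\<Sum>w\<in>words p k. chi u w / chi v w) = (if \<forall>i<k. u i = v i then of_nat p ^ k else 0)"
  using assms(1)
proof (induction k)
  case 0
  show ?case by (simp add: words_0 chi_sym[of _ "\<lambda>_. 0"] chi_zero)
next
  case (Suc k)
  have upd: "chi x (w(k := i)) = chi x w * (\<zeta> ^ x k) ^ i" if "w \<in> words p k" for x w i
  proof -
    have k: "k \<in> {..<rank}" using Suc.prems by simp
    have "w k = 0" using that by (simp add: words_def)
    thus ?thesis
      unfolding chi_def prod.remove[OF finite_lessThan k] by (simp add: power_mult)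
  qed
  have "(\<Sum>w\<in>words p (Suc k). chi u w / chi v w) =
      (\<Sum>x\<in>{..<p} \<times> words p k. chi u (case x of (i, w) \<Rightarrow> w(k := i)) / chi v (case x of (i, w) \<Rightarrow> w(k := i)))"
    by (rule sum.reindex_bij_betw[OF bij_betw_words_Suc, symmetric])
  also have "\<dots> = (\<Sum>x\<in>{..<p} \<times> words p k.
      case x of (i, w) \<Rightarrow> (\<zeta> ^ u k / \<zeta> ^ v k) ^ i * (chi u w / chi v w))"
    by (rule sum.cong) (auto simp: upd power_divide mult_ac)
  also have "\<dots> = (\<Sum>i<p. (\<zeta> ^ u k / \<zeta> ^ v k) ^ i) * (\<Sum>w\<in>words p k. chi u w / chi v w)"
    by (simp add: sum_product sum.cartesian_product)
  also have "\<dots> = (if \<forall>i<Suc k. u i = v i then of_nat p ^ Suc k else 0)"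
    using Suc by (auto simp add: character_sum assms less_Suc_eq)
  finally show ?case .
qed

lemma chi_orthogonality_words:
  assumes b: "b \<in> F" and uv: "u \<in> words p (fst b)" "v \<in> words p (fst b)"
  shows "(\<Sum>w\<in>words p (fst b). chi u w / chi v w) = (if u = v then of_nat p ^ fst b else 0)"
proof -
  have "(\<forall>i<fst b. u i = v i) \<longleftrightarrow> u = v"
    using uv by (auto simp: words_def fun_eq_iff) (metis not_le)
  thus ?thesis
    using chi_orthogonality[OF rank_ge[OF b], of u v] words_lt[OF p_pos] uv by simp
qed

lemma pauli_in_ent: "b \<in> F \<Longrightarrow> u \<in> words p (fst b) \<Longrightarrow> pauli b u v \<in> span (block_entries b)"
  unfolding pauli_def
  by (intro span_sum span_scale span_base block_units vadd_closed p_pos)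

lemma pauli_mul:
  assumes b: "b \<in> F" and u: "u \<in> words p (fst b)" "u' \<in> words p (fst b)"
  shows "pauli b u v \<star> pauli b u' v' = chi v' u *s pauli b (vadd p u u') (vadd p v v')"
proof -
  let ?W = "words p (fst b)"
  have cl: "vadd p w x \<in> ?W" if "w \<in> ?W" "x \<in> ?W" for w x using vadd_closed p_pos that by blast
  have "pauli b u v \<star> pauli b u' v' = (\<Sum>w\<in>?W. \<Sum>w'\<in>?W.
      if vadd p w u = w' then (chi v w * chi v' w') *s snd b w (vadd p w' u') else 0)"
    unfolding pauli_def mul_sum_left mul_sum_right
    by (subst sum.swap, intro sum.cong refl)
       (auto simp: mul_scale_left mul_scale_right block_units[OF b] cl u mult.commute)
  also have "\<dots> = (\<Sum>w\<in>?W. (chi v w * chi v' (vadd p w u)) *s snd b w (vadd p (vadd p w u) u'))"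
    by (intro sum.cong refl) (simp add: finite_words cl u)
  also have "\<dots> = chi v' u *s pauli b (vadd p u u') (vadd p v v')"
    unfolding pauli_def scale_sum_right
    by (intro sum.cong refl) (simp add: chi_add_right chi_add_left vadd_assoc mult_ac)
  finally show ?thesis .
qed

lemma pauli_orthogonal:
  "\<lbrakk>b \<in> F; c \<in> F; b \<noteq> c; u \<in> words p (fst b); u' \<in> words p (fst c)\<rbrakk> \<Longrightarrow> pauli b u v \<star> pauli c u' v' = 0"
  by (rule orthogonal) (auto intro: pauli_in_ent)

lemma pauli_nonzero:
  assumes b: "b \<in> F" and u: "u \<in> words p (fst b)"
  shows "pauli b u v \<noteq> 0"
proof
  let ?z = "\<lambda>_. 0 :: nat"
  let ?W = "words p (fst b)"
  have z: "?z \<in> ?W" by (rule zero_in_words[OF p_pos])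
  have cl: "vadd p w u \<in> ?W" if "w \<in> ?W" for w using vadd_closed p_pos that u by blast
  assume "pauli b u v = 0"
  hence "snd b ?z ?z \<star> pauli b u v = 0" by simp
  moreover have "snd b ?z ?z \<star> pauli b u v = (\<Sum>w\<in>?W. if ?z = w then chi v w *s snd b ?z (vadd p w u) else 0)"
    unfolding pauli_def mul_sum_right
    by (intro sum.cong refl) (auto simp: mul_scale_right block_units[OF b] z cl)
  ultimately show False
    using z block_units(2)[OF b z cl[OF z]] chi_nonzero by (simp add: finite_words)
qed

lemma pauli_zero_eq_e: "b \<in> F \<Longrightarrow> pauli b (\<lambda>_. 0) (\<lambda>_. 0) = block_ident b"
  unfolding pauli_def block_ident_def matrix_units.ident_def[OF block]
  by (intro sum.cong refl) (simp add: chi_zero vadd_zero[OF p_pos])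

lemma subspace_part: "subspace (part t)"
  by (simp add: part_def)

lemma pauli_in_part:
  "b \<in> F \<Longrightarrow> u \<in> words p (fst b) \<Longrightarrow> v \<in> words p (fst b) \<Longrightarrow> pauli b u v \<in> part (u, v)"
  unfolding part_def by (rule span_base, rule CollectI, rule exI[of _ b]) simp

lemma part_subset: "part t \<subseteq> S"
  unfolding part_def
proof (rule span_minimal[OF _ subspace_S], rule subsetI)
  fix x assume "x \<in> {pauli b (fst t) (snd t) |b. b \<in> F \<and> t \<in> words p (fst b) \<times> words p (fst b)}"
  then obtain b where b: "b \<in> F" "t \<in> words p (fst b) \<times> words p (fst b)" "x = pauli b (fst t) (snd t)"
    by blast
  hence "x \<in> span (block_entries b)" by (simp add: pauli_in_ent mem_Times_iff)
  thus "x \<in> S" using span_ent_subset[OF b(1)] by blast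
qed

lemma part_mul:
  assumes "x \<in> part s" "y \<in> part t"
  shows "x \<star> y \<in> part (vadd p (fst s) (fst t), vadd p (snd s) (snd t))"
  using assms[unfolded part_def[of s] part_def[of t]]
proof (rule span_mul[OF _ _ subspace_part])
  fix x y
  assume "x \<in> {pauli b (fst s) (snd s) |b. b \<in> F \<and> s \<in> words p (fst b) \<times> words p (fst b)}"
    and "y \<in> {pauli b (fst t) (snd t) |b. b \<in> F \<and> t \<in> words p (fst b) \<times> words p (fst b)}"
  then obtain b c where x: "x = pauli b (fst s) (snd s)" and y: "y = pauli c (fst t) (snd t)"
    and b: "b \<in> F" "s \<in> words p (fst b) \<times> words p (fst b)"
    and c: "c \<in> F" "t \<in> words p (fst c) \<times> words p (fst c)" by blast
  show "x \<star> y \<in> part (vadd p (fst s) (fst t), vadd p (snd s) (snd t))"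
  proof (cases "b = c")
    case True
    thus ?thesis
      using b c by (auto simp: x y pauli_mul mem_Times_iff
          intro!: subspace_scale[OF subspace_part] pauli_in_part vadd_closed p_pos)
  next
    case False
    thus ?thesis using b c by (auto simp: x y pauli_orthogonal subspace_0[OF subspace_part])
  qed
qed

text \<open>In a common block the factor is $\zeta^{v' \cdot u - v \cdot u'}$ by \<open>pauli_mul\<close>, whatever
  the block; elements of different blocks annihilate each other, so they commute up to any
  factor.\<close>

lemma part_commute:
  assumes "x \<in> part s" "y \<in> part t"
  shows "x \<star> y = (chi (snd t) (fst s) / chi (snd s) (fst t)) *s (y \<star> x)"
proof -
  let ?c = "chi (snd t) (fst s) / chi (snd s) (fst t)"
  have gen: "pauli b (fst s) (snd s) \<star> pauli c (fst t) (snd t) =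
      ?c *s (pauli c (fst t) (snd t) \<star> pauli b (fst s) (snd s))"
    if b: "b \<in> F" "s \<in> words p (fst b) \<times> words p (fst b)"
    and c: "c \<in> F" "t \<in> words p (fst c) \<times> words p (fst c)" for b c
  proof (cases "b = c")
    case True
    thus ?thesis using b c chi_nonzero
      by (simp add: pauli_mul mem_Times_iff vadd_comm[of p "fst t"] vadd_comm[of p "snd t"])
  next
    case False
    thus ?thesis using b c by (simp add: pauli_orthogonal mem_Times_iff)
  qed
  have sub: "subspace {x. x \<star> y = ?c *s (y \<star> x)}" "subspace {y. x \<star> y = ?c *s (y \<star> x)}" for x y
    by (auto simp: subspace_def mul_add_left mul_add_right mul_scale_left mul_scale_right
        scale_right_distrib mult.commute)
  have "pauli b (fst s) (snd s) \<star> y = ?c *s (y \<star> pauli b (fst s) (snd s))"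
    if b: "b \<in> F" "s \<in> words p (fst b) \<times> words p (fst b)" for b
  proof -
    have "part t \<subseteq> {y. pauli b (fst s) (snd s) \<star> y = ?c *s (y \<star> pauli b (fst s) (snd s))}"
      unfolding part_def[of t] by (rule span_minimal[OF _ sub(2)]) (use gen b in blast)
    thus ?thesis using assms(2) by blast
  qed
  hence "part s \<subseteq> {x. x \<star> y = ?c *s (y \<star> x)}"
    unfolding part_def[of s] by (intro span_minimal[OF _ sub(1)]) blast
  thus ?thesis using assms(1) by blast
qed

text \<open>The projection to degree $t = (u,v)$. The sandwich by $E_{iw}$ and $E_{w+u,i+u}$ moves the
  matrix entry at $(w,w+u)$ to $(i,i+u)$, and the character sum over $w$ extracts the coefficient of
  $X_{u,v}$ from these entries.\<close>

definition proj :: "(nat \<Rightarrow> nat) \<times> (nat \<Rightarrow> nat) \<Rightarrow> 'a \<Rightarrow> 'a" where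
  "proj t x = (\<Sum>b | b \<in> F \<and> t \<in> words p (fst b) \<times> words p (fst b).
     inverse (of_nat p ^ fst b) *s (\<Sum>i\<in>words p (fst b). \<Sum>w\<in>words p (fst b).
       (chi (snd t) i / chi (snd t) w) *s
         (snd b i w \<star> x \<star> snd b (vadd p w (fst t)) (vadd p i (fst t)))))"

lemma proj_add: "proj t (x + y) = proj t x + proj t y"
  by (simp add: proj_def mul_add_left mul_add_right scale_right_distrib sum.distrib)

lemma proj_scale: "proj t (c *s x) = c *s proj t x"
  by (simp add: proj_def mul_scale_left mul_scale_right scale_sum_right mult_ac)

lemma proj_zero: "proj t 0 = 0"
  by (simp add: proj_def)

lemma proj_sum: "proj t (sum f I) = (\<Sum>i\<in>I. proj t (f i))"
  by (induction I rule: infinite_finite_induct) (simp_all add: proj_add proj_zero)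

lemma proj_pauli:
  assumes c: "c \<in> F" "u' \<in> words p (fst c)" "v' \<in> words p (fst c)"
  shows "proj (u, v) (pauli c u' v') = (if (u, v) = (u', v') then pauli c u' v' else 0)"
proof -
  define term' where "term' b = inverse (of_nat p ^ fst b) *s (\<Sum>i\<in>words p (fst b). \<Sum>w\<in>words p (fst b).
      (chi v i / chi v w) *s
        (snd b i w \<star> pauli c u' v' \<star> snd b (vadd p w u) (vadd p i u)))" for b
  have proj: "proj (u, v) (pauli c u' v') = (\<Sum>b | b \<in> F \<and> u \<in> words p (fst b) \<and> v \<in> words p (fst b). term' b)"
    by (simp add: proj_def term'_def)
  have other: "term' b = 0" if b: "b \<in> F" "u \<in> words p (fst b)" "v \<in> words p (fst b)" "b \<noteq> c" for b
  proof -
    have "snd b i w \<star> pauli c u' v' = 0" if "i \<in> words p (fst b)" "w \<in> words p (fst b)" for i w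
      using b c that by (intro orthogonal[of b c] pauli_in_ent span_base block_units) auto
    thus ?thesis by (simp add: term'_def)
  qed
  let ?W = "words p (fst c)"
  have self: "term' c = (if u = u' \<and> v = v' then pauli c u' v' else 0)" if uv: "u \<in> ?W" "v \<in> ?W"
  proof -
    have cl: "vadd p w x \<in> ?W" if "w \<in> ?W" "x \<in> ?W" for w x using vadd_closed p_pos that by blast
    have sandwich: "snd c i w \<star> pauli c u' v' \<star> snd c (vadd p w u) (vadd p i u) =
        (if u = u' then chi v' w *s snd c i (vadd p i u) else 0)" if iw: "i \<in> ?W" "w \<in> ?W" for i w
    proof -
      have "snd c i w \<star> pauli c u' v' =
          (\<Sum>x\<in>?W. if w = x then chi v' x *s snd c i (vadd p x u') else 0)"
        unfolding pauli_def mul_sum_right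
        by (intro sum.cong refl) (auto simp: mul_scale_right block_units[OF c(1)] iw cl c)
      also have "\<dots> = chi v' w *s snd c i (vadd p w u')" using iw by (simp add: finite_words)
      finally show ?thesis
        using iw uv c vadd_cancel[OF p_pos, of u "fst c" u' w]
        by (auto simp: mul_scale_left block_units[OF c(1)] cl)
    qed
    have "term' c = inverse (of_nat p ^ fst c) *s (\<Sum>i\<in>?W. \<Sum>w\<in>?W.
        (chi v i * (chi v' w / chi v w)) *s (if u = u' then snd c i (vadd p i u) else 0))"
      unfolding term'_def
      by (rule arg_cong[where f = "scale (inverse (of_nat p ^ fst c))"], intro sum.cong refl)
         (simp add: sandwich)
    also have "\<dots> = inverse (of_nat p ^ fst c) *s (\<Sum>i\<in>?W.
        (chi v i * (\<Sum>w\<in>?W. chi v' w / chi v w)) *s (if u = u' then snd c i (vadd p i u) else 0))"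
      by (simp only: sum_distrib_left scale_sum_left)
    also have "\<dots> = (if u = u' \<and> v = v' then pauli c u' v' else 0)"
    proof -
      have cancel: "inverse (of_nat p ^ fst c) * (y * of_nat p ^ fst c) = y" for y :: 'k
        using p_nonzero by simp
      show ?thesis
        by (auto simp: cancel chi_orthogonality_words[OF c(1) c(3) uv(2)] pauli_def scale_sum_right)
    qed
    finally show ?thesis .
  qed
  show ?thesis
  proof (cases "u \<in> ?W \<and> v \<in> ?W")
    case True
    hence "proj (u, v) (pauli c u' v') = (\<Sum>b\<in>{c}. term' b)"
      unfolding proj using c finite_blocks by (intro sum.mono_neutral_right ballI other) auto
    thus ?thesis using True by (simp add: self)
  next
    case False
    hence "proj (u, v) (pauli c u' v') = 0"
      unfolding proj
    proof (intro sum.neutral ballI)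
      fix b assume "b \<in> {b \<in> F. u \<in> words p (fst b) \<and> v \<in> words p (fst b)}"
      hence b: "b \<in> F" "u \<in> words p (fst b)" "v \<in> words p (fst b)" by simp_all
      moreover have "b \<noteq> c" using b False by blast
      ultimately show "term' b = 0" by (rule other)
    qed
    thus ?thesis using False c by auto
  qed
qed

lemma proj_part:
  assumes "x \<in> part s"
  shows "proj t x = (if t = s then x else 0)"
proof -
  have "subspace {x. proj t x = (if t = s then x else 0)}"
    by (auto simp: subspace_def proj_add proj_scale proj_zero)
  hence "part s \<subseteq> {x. proj t x = (if t = s then x else 0)}"
    unfolding part_def
  proof (rule span_minimal[rotated], intro subsetI CollectI)
    fix x assume "x \<in> {pauli b (fst s) (snd s) |b. b \<in> F \<and> s \<in> words p (fst b) \<times> words p (fst b)}"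
    then obtain b where b: "b \<in> F" "s \<in> words p (fst b) \<times> words p (fst b)"
      and x: "x = pauli b (fst s) (snd s)" by blast
    have "proj (fst t, snd t) (pauli b (fst s) (snd s)) =
        (if (fst t, snd t) = (fst s, snd s) then pauli b (fst s) (snd s) else 0)"
      by (intro proj_pauli) (use b in auto)
    thus "proj t x = (if t = s then x else 0)"
      by (simp only: prod.collapse x)
  qed
  thus ?thesis using assms by blast
qed

lemma parts_independent:
  assumes "finite I" and "\<And>t. t \<in> I \<Longrightarrow> f t \<in> part t" and "\<And>t. t \<in> I \<Longrightarrow> g t \<in> part t"
    and "(\<Sum>t\<in>I. f t) = (\<Sum>t\<in>I. g t)" and "t \<in> I"
  shows "f t = g t"
proof -
  have "proj t (\<Sum>s\<in>I. h s) = h t" if "\<And>t. t \<in> I \<Longrightarrow> h t \<in> part t" for h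
  proof -
    have "proj t (\<Sum>s\<in>I. h s) = (\<Sum>s\<in>I. if t = s then h s else 0)"
      unfolding proj_sum by (intro sum.cong refl) (auto simp: proj_part[OF that])
    thus ?thesis using assms by simp
  qed
  from this[of f] this[of g] show ?thesis using assms by simp
qed

text \<open>Fourier inversion in the variable \<open>v\<close>, with $u = j - i$.\<close>

lemma unit_in_paulis:
  assumes b: "b \<in> F" and ij: "i \<in> words p (fst b)" "j \<in> words p (fst b)"
  shows "\<exists>u\<in>words p (fst b). \<exists>c. snd b i j = (\<Sum>v\<in>words p (fst b). c v *s pauli b u v)"
proof -
  let ?W = "words p (fst b)"
  obtain i' where i': "i' \<in> ?W" "vadd p i i' = (\<lambda>_. 0)" using vadd_inverse[OF p_pos ij(1)] by blast
  define u where "u = vadd p i' j"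
  have u: "u \<in> ?W" using vadd_closed[OF p_pos i'(1) ij(2)] by (simp add: u_def)
  have iu: "vadd p i u = j"
    using i' ij vadd_zero[OF p_pos ij(2)] by (simp add: u_def vadd_comm[of p _ j] flip: vadd_assoc)
       (metis vadd_assoc vadd_comm)
  define c where "c v = inverse (of_nat p ^ fst b) * inverse (chi v i)" for v
  have "(\<Sum>v\<in>?W. c v *s pauli b u v) =
      (\<Sum>w\<in>?W. (\<Sum>v\<in>?W. c v * chi v w) *s snd b w (vadd p w u))"
    unfolding pauli_def scale_sum_right scale_sum_left by (subst sum.swap) simp
  also have "\<dots> = (\<Sum>w\<in>?W. if w = i then snd b w (vadd p w u) else 0)"
  proof (intro sum.cong refl)
    fix w assume w: "w \<in> ?W"
    have "(\<Sum>v\<in>?W. c v * chi v w) = inverse (of_nat p ^ fst b) * (\<Sum>v\<in>?W. chi w v / chi i v)"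
      unfolding sum_distrib_left by (intro sum.cong refl) (simp add: c_def chi_sym[of w] chi_sym[of i] field_simps)
    also have "\<dots> = (if w = i then 1 else 0)"
      using p_nonzero by (simp add: chi_orthogonality_words[OF b w ij(1)])
    finally show "(\<Sum>v\<in>?W. c v * chi v w) *s snd b w (vadd p w u) = (if w = i then snd b w (vadd p w u) else 0)"
      by simp
  qed
  also have "\<dots> = snd b i j" using ij by (simp add: finite_words iu)
  finally show ?thesis using u by metis
qed

lemma parts_span:
  assumes "x \<in> S"
  shows "\<exists>f. (\<forall>t\<in>words p rank \<times> words p rank. f t \<in> part t) \<and> x = (\<Sum>t\<in>words p rank \<times> words p rank. f t)"
proof -
  let ?T = "words p rank \<times> words p rank"
  let ?P = "\<lambda>x. \<exists>f. (\<forall>t\<in>?T. f t \<in> part t) \<and> x = (\<Sum>t\<in>?T. f t)"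
  have sub: "subspace {x. ?P x}"
    unfolding subspace_def
  proof (safe)
    show "?P 0" by (rule exI[of _ "\<lambda>_. 0"]) (simp add: subspace_0[OF subspace_part])
  next
    fix f g assume "\<forall>t\<in>?T. f t \<in> part t" "\<forall>t\<in>?T. g t \<in> part t"
    thus "?P (sum f ?T + sum g ?T)"
      by (intro exI[of _ "\<lambda>t. f t + g t"]) (simp add: subspace_add[OF subspace_part] sum.distrib)
  next
    fix c f assume "\<forall>t\<in>?T. f t \<in> part t"
    thus "?P (c *s sum f ?T)"
      by (intro exI[of _ "\<lambda>t. c *s f t"]) (simp add: subspace_scale[OF subspace_part] scale_sum_right)
  qed
  have pauli: "?P (pauli b u v)" if b: "b \<in> F" "u \<in> words p (fst b)" "v \<in> words p (fst b)" for b u v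
  proof (intro exI conjI ballI)
    let ?f = "\<lambda>t. if t = (u, v) then pauli b u v else 0"
    show "?f t \<in> part t" for t
      using b by (simp add: pauli_in_part subspace_0[OF subspace_part])
    have "(u, v) \<in> ?T" using b words_mono[OF rank_ge[OF b(1)] p_pos] by blast
    thus "pauli b u v = (\<Sum>t\<in>?T. ?f t)" by (simp add: finite_words)
  qed
  have "S \<subseteq> {x. ?P x}"
    unfolding S_span
  proof (rule span_minimal[OF _ sub], safe)
    fix b x assume b: "b \<in> F" and "x \<in> block_entries b"
    then obtain i j where ij: "i \<in> words p (fst b)" "j \<in> words p (fst b)" "x = snd b i j"
      unfolding block_entries_def by (rule matrix_units.entriesE[OF block])
    obtain u c where u: "u \<in> words p (fst b)" and x: "x = (\<Sum>v\<in>words p (fst b). c v *s pauli b u v)"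
      using unit_in_paulis[OF b ij(1,2)] ij(3) by blast
    have "x \<in> {x. ?P x}"
      unfolding x by (intro subspace_sum[OF sub] subspace_scale[OF sub]) (use pauli[OF b u] in simp)
    thus "?P x" by simp
  qed
  thus ?thesis using assms by blast
qed

text \<open>The unit \<open>z\<close> of the algebra has a component in each block. Multiplied by the identity of the
  block \<open>b\<close>, the product becomes a nonzero multiple of one Pauli matrix, also if \<open>ts\<close> is empty.\<close>

lemma pauli_products_nonzero:
  assumes b: "b \<in> F" "fst b = rank" and one: "z \<noteq> 0" "\<And>x. x \<in> S \<Longrightarrow> x \<star> z = x"
    and ts: "set ts \<subseteq> words p rank \<times> words p rank"
  shows "foldr (\<star>) (map (\<lambda>t. pauli b (fst t) (snd t)) ts) z \<noteq> 0"
proof -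
  have "\<exists>c u v. c \<noteq> 0 \<and> u \<in> words p rank \<and>
      block_ident b \<star> foldr (\<star>) (map (\<lambda>t. pauli b (fst t) (snd t)) ts) z = c *s pauli b u v"
    using ts
  proof (induction ts)
    case Nil
    show ?case
      by (rule exI[of _ 1], rule exI[of _ "\<lambda>_. 0"], rule exI[of _ "\<lambda>_. 0"])
         (simp add: one e_in_S b zero_in_words p_pos pauli_zero_eq_e)
  next
    case (Cons t ts)
    let ?r = "foldr (\<star>) (map (\<lambda>t. pauli b (fst t) (snd t)) ts) z"
    from Cons obtain c u v where c: "c \<noteq> 0" "u \<in> words p rank" "block_ident b \<star> ?r = c *s pauli b u v" by auto
    have t: "fst t \<in> words p (fst b)" using Cons.prems b by auto
    have X: "pauli b (fst t) (snd t) \<in> span (block_entries b)" by (rule pauli_in_ent[OF b(1) t])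
    have "block_ident b \<star> (pauli b (fst t) (snd t) \<star> ?r) = pauli b (fst t) (snd t) \<star> (block_ident b \<star> ?r)"
      by (simp add: e_mul[OF b(1) X] mul_e[OF b(1) X] flip: mul_assoc)
    also have "\<dots> = (c * chi v (fst t)) *s pauli b (vadd p (fst t) u) (vadd p (snd t) v)"
      using c t b by (simp add: mul_scale_right pauli_mul)
    finally show ?case
      using c t b chi_nonzero vadd_closed[OF p_pos, of "fst t" rank u]
      by (intro exI[of _ "c * chi v (fst t)"] exI[of _ "vadd p (fst t) u"] exI[of _ "vadd p (snd t) v"]) simp
  qed
  then obtain c u v where "c \<noteq> 0" "u \<in> words p rank"
      "block_ident b \<star> foldr (\<star>) (map (\<lambda>t. pauli b (fst t) (snd t)) ts) z = c *s pauli b u v" by blast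
  thus ?thesis using pauli_nonzero[of b u v] b by auto
qed

end

section \<open>Regular gradings of group algebras\<close>

text \<open>A root of $1 + x + \dots + x^{p-1}$, which is not $1$ as $p \neq 0$ in the field.\<close>

lemma ex_prime_root_of_unity:
  assumes p: "prime p" and char: "of_nat p \<noteq> (0 :: 'k::alg_closed_field)"
  shows "\<exists>\<zeta>::'k. prime_root_of_unity p \<zeta>"
proof -
  have "p \<ge> 2" by (rule prime_ge_2_nat[OF p])
  then obtain \<zeta> :: 'k where "(\<Sum>k\<le>p - 1. 1 * \<zeta> ^ k) = 0"
    using alg_closed[of "p - 1" "\<lambda>_. 1 :: 'k"] by auto
  moreover have "{..p - 1} = {..<p}" using \<open>p \<ge> 2\<close> by auto
  ultimately have sum: "(\<Sum>k<p. \<zeta> ^ k) = 0" by simp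
  have "\<zeta> ^ p - 1 = (\<zeta> - 1) * (\<Sum>k<p. \<zeta> ^ k)" by (rule power_diff_1_eq)
  hence "\<zeta> ^ p = 1" by (simp add: sum)
  moreover have "\<zeta> \<noteq> 1" using sum char by auto
  ultimately have "prime_root_of_unity p \<zeta>" by unfold_locales (use p char in auto)
  thus ?thesis by blast
qed

lemma ex_power_root:
  assumes "n > 0"
  shows "\<exists>d. d ^ n = (c :: 'k::alg_closed_field)"
proof -
  have "degree (monom 1 n - [:c:]) = n"
    using assms by (subst diff_conv_add_uminus, subst degree_add_eq_left) (simp_all add: degree_monom_eq)
  then obtain d where "poly (monom 1 n - [:c:]) d = 0"
    using alg_closed_imp_poly_has_root assms by metis
  thus ?thesis by (auto simp: poly_monom)
qed

lemma finsum_group_algebra: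
  assumes "K_algebra (group_algebra G :: ('k::field, 'g \<Rightarrow> 'k) module)"
    and "finite I" and "\<And>i. i \<in> I \<Longrightarrow> f i \<in> carrier (group_algebra G :: ('k, 'g \<Rightarrow> 'k) module)"
  shows "(\<Oplus>\<^bsub>(group_algebra G :: ('k, 'g \<Rightarrow> 'k) module)\<^esub>i\<in>I. f i) = (\<Sum>i\<in>I. f i)"
  using assms(2,3)
proof (induction I)
  interpret K_algebra "group_algebra G :: ('k, 'g \<Rightarrow> 'k) module" by fact
  {
    case empty
    show ?case by (simp add: zero_group_algebra)
  next
    case (insert i I)
    thus ?case by (subst finsum_insert) (auto simp: add_group_algebra)
  }
qed

text \<open>Assembles the Pauli grading for the given decomposition, with the degrees renamed to natural
  numbers.\<close>

lemma (in group) group_algebra_regular_grading: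
  fixes \<zeta> :: "'k::field"
  assumes fin: "finite (carrier G)" and zeta: "prime_root_of_unity p \<zeta>"
    and splits: "assoc_algebra.splits (fscale :: 'k \<Rightarrow> _) (gmul G) p (carrier (group_algebra G))"
  shows "\<exists>(T :: nat monoid) A. finite (carrier T) \<and>
    regular_grading (group_algebra G :: ('k, 'a \<Rightarrow> 'k) module) T A"
proof -
  let ?KG = "group_algebra G :: ('k, 'a \<Rightarrow> 'k) module"
  interpret KG: K_algebra ?KG by (rule group_algebra_K_algebra)
  interpret A: assoc_algebra "fscale :: 'k \<Rightarrow> ('a \<Rightarrow> 'k) \<Rightarrow> _" "gmul G"
    by (rule assoc_algebra_gmul[OF fin])
  obtain F where F: "block_decomposition fscale (gmul G) p F (carrier ?KG)"
    using splits by (auto simp: A.splits_def)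
  interpret B: block_decomposition fscale "gmul G" p F "carrier ?KG" by fact
  interpret prime_root_of_unity p \<zeta> by fact
  have one_nz: "\<one>\<^bsub>?KG\<^esub> \<noteq> 0" by (auto simp: one_group_algebra delta_def fun_eq_iff)
  have "F \<noteq> {}"
  proof
    assume "F = {}"
    hence "carrier ?KG = {0}" using B.S_span by simp
    thus False using one_nz KG.one_closed by auto
  qed
  then interpret pauli_grading fscale "gmul G" p F "carrier ?KG" \<zeta>
    by unfold_locales
  let ?W = "words p rank"
  interpret W: comm_group "word_pairs p rank" by (rule comm_group_word_pairs[OF p_pos])
  have carrier_W: "carrier (word_pairs p rank) = ?W \<times> ?W" by (simp add: word_pairs_def)
  obtain T :: "nat monoid" and h where T: "comm_group T" "finite (carrier T)"
    and h: "bij_betw h (carrier T) (?W \<times> ?W)"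
    and h_mult: "\<And>i j. i \<in> carrier T \<Longrightarrow> j \<in> carrier T \<Longrightarrow>
      h (i \<otimes>\<^bsub>T\<^esub> j) = h i \<otimes>\<^bsub>word_pairs p rank\<^esub> h j"
    using comm_group_on_nat[OF W.comm_group_axioms] finite_words unfolding carrier_W by blast
  interpret T: comm_group T by (rule T(1))
  define C where "C i = part (h i)" for i
  have C_sub: "C i \<subseteq> carrier ?KG" for i by (simp add: C_def part_subset)
  have C_subspace: "A.subspace (C i)" for i by (simp add: C_def subspace_part)
  have "regular_grading ?KG T C"
  proof (intro regular_grading.intro regular_grading_axioms.intro KG.K_algebra_axioms T(1))
    fix i assume "i \<in> carrier T"
    show "submodule (C i) (ring_of_type_algebra :: 'k ring) ?KG"
    proof (rule KG.submoduleI)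
      show "C i \<subseteq> carrier ?KG" by (rule C_sub)
      show "\<zero>\<^bsub>?KG\<^esub> \<in> C i" using A.subspace_0[OF C_subspace] by (simp add: zero_group_algebra)
    next
      fix a assume a: "a \<in> C i"
      hence "a \<in> carrier ?KG" using C_sub by blast
      hence "\<ominus>\<^bsub>?KG\<^esub> a = - a"
        using A.subspace_neg[OF C_subspace a] C_sub
        by (intro KG.minus_equality) (auto simp: add_group_algebra zero_group_algebra)
      thus "\<ominus>\<^bsub>?KG\<^esub> a \<in> C i" using A.subspace_neg[OF C_subspace a] by simp
    next
      fix a b assume "a \<in> C i" "b \<in> C i"
      thus "a \<oplus>\<^bsub>?KG\<^esub> b \<in> C i" by (simp add: add_group_algebra A.subspace_add[OF C_subspace])
    next
      fix c :: 'k and a assume "a \<in> C i"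
      thus "c \<odot>\<^bsub>?KG\<^esub> a \<in> C i" by (simp add: smult_group_algebra A.subspace_scale[OF C_subspace])
    qed
  next
    fix r assume r: "r \<in> carrier ?KG"
    have sum_eq: "(\<Oplus>\<^bsub>?KG\<^esub>t\<in>{t \<in> carrier T. f t \<noteq> \<zero>\<^bsub>?KG\<^esub>}. f t) = (\<Sum>t\<in>carrier T. f t)"
      if "f \<in> (\<Pi>\<^sub>E t\<in>carrier T. C t)" for f
    proof -
      have "f t \<in> carrier ?KG" if "t \<in> carrier T" for t
        using that \<open>f \<in> _\<close> C_sub by (auto simp: PiE_def Pi_def)
      hence "(\<Oplus>\<^bsub>?KG\<^esub>t\<in>{t \<in> carrier T. f t \<noteq> \<zero>\<^bsub>?KG\<^esub>}. f t) = (\<Sum>t\<in>{t \<in> carrier T. f t \<noteq> \<zero>\<^bsub>?KG\<^esub>}. f t)"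
        using T(2) by (intro finsum_group_algebra[OF KG.K_algebra_axioms]) auto
      also have "\<dots> = (\<Sum>t\<in>carrier T. f t)"
        using T(2) by (intro sum.mono_neutral_left) (auto simp: zero_group_algebra)
      finally show ?thesis .
    qed
    show "\<exists>!f. f \<in> (\<Pi>\<^sub>E t\<in>carrier T. C t) \<and> finite {t \<in> carrier T. f t \<noteq> \<zero>\<^bsub>?KG\<^esub>} \<and>
        r = (\<Oplus>\<^bsub>?KG\<^esub>t\<in>{t \<in> carrier T. f t \<noteq> \<zero>\<^bsub>?KG\<^esub>}. f t)"
    proof (rule ex_ex1I)
      obtain f where f: "\<forall>t\<in>?W \<times> ?W. f t \<in> part t" "r = (\<Sum>t\<in>?W \<times> ?W. f t)"
        using parts_span[OF r] by blast
      define f' where "f' = restrict (\<lambda>i. f (h i)) (carrier T)"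
      have f': "f' \<in> (\<Pi>\<^sub>E t\<in>carrier T. C t)"
        unfolding f'_def C_def by (intro restrict_PiE_iff[THEN iffD2] ballI f(1)[rule_format] bij_betw_apply[OF h])
      have "r = (\<Sum>t\<in>carrier T. f (h t))"
        unfolding f(2) by (rule sum.reindex_bij_betw[OF h, symmetric])
      also have "\<dots> = (\<Sum>t\<in>carrier T. f' t)" by (simp add: f'_def)
      finally show "\<exists>f. f \<in> (\<Pi>\<^sub>E t\<in>carrier T. C t) \<and> finite {t \<in> carrier T. f t \<noteq> \<zero>\<^bsub>?KG\<^esub>} \<and>
          r = (\<Oplus>\<^bsub>?KG\<^esub>t\<in>{t \<in> carrier T. f t \<noteq> \<zero>\<^bsub>?KG\<^esub>}. f t)"
        using f' T(2) by (intro exI[of _ f']) (simp add: sum_eq)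
    next
      fix f g
      assume f: "f \<in> (\<Pi>\<^sub>E t\<in>carrier T. C t) \<and> finite {t \<in> carrier T. f t \<noteq> \<zero>\<^bsub>?KG\<^esub>} \<and>
          r = (\<Oplus>\<^bsub>?KG\<^esub>t\<in>{t \<in> carrier T. f t \<noteq> \<zero>\<^bsub>?KG\<^esub>}. f t)"
        and g: "g \<in> (\<Pi>\<^sub>E t\<in>carrier T. C t) \<and> finite {t \<in> carrier T. g t \<noteq> \<zero>\<^bsub>?KG\<^esub>} \<and>
          r = (\<Oplus>\<^bsub>?KG\<^esub>t\<in>{t \<in> carrier T. g t \<noteq> \<zero>\<^bsub>?KG\<^esub>}. g t)"
      define k where "k = inv_into (carrier T) h"
      have k: "bij_betw k (?W \<times> ?W) (carrier T)" unfolding k_def by (rule bij_betw_inv_into[OF h])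
      have hk: "h (k t) = t" if "t \<in> ?W \<times> ?W" for t
        unfolding k_def by (rule bij_betw_inv_into_right[OF h that])
      have kh: "k (h i) = i" if "i \<in> carrier T" for i
        unfolding k_def by (rule bij_betw_inv_into_left[OF h that])
      have in_part: "f' (k t) \<in> part t" if "f' \<in> (\<Pi>\<^sub>E t\<in>carrier T. C t)" "t \<in> ?W \<times> ?W" for f' t
        using PiE_mem[OF that(1) bij_betw_apply[OF k that(2)]] hk[OF that(2)] by (simp add: C_def)
      have "r = (\<Sum>t\<in>carrier T. f t)" "r = (\<Sum>t\<in>carrier T. g t)"
        using conjunct2[OF conjunct2[OF f]] conjunct2[OF conjunct2[OF g]]
        by (simp_all only: sum_eq[OF conjunct1[OF f]] sum_eq[OF conjunct1[OF g]])
      hence "(\<Sum>t\<in>carrier T. f t) = (\<Sum>t\<in>carrier T. g t)" by simp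
      hence eq: "(\<Sum>t\<in>?W \<times> ?W. f (k t)) = (\<Sum>t\<in>?W \<times> ?W. g (k t))"
        by (simp only: sum.reindex_bij_betw[OF k])
      have "f (k t) = g (k t)" if "t \<in> ?W \<times> ?W" for t
        by (rule parts_independent[OF _ in_part[OF conjunct1[OF f]] in_part[OF conjunct1[OF g]] eq that])
           (simp_all add: finite_words)
      hence "f i = g i" if "i \<in> carrier T" for i
        using kh[OF that] bij_betw_apply[OF h that] by metis
      thus "f = g" by (rule PiE_ext[OF conjunct1[OF f] conjunct1[OF g]])
    qed
  next
    fix s t a b assume st: "s \<in> carrier T" "t \<in> carrier T" and ab: "a \<in> C s" "b \<in> C t"
    have "h (s \<otimes>\<^bsub>T\<^esub> t) = (vadd p (fst (h s)) (fst (h t)), vadd p (snd (h s)) (snd (h t)))"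
      by (simp add: h_mult[OF st] word_pairs_def split: prod.split)
    moreover have "a \<otimes>\<^bsub>?KG\<^esub> b = gmul G a b" using ab C_sub by (intro mult_group_algebra) auto
    ultimately show "a \<otimes>\<^bsub>?KG\<^esub> b \<in> C (s \<otimes>\<^bsub>T\<^esub> t)"
      using part_mul ab by (simp add: C_def)
  next
    fix ts assume ts: "set ts \<subseteq> carrier T"
    obtain b where b: "b \<in> F" "fst b = rank" using rank_attained by blast
    let ?x = "\<lambda>i. pauli b (fst (h i)) (snd (h i))"
    have x: "?x i \<in> C i" if "i \<in> carrier T" for i
      using pauli_in_part[OF b(1), of "fst (h i)" "snd (h i)"] bij_betw_apply[OF h that] b(2)
      by (auto simp: C_def)
    have foldr_eq: "foldr (\<otimes>\<^bsub>?KG\<^esub>) (map ?x ts) \<one>\<^bsub>?KG\<^esub> = foldr (gmul G) (map ?x ts) \<one>\<^bsub>?KG\<^esub> \<and>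
      foldr (\<otimes>\<^bsub>?KG\<^esub>) (map ?x ts) \<one>\<^bsub>?KG\<^esub> \<in> carrier ?KG"
      using ts
    proof (induction ts)
      case (Cons i ts)
      hence xi: "?x i \<in> carrier ?KG" using x C_sub by auto
      from Cons have IH: "foldr (\<otimes>\<^bsub>?KG\<^esub>) (map ?x ts) \<one>\<^bsub>?KG\<^esub> = foldr (gmul G) (map ?x ts) \<one>\<^bsub>?KG\<^esub>"
        "foldr (\<otimes>\<^bsub>?KG\<^esub>) (map ?x ts) \<one>\<^bsub>?KG\<^esub> \<in> carrier ?KG" by auto
      show ?case
        using KG.m_closed[OF xi IH(2)] mult_group_algebra[OF xi IH(2)] IH(1) by simp
    qed simp
    have "foldr (gmul G) (map (\<lambda>t. pauli b (fst t) (snd t)) (map h ts)) \<one>\<^bsub>?KG\<^esub> \<noteq> 0"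
    proof (rule pauli_products_nonzero[OF b one_nz])
      show "gmul G y \<one>\<^bsub>?KG\<^esub> = y" if "y \<in> carrier ?KG" for y
        using KG.r_one[OF that] that by (simp add: mult_group_algebra)
      show "set (map h ts) \<subseteq> ?W \<times> ?W" using ts bij_betw_apply[OF h]
        unfolding set_map by blast
    qed
    hence "foldr (gmul G) (map ?x ts) \<one>\<^bsub>?KG\<^esub> \<noteq> 0" by (simp add: comp_def)
    moreover have "list_all2 (\<lambda>a t. a \<in> C t) (map ?x ts) ts"
      unfolding list_all2_conv_all_nth using ts nth_mem by (auto intro!: x)
    ultimately show "\<exists>as. list_all2 (\<lambda>a t. a \<in> C t) as ts \<and> foldr (\<otimes>\<^bsub>?KG\<^esub>) as \<one>\<^bsub>?KG\<^esub> \<noteq> \<zero>\<^bsub>?KG\<^esub>"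
      using foldr_eq by (intro exI[of _ "map ?x ts"]) (simp add: zero_group_algebra)
  next
    fix s t assume st: "s \<in> carrier T" "t \<in> carrier T"
    let ?c = "chi (snd (h t)) (fst (h s)) / chi (snd (h s)) (fst (h t))"
    have "a \<otimes>\<^bsub>?KG\<^esub> b = ?c \<odot>\<^bsub>?KG\<^esub> (b \<otimes>\<^bsub>?KG\<^esub> a)" if ab: "a \<in> C s" "b \<in> C t" for a b
    proof -
      have car: "a \<in> carrier ?KG" "b \<in> carrier ?KG" using ab C_sub by auto
      show ?thesis
        using part_commute[OF ab[unfolded C_def]]
        by (simp only: mult_group_algebra[OF car] mult_group_algebra[OF car(2,1)] smult_group_algebra)
    qed
    moreover have "?c \<noteq> 0" using chi_nonzero by simp
    ultimately show "\<exists>\<theta>::'k. \<theta> \<noteq> 0 \<and> (\<forall>a\<in>C s. \<forall>b\<in>C t. a \<otimes>\<^bsub>?KG\<^esub> b = \<theta> \<odot>\<^bsub>?KG\<^esub> (b \<otimes>\<^bsub>?KG\<^esub> a))"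
      by blast
  qed
  thus ?thesis using T(2) by blast
qed

theorem corollary66:
  fixes G :: "'g monoid" and p n :: nat
  assumes "CHAR('k::alg_closed_field) \<noteq> 2"
    and "group G" and "finite (carrier G)" and "\<not> comm_group G"
    and "prime p" and "Coset.order G = p ^ n"
    and "CHAR('k) = 0 \<or> \<not> CHAR('k) dvd Coset.order G"
  shows "\<exists>(T :: nat monoid) A. finite (carrier T) \<and>
    regular_grading (group_algebra G :: ('k, 'g \<Rightarrow> 'k) module) T A"
proof -
  interpret group G by fact
  \<comment> \<open>A non-abelian group is not trivial, so \<open>p\<close> divides its order and is invertible in the field.\<close>
  have "n \<noteq> 0"
  proof
    assume "n = 0"
    hence "card (carrier G) = 1" using assms by (simp add: Coset.order_def)
    then obtain a where "carrier G = {a}" by (auto simp: card_1_singleton_iff)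
    hence "comm_group G" by (intro group_comm_groupI) auto
    thus False using assms by simp
  qed
  have char: "of_nat p \<noteq> (0 :: 'k)"
  proof
    assume "of_nat p = (0 :: 'k)"
    hence "CHAR('k) dvd p" by (simp add: of_nat_eq_0_iff_char_dvd)
    moreover from this have "CHAR('k) \<noteq> 0" using prime_gt_0_nat[OF \<open>prime p\<close>] by auto
    ultimately show False
      using assms \<open>n \<noteq> 0\<close> dvd_trans[OF _ dvd_power[of n p]] by auto
  qed
  obtain \<zeta> :: 'k where zeta: "prime_root_of_unity p \<zeta>"
    using ex_prime_root_of_unity[OF \<open>prime p\<close> char] by blast
  have "assoc_algebra.splits (fscale :: 'k \<Rightarrow> _) (gmul G) p (module.span fscale (delta ` carrier G))"
    by (rule splits_prime_power_subgroup[OF \<open>finite (carrier G)\<close> zeta _ subgroup_self])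
       (use assms ex_power_root prime_gt_0_nat in \<open>auto simp: Coset.order_def\<close>)
  thus ?thesis
    using group_algebra_regular_grading[OF \<open>finite (carrier G)\<close> zeta]
    by (simp add: span_delta_carrier[OF \<open>finite (carrier G)\<close>])
qed

end
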